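(* Let $\mu_+,\mu_-$ be nonnegative finite Borel measures on $\mathbb{R}^n$ with bounded support and let $\tau$ be a concave transportation cost. Then either the minimization problem $\min_\chi J^{\tau,\mu_+,\mu_-}[\chi]$ over irrigation patterns $\chi:\Gamma\times I\to\mathbb{R}^n$ has a solution, or $J^{\tau,\mu_+,\mu_-}[\chi]=\infty$ for all irrigation patterns $\chi$.
   Context: Transportation cost: $\tau:[0,\infty)\to[0,\infty)$, $\tau(0)=0$, $\tau(w)>0$ for $w>0$, non-decreasing, subadditive, lower semi-continuous. A reference space $(\Gamma,\mathcal B(\Gamma),\mathbb P)$ is a complete separable uncountable metric space with a positive finite atomless Borel measure $\mathbb P$ (fixed). $I=[0,1]$. An irrigation pattern is a measurable $\chi:\Gamma\times I\to\mathbb{R}^n$ such that $\chi_p=\chi(p,\cdot)$ is absolutely continuous for $\mathbb P$-a.e. $p$; $\mu_\pm^\chi$ are the pushforwards of $\mathbb P$ under $p\mapsto\chi(p,0)$ resp. $p\mapsto\chi(p,1)$. $m_\chi(x)=\mathbb P(\{q:x\in\chi_q(I)\})$; $r^\tau(w)=\tau(w)/w$ for $w>0$, $r^\tau(0)=\lim_{w\downarrow0}\tau(w)/w$; $J^\tau(\chi)=\int_{\Gamma\times I}r^\tau(m_\chi(\chi(p,t)))|\dot\chi(p,t)|\,d\mathbb P(p)\,dt$; $J^{\tau,\mu_+,\mu_-}[\chi]=J^\tau(\chi)$ if $\mu_+^\chi=\mu_+$ and $\mu_-^\chi=\mu_-$, and $+\infty$ otherwise. *)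

theory Defs
  imports "HOL-Analysis.Analysis"
begin

definition transportation_cost :: "(real \<Rightarrow> real) \<Rightarrow> bool" where
  "transportation_cost \<tau> \<longleftrightarrow>
     \<tau> 0 = 0 \<and>
     (\<forall>w>0. \<tau> w > 0) \<and>
     (\<forall>v w. 0 \<le> v \<longrightarrow> v \<le> w \<longrightarrow> \<tau> v \<le> \<tau> w) \<and>
     (\<forall>v w. 0 \<le> v \<longrightarrow> 0 \<le> w \<longrightarrow> \<tau> (v + w) \<le> \<tau> v + \<tau> w) \<and>
     (\<forall>w\<ge>0. \<forall>x. (\<lambda>n. x n) \<longlonglongrightarrow> w \<longrightarrow> (\<forall>n. x n \<ge> 0) \<longrightarrow>
              ereal (\<tau> w) \<le> liminf (\<lambda>n. ereal (\<tau> (x n))))"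

definition reference_measure :: "'g::polish_space measure \<Rightarrow> bool" where
  "reference_measure P \<longleftrightarrow>
     uncountable (UNIV :: 'g set) \<and>
     space P = UNIV \<and> sets P = sets borel \<and>
     finite_measure P \<and> emeasure P UNIV \<noteq> 0 \<and>
     (\<forall>x. emeasure P {x} = 0)"

definition abs_cont_on_I :: "(real \<Rightarrow> 'a::real_normed_vector) \<Rightarrow> bool" where
  "abs_cont_on_I f \<longleftrightarrow>
     (\<forall>\<epsilon>>0. \<exists>\<delta>>0. \<forall>(N::nat) (a::nat \<Rightarrow> real) b.
        (\<forall>k<N. 0 \<le> a k \<and> a k \<le> b k \<and> b k \<le> 1) \<longrightarrow>
        (\<forall>k<N. \<forall>j<N. k \<noteq> j \<longrightarrow> {a k<..<b k} \<inter> {a j<..<b j} = {}) \<longrightarrow>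
        (\<Sum>k<N. b k - a k) < \<delta> \<longrightarrow>
        (\<Sum>k<N. norm (f (b k) - f (a k))) < \<epsilon>)"

abbreviation I_measure :: "real measure" where
  "I_measure \<equiv> restrict_space lborel {0..1}"

definition irrigation_pattern :: "'g measure \<Rightarrow> ('g \<Rightarrow> real \<Rightarrow> 'b::euclidean_space) \<Rightarrow> bool" where
  "irrigation_pattern P chi \<longleftrightarrow>
     (\<lambda>(p, t). chi p t) \<in> borel_measurable (P \<Otimes>\<^sub>M I_measure) \<and>
     (AE p in P. abs_cont_on_I (chi p))"

definition mu_plus :: "'g measure \<Rightarrow> ('g \<Rightarrow> real \<Rightarrow> 'b::euclidean_space) \<Rightarrow> 'b measure" where
  "mu_plus P chi = distr P borel (\<lambda>p. chi p 0)"

definition mu_minus :: "'g measure \<Rightarrow> ('g \<Rightarrow> real \<Rightarrow> 'b::euclidean_space) \<Rightarrow> 'b measure" where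
  "mu_minus P chi = distr P borel (\<lambda>p. chi p 1)"

text \<open>m_chi(x) = P({q. x in chi_q(I)}); the set is analytic hence measurable for the completion.\<close>
definition m_chi :: "'g measure \<Rightarrow> ('g \<Rightarrow> real \<Rightarrow> 'b) \<Rightarrow> 'b \<Rightarrow> real" where
  "m_chi P chi x = measure (completion P) {q \<in> space P. x \<in> chi q ` {0..1}}"

definition r_tau :: "(real \<Rightarrow> real) \<Rightarrow> real \<Rightarrow> ennreal" where
  "r_tau \<tau> w = (if w > 0 then ennreal (\<tau> w / w)
                 else Lim (at_right 0) (\<lambda>v. ennreal (\<tau> v / v)))"

definition J_tau :: "(real \<Rightarrow> real) \<Rightarrow> 'g measure \<Rightarrow> ('g \<Rightarrow> real \<Rightarrow> 'b::euclidean_space) \<Rightarrow> ennreal" where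
  "J_tau \<tau> P chi =
     (\<integral>\<^sup>+ (p, t). r_tau \<tau> (m_chi P chi (chi p t)) * ennreal (norm (vector_derivative (chi p) (at t)))
        \<partial>(P \<Otimes>\<^sub>M I_measure))"

definition J_tau_mu :: "(real \<Rightarrow> real) \<Rightarrow> 'g measure \<Rightarrow> 'b measure \<Rightarrow> 'b measure
                        \<Rightarrow> ('g \<Rightarrow> real \<Rightarrow> 'b::euclidean_space) \<Rightarrow> ennreal" where
  "J_tau_mu \<tau> P \<mu>p \<mu>m chi =
     (if mu_plus P chi = \<mu>p \<and> mu_minus P chi = \<mu>m then J_tau \<tau> P chi else \<infinity>)"

definition finite_borel_bounded_support :: "'b::euclidean_space measure \<Rightarrow> bool" where
  "finite_borel_bounded_support \<mu> \<longleftrightarrow>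
     sets \<mu> = sets borel \<and> finite_measure \<mu> \<and> (\<exists>R. emeasure \<mu> (- cball 0 R) = 0)"

end

theory Submission
  imports Defs "HOL-Probability.Probability"
begin

text \<open>
  Direct method. Given a minimizing sequence of finite cost, each path is reparametrized
  proportionally to arc length; since \<open>r\<close> is nonincreasing, the cost controls the mean length.
  The Lipschitz paths are recorded by countably many coordinates in \<open>(0,1)\<close> and coded by
  a single real number, so that Helly's selection theorem and Skorohod's theorem on the real line
  yield almost sure convergence of the paths, uniformly in time, on an auxiliary probability space.
  The limit law lives on the real line and is transported back to the atomless space
  \<open>P\<close>.

  Semicontinuity avoids derivatives in the limit: the multiplicity is replaced by the mass of the
  paths meeting a closed ball, which is upper semicontinuous, and the time integral by a finite sum
  of increments. The resulting discrete energies bound the cost from below (fundamental theorem of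
  calculus along the original paths), pass to the limit by Fatou's lemma, depend only on the law of
  the pattern, and their supremum is at least the cost of a Lipschitz pattern.
\<close>

text \<open>The obstacle is that \<open>m_chi\<close> couples all the paths: the cost is not the
  integral of a function of a single path, so semicontinuity of length for one curve is not enough.
  The monotonicity of \<open>r_tau \<tau>\<close> supplies the right sign: an upper bound for
  multiplicities is a lower bound for costs, and closed conditions give upper bounds that survive
  limits. The parameters are removed in a fixed order. With the number of pieces and the radius
  fixed, the patterns pass to their limit; then the number of pieces tends to infinity; only then
  does the radius tend to 0. Compactness has two sources. The bounded support of
  \<open>\<mu>p\<close> confines almost all starting points to one ball. Lengths are bounded only in
  mean, so for a fixed sample Fatou's lemma gives just a finite lower limit of the lengths.
  Squashing lengths into (0,1) makes this enough: the squashed lengths converge along the whole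
  sequence, and a finite lower limit keeps their limit away from the end that stands for
  infinity.\<close>

section \<open>Differentiation of absolutely continuous curves\<close>

text \<open>Regularity gives an open \<open>U\<close> containing \<open>A = {h < u}\<close> such that
  \<open>\<bar>h - u\<bar>\<close> has small integral on \<open>U - A\<close>. An interval in \<open>U\<close> with mean of
  \<open>h\<close> above \<open>v\<close> spends at least the fraction \<open>v - u\<close> of its length on that integral,
  so a disjoint Vitali family of such intervals is short.\<close>

lemma negligible_upper_derivate_gt:
  fixes h F :: "real \<Rightarrow> real"
  assumes h: "integrable lborel h" and uv: "u < v"
    and F: "\<And>a b. a \<le> b \<Longrightarrow> F b - F a = (LINT t:{a..b}|lborel. h t)"
  shows "negligible {x. h x < u \<and>
      (\<forall>d>0. \<exists>a b. a \<le> x \<and> x \<le> b \<and> a < b \<and> b - a < d \<and> v * (b - a) < F b - F a)}"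
    (is "negligible ?S")
proof -
  have [measurable]: "h \<in> borel_measurable borel" using h by auto
  have "negligible (?S \<inter> ball 0 (real n))" for n
    unfolding negligible_outer_le
  proof (intro allI impI)
    fix e :: real assume e: "e > 0"
    define B where "B = ball (0::real) (real n)"
    have [measurable]: "B \<in> sets borel" and openB: "open B" by (auto simp: B_def)
    define M where "M = density lborel (\<lambda>x. ennreal (indicator B x * \<bar>h x - u\<bar>))"
    have setsM [measurable_cong, simp]: "sets M = sets borel" by (simp add: M_def)
    have emM: "emeasure M X = (\<integral>\<^sup>+x. ennreal (indicator B x * \<bar>h x - u\<bar>) * indicator X x \<partial>lborel)"
      if "X \<in> sets borel" for X
      unfolding M_def using that by (subst emeasure_density) auto
    have "integrable lborel (\<lambda>x. indicator B x * (h x - u))"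
    proof -
      have "integrable lborel (\<lambda>x. indicator B x * h x)"
        using integrable_mult_indicator[OF _ h, of B] by simp
      moreover have "integrable lborel (\<lambda>x. indicator B x * u)"
        by (auto simp: B_def intro!: integrable_mult_left integrable_real_indicator
              emeasure_bounded_finite)
      ultimately show ?thesis
        by (simp add: right_diff_distrib)
    qed
    then have fin: "(\<integral>\<^sup>+x. ennreal (norm (indicator B x * (h x - u))) \<partial>lborel) < \<infinity>"
      by (simp add: integrable_iff_bounded)
    have "emeasure M UNIV = (\<integral>\<^sup>+x. ennreal (norm (indicator B x * (h x - u))) \<partial>lborel)"
      by (subst emM) (auto simp: abs_mult intro!: nn_integral_cong)
    then have finM: "emeasure M UNIV < \<infinity>" using fin by simp
    interpret M: finite_measure M
      by standard (use finM sets_eq_imp_space_eq[OF setsM] in auto)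
    define A where "A = {x. h x < u}"
    have [measurable]: "A \<in> sets borel" by (simp add: A_def)
    define e' where "e' = e * (v - u) / 4"
    have e': "e' > 0" using e uv by (simp add: e'_def)
    have "emeasure M A = (INF U \<in> {U. A \<subseteq> U \<and> open U}. emeasure M U)"
      by (rule outer_regular) (use finM in auto)
    moreover have "emeasure M A < emeasure M A + ennreal e'"
      using e' M.emeasure_finite[of A] by (simp add: ennreal_add_left_cancel_less top.not_eq_extremum)
    ultimately obtain U where U: "A \<subseteq> U" "open U" "emeasure M U < emeasure M A + ennreal e'"
      by (metis (mono_tags, lifting) INF_less_iff mem_Collect_eq)
    have [measurable]: "U \<in> sets borel" using U by simp
    have "emeasure M (U - A) = emeasure M U - emeasure M A"
      using U by (subst emeasure_Diff) auto
    then have MUA: "emeasure M (U - A) \<le> ennreal e'"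
      using U(3) by (metis add.commute ennreal_minus_le_iff less_imp_le M.emeasure_finite top_neq_ennreal ennreal_enn2real)
    define S where "S = ?S \<inter> ball 0 (real n)"
    \<comment> \<open>The ball chosen below has radius \<open>2 * (b - a)\<close>, hence length
      \<open>4 * (b - a)\<close>, while the mass of \<open>\<bar>h - u\<bar>\<close> on
      \<open>{a..b} - A\<close> is at least \<open>(v - u) * (b - a)\<close>. The ratio of the two
      is the constant \<open>(v - u) / 4\<close>.\<close>
    define K where "K = {(x, r). 0 < r \<and> x \<in> S \<and> ball x r \<subseteq> U \<inter> B \<and>
        ennreal ((v - u) / 4) * emeasure lborel (ball x r) \<le> emeasure M (ball x r - A)}"
    have ex: "\<exists>i. i \<in> K \<and> x \<in> ball (fst i) (snd i) \<and> snd i < d" if x: "x \<in> S" and d: "d > 0" for x d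
    proof -
      have "x \<in> U \<inter> B" using x U by (auto simp: S_def A_def B_def)
      then obtain r0 where r0: "r0 > 0" "ball x r0 \<subseteq> U \<inter> B"
        using U(2) openB open_contains_ball by (metis open_Int)
      obtain a b where ab: "a \<le> x" "x \<le> b" "a < b" "b - a < min (d/2) (r0/2)" "v * (b - a) < F b - F a"
        using x r0(1) d unfolding S_def by (smt (verit) IntD1 mem_Collect_eq half_gt_zero)
      define r where "r = 2 * (b - a)"
      have r: "0 < r" "r < d" "r < r0" using ab by (auto simp: r_def)
      have sub: "ball x r \<subseteq> U \<inter> B" using r r0(2) subset_ball[of r r0 x] by auto
      have abB: "{a..b} \<subseteq> ball x r" using ab by (auto simp: r_def dist_real_def)
      have int1: "set_integrable lborel {a..b} h"
        unfolding set_integrable_def by (rule integrable_mult_indicator[OF _ h]) auto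
      have int3: "integrable lborel (\<lambda>t. indicator {a..b} t * u)"
        by (intro integrable_mult_left integrable_real_indicator) (auto simp: emeasure_lborel_Icc_eq)
      have int4: "integrable lborel (\<lambda>t. indicator {a..b} t * h t)"
        using int1 by (simp add: set_integrable_def)
      have int2: "integrable lborel (\<lambda>t. indicator {a..b} t * (h t - u))"
        using Bochner_Integration.integrable_diff[OF int4 int3] by (simp add: right_diff_distrib)
      have "(\<integral>t. indicator {a..b} t * (h t - u) \<partial>lborel) = (F b - F a) - u * (b - a)"
      proof -
        have "(\<integral>t. indicator {a..b} t * (h t - u) \<partial>lborel) =
           (\<integral>t. indicator {a..b} t * h t - indicator {a..b} t * u \<partial>lborel)"
          by (simp add: right_diff_distrib)
        also have "\<dots> = (\<integral>t. indicator {a..b} t * h t \<partial>lborel) - (\<integral>t. indicator {a..b} t * u \<partial>lborel)"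
          by (rule Bochner_Integration.integral_diff[OF int4 int3])
        finally show ?thesis using ab F[of a b] by (simp add: set_lebesgue_integral_def mult.commute)
      qed
      then have "(v - u) * (b - a) \<le> (\<integral>t. indicator {a..b} t * (h t - u) \<partial>lborel)"
        using ab by (simp add: algebra_simps)
      then have "ennreal ((v - u) * (b - a)) \<le> ennreal (\<integral>t. indicator {a..b} t * (h t - u) \<partial>lborel)"
        by (rule ennreal_leI)
      also have "\<dots> \<le> (\<integral>\<^sup>+t. ennreal (indicator {a..b} t * (h t - u)) \<partial>lborel)"
      proof -
        have "ennreal (\<integral>t. indicator {a..b} t * (h t - u) \<partial>lborel) \<le> ennreal (\<integral>t. max 0 (indicator {a..b} t * (h t - u)) \<partial>lborel)"
          using int2 by (intro ennreal_leI integral_mono) auto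
        moreover have "ennreal (\<integral>t. max 0 (indicator {a..b} t * (h t - u)) \<partial>lborel) =
            (\<integral>\<^sup>+t. ennreal (max 0 (indicator {a..b} t * (h t - u))) \<partial>lborel)"
          using int2 by (intro nn_integral_eq_integral[symmetric]) auto
        moreover have "(\<integral>\<^sup>+t. ennreal (max 0 (indicator {a..b} t * (h t - u))) \<partial>lborel) =
            (\<integral>\<^sup>+t. ennreal (indicator {a..b} t * (h t - u)) \<partial>lborel)"
          by (intro nn_integral_cong) (simp add: max_def ennreal_neg)
        ultimately show ?thesis by (simp only:)
      qed
      also have "\<dots> \<le> (\<integral>\<^sup>+t. ennreal (indicator B t * \<bar>h t - u\<bar>) * indicator (ball x r - A) t \<partial>lborel)"
        using abB sub by (intro nn_integral_mono)
           (auto simp: indicator_def A_def ennreal_neg intro!: ennreal_leI)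
      also have "\<dots> = emeasure M (ball x r - A)" by (subst emM) auto
      finally have *: "ennreal ((v - u) * (b - a)) \<le> emeasure M (ball x r - A)" .
      have "ball x r = {x - r<..<x + r}" by (auto simp: dist_real_def)
      then have "emeasure lborel (ball x r) = ennreal (4 * (b - a))"
        using r by (simp add: r_def)
      then have "ennreal ((v - u) / 4) * emeasure lborel (ball x r) = ennreal ((v - u) * (b - a))"
        using uv ab by (simp add: ennreal_mult[symmetric])
      with * r sub x show ?thesis by (intro exI[of _ "(x, r)"]) (auto simp: K_def)
    qed
    obtain C where C: "countable C" "C \<subseteq> K"
      "pairwise (\<lambda>i j. disjnt (ball (fst i) (snd i)) (ball (fst j) (snd j))) C"
      "negligible (S - (\<Union>i \<in> C. ball (fst i) (snd i)))"
      by (rule Vitali_covering_theorem_balls[of S K fst snd, OF ex]) (use that in blast)+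
    define T where "T = (\<Union>i \<in> C. ball (fst i) (snd i))"
    have [measurable]: "T \<in> sets borel" unfolding T_def by (intro borel_open open_UN) auto
    have disj: "disjoint_family_on (\<lambda>i. ball (fst i) (snd i)) C"
      using C(3) by (auto simp: disjoint_family_on_def pairwise_def disjnt_def)
    have disj': "disjoint_family_on (\<lambda>i. ball (fst i) (snd i) - A) C"
      using disj unfolding disjoint_family_on_def by blast
    have "ennreal ((v - u) / 4) * emeasure lborel T =
        ennreal ((v - u) / 4) * (\<integral>\<^sup>+i. emeasure lborel (ball (fst i) (snd i)) \<partial>count_space C)"
      unfolding T_def using C(1) disj by (subst emeasure_UN_countable) auto
    also have "\<dots> = (\<integral>\<^sup>+i. ennreal ((v - u) / 4) * emeasure lborel (ball (fst i) (snd i)) \<partial>count_space C)"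
      by (subst nn_integral_cmult) auto
    also have "\<dots> \<le> (\<integral>\<^sup>+i. emeasure M (ball (fst i) (snd i) - A) \<partial>count_space C)"
      using C(2) by (intro nn_integral_mono) (auto simp: K_def)
    also have "\<dots> = emeasure M (\<Union>i\<in>C. ball (fst i) (snd i) - A)"
      using C(1) disj' by (subst emeasure_UN_countable) auto
    also have "\<dots> \<le> emeasure M (U - A)"
      using C(2) by (intro emeasure_mono) (fastforce simp: K_def)+
    also note MUA
    finally have "ennreal ((v - u) / 4) * emeasure lborel T \<le> ennreal ((v - u) / 4) * ennreal e"
      using e uv by (simp add: e'_def ennreal_mult[symmetric] mult.commute)
    then have T: "emeasure lborel T \<le> ennreal e"
      using uv by (subst (asm) ennreal_mult_le_mult_iff) (auto simp: )
    have Tl: "T \<in> lmeasurable"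
      using T by (intro fmeasurableI) (auto simp: le_less_trans)
    have neg: "negligible (S - T)" using C(4) by (simp add: T_def)
    have "measure lebesgue (T \<union> (S - T)) = measure lebesgue T"
      by (rule measure_negligible_symdiff) (use neg Tl in \<open>auto intro: negligible_subset\<close>)
    also have "\<dots> \<le> e"
      using T e by (simp add: measure_def enn2real_leI)
    finally have meas: "measure lebesgue (T \<union> (S - T)) \<le> e" .
    have "T \<union> (S - T) \<in> lmeasurable"
      using Tl negligible_imp_measurable[OF neg] by (rule fmeasurable.Un)
    moreover have "?S \<inter> ball 0 (real n) \<subseteq> T \<union> (S - T)" unfolding S_def by blast
    ultimately show "\<exists>T. ?S \<inter> ball 0 (real n) \<subseteq> T \<and> T \<in> lmeasurable \<and> measure lebesgue T \<le> e"
      using meas by blast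
  qed
  then have "negligible (\<Union>n. ?S \<inter> ball 0 (real n))" by (intro negligible_countable_Union) auto
  moreover have "?S \<subseteq> (\<Union>n. ?S \<inter> ball 0 (real n))"
    using reals_Archimedean2 by (auto simp: dist_real_def)
  ultimately show ?thesis by (rule negligible_subset)
qed

lemma AE_has_real_derivative_integral:
  fixes h F :: "real \<Rightarrow> real"
  assumes h: "integrable lborel h"
    and F: "\<And>a b. a \<le> b \<Longrightarrow> F b - F a = (LINT t:{a..b}|lborel. h t)"
  shows "AE x in lborel. (F has_real_derivative h x) (at x)"
proof -
  have [measurable]: "h \<in> borel_measurable borel" using h by auto
  define Up where "Up F h u v = {x::real. h x < u \<and>
      (\<forall>d>0. \<exists>a b. a \<le> x \<and> x \<le> b \<and> a < b \<and> b - a < d \<and> v * (b - a) < F b - F a)}"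
    for F h :: "real \<Rightarrow> real" and u v
  \<comment> \<open>Rational pairs keep the union countable. Passing to \<open>- F\<close> and
    \<open>- h\<close> turns the bound on upper derivates into one on lower derivates.\<close>
  define N where "N = (\<Union>(u,v)\<in>{(u,v)\<in>\<rat>\<times>\<rat>. u < v}. Up F h u v \<union> Up (\<lambda>x. - F x) (\<lambda>x. - h x) u v)"
  have "negligible (Up F h u v)" if "u < v" for u v
    unfolding Up_def by (rule negligible_upper_derivate_gt[OF h that F])
  moreover have "negligible (Up (\<lambda>x. - F x) (\<lambda>x. - h x) u v)" if "u < v" for u v
    unfolding Up_def using F h that
    by (intro negligible_upper_derivate_gt) (fastforce simp: set_lebesgue_integral_def)+
  ultimately have "negligible N"
    unfolding N_def 
    by (intro negligible_countable_Union countable_image)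
       (auto intro!: negligible_Un countable_subset[of _ "\<rat>\<times>\<rat>"] countable_SIGMA countable_rat)
  then have AE: "AE x in lebesgue. x \<notin> N"
    by (simp add: negligible_iff_null_sets AE_not_in)
  \<comment> \<open>Two rationals \<open>u < v\<close> are placed between \<open>h x\<close> and
    \<open>h x + e\<close>; avoiding the exceptional set of this one pair bounds all secant slopes
    over short intervals around \<open>x\<close>.\<close>
  have ub: "\<exists>d>0. \<forall>a b. a \<le> x \<and> x \<le> b \<and> a < b \<and> b - a < d \<longrightarrow> F b - F a \<le> (h x + e) * (b - a)"
    if x: "\<And>u v. u \<in> \<rat> \<Longrightarrow> v \<in> \<rat> \<Longrightarrow> u < v \<Longrightarrow> x \<notin> Up F h u v" and e: "e > 0" for F h :: "real \<Rightarrow> real" and x e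
  proof -
    obtain u where u: "u \<in> \<rat>" "h x < u" "u < h x + e/2" using Rats_dense_in_real[of "h x" "h x + e/2"] e by auto
    obtain v where v: "v \<in> \<rat>" "h x + e/2 < v" "v < h x + e" using Rats_dense_in_real[of "h x + e/2" "h x + e"] e by auto
    have "x \<notin> Up F h u v" using x u v by auto
    then obtain d where d: "d > 0" "\<And>a b. a \<le> x \<Longrightarrow> x \<le> b \<Longrightarrow> a < b \<Longrightarrow> b - a < d \<Longrightarrow> \<not> v * (b - a) < F b - F a"
      using u unfolding Up_def by blast
    have "F b - F a \<le> (h x + e) * (b - a)" if "a \<le> x" "x \<le> b" "a < b" "b - a < d" for a b
    proof -
      have "F b - F a \<le> v * (b - a)" using d(2)[OF that] by simp
      also have "\<dots> \<le> (h x + e) * (b - a)" using v that by (intro mult_right_mono) auto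
      finally show ?thesis .
    qed
    with d(1) show ?thesis by blast
  qed
  have "AE x in lebesgue. (F has_real_derivative h x) (at x)"
  proof (rule AE_mp[OF AE], rule AE_I2, intro impI)
    fix x assume x: "x \<notin> N"
    show "(F has_real_derivative h x) (at x)"
      unfolding has_field_derivative_def has_derivative_at_within
    proof (safe intro!: bounded_linear_mult_right)
      have *: "\<forall>e>0. \<exists>d>0. \<forall>y. 0 < \<bar>y - x\<bar> \<and> \<bar>y - x\<bar> < d \<longrightarrow> \<bar>F y - F x - h x * (y - x)\<bar> \<le> e * \<bar>y - x\<bar>"
      proof (intro allI impI)
        fix e :: real assume e: "e > 0"
        have "x \<notin> Up F h u v" "x \<notin> Up (\<lambda>x. - F x) (\<lambda>x. - h x) u v" if "u \<in> \<rat>" "v \<in> \<rat>" "u < v" for u v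
          using x that by (auto simp: N_def)
        from ub[of x F h, OF this(1) e] ub[of x "\<lambda>x. - F x" "\<lambda>x. - h x", OF this(2) e]
        obtain d1 d2 where d: "d1 > 0" "d2 > 0"
          "\<And>a b. a \<le> x \<Longrightarrow> x \<le> b \<Longrightarrow> a < b \<Longrightarrow> b - a < d1 \<Longrightarrow> F b - F a \<le> (h x + e) * (b - a)"
          "\<And>a b. a \<le> x \<Longrightarrow> x \<le> b \<Longrightarrow> a < b \<Longrightarrow> b - a < d2 \<Longrightarrow> - F b - - F a \<le> (- h x + e) * (b - a)"
          by metis
        show "\<exists>d>0. \<forall>y. 0 < \<bar>y - x\<bar> \<and> \<bar>y - x\<bar> < d \<longrightarrow> \<bar>F y - F x - h x * (y - x)\<bar> \<le> e * \<bar>y - x\<bar>"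
        proof (intro exI[of _ "min d1 d2"] conjI allI impI)
          fix y assume y: "0 < \<bar>y - x\<bar> \<and> \<bar>y - x\<bar> < min d1 d2"
          show "\<bar>F y - F x - h x * (y - x)\<bar> \<le> e * \<bar>y - x\<bar>"
          proof (cases "x < y")
            case True
            with d(3)[of x y] d(4)[of x y] y show ?thesis by (auto simp: algebra_simps abs_le_iff)
          next
            case False
            with d(3)[of y x] d(4)[of y x] y show ?thesis by (auto simp: algebra_simps abs_le_iff)
          qed
        qed (use d in auto)
      qed
      then show "((\<lambda>y. (F y - F x - h x * (y - x)) /\<^sub>R norm (y - x)) \<longlongrightarrow> 0) (at x)"
        unfolding tendsto_iff eventually_at dist_real_def
      proof (intro allI impI)
        fix e :: real assume e: "e > 0"
        then obtain d where d: "d > 0"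
          "\<And>y. 0 < \<bar>y - x\<bar> \<Longrightarrow> \<bar>y - x\<bar> < d \<Longrightarrow> \<bar>F y - F x - h x * (y - x)\<bar> \<le> e / 2 * \<bar>y - x\<bar>"
          using * by (meson half_gt_zero)
        show "\<exists>d>0. \<forall>y\<in>UNIV. y \<noteq> x \<and> \<bar>y - x\<bar> < d \<longrightarrow>
            \<bar>(F y - F x - h x * (y - x)) /\<^sub>R norm (y - x) - 0\<bar> < e"
        proof (intro exI[of _ d] conjI ballI impI d(1))
          fix y assume y: "y \<noteq> x \<and> \<bar>y - x\<bar> < d"
          then have "\<bar>F y - F x - h x * (y - x)\<bar> \<le> e / 2 * \<bar>y - x\<bar>" "\<bar>y - x\<bar> > 0" "e * \<bar>y - x\<bar> > 0"
            using d(2)[of y] e by auto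
          then have "\<bar>F y - F x - h x * (y - x)\<bar> < e * \<bar>y - x\<bar>" by linarith
          then show "\<bar>(F y - F x - h x * (y - x)) /\<^sub>R norm (y - x) - 0\<bar> < e"
            using \<open>\<bar>y - x\<bar> > 0\<close> by (simp add: abs_mult divide_simps)
        qed
      qed
    qed
  qed
  then show ?thesis by (simp add: AE_completion_iff)
qed

section \<open>Total variation of an absolutely continuous curve\<close>

definition ac_modulus :: "(real \<Rightarrow> 'a::real_normed_vector) \<Rightarrow> real \<Rightarrow> real \<Rightarrow> bool" where
  "ac_modulus f e d \<longleftrightarrow> (\<forall>(N::nat) (a::nat \<Rightarrow> real) b.
        (\<forall>k<N. 0 \<le> a k \<and> a k \<le> b k \<and> b k \<le> 1) \<longrightarrow>
        (\<forall>k<N. \<forall>j<N. k \<noteq> j \<longrightarrow> {a k<..<b k} \<inter> {a j<..<b j} = {}) \<longrightarrow>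
        (\<Sum>k<N. b k - a k) < d \<longrightarrow>
        (\<Sum>k<N. norm (f (b k) - f (a k))) < e)"

lemma abs_cont_on_I_iff_modulus: "abs_cont_on_I f \<longleftrightarrow> (\<forall>e>0. \<exists>d>0. ac_modulus f e d)"
  by (simp add: abs_cont_on_I_def ac_modulus_def)

text \<open>Later families are indexed by pairs (interval, subinterval) or by the intervals
  themselves, so the initial segment of the naturals gives way to any finite index set.\<close>

lemma ac_modulus_finite:
  fixes a b :: "'i \<Rightarrow> real"
  assumes "ac_modulus f e d" "finite A" "\<And>k. k \<in> A \<Longrightarrow> 0 \<le> a k \<and> a k \<le> b k \<and> b k \<le> 1"
    "\<And>k j. k \<in> A \<Longrightarrow> j \<in> A \<Longrightarrow> k \<noteq> j \<Longrightarrow> {a k<..<b k} \<inter> {a j<..<b j} = {}"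
    "(\<Sum>k\<in>A. b k - a k) < d"
  shows "(\<Sum>k\<in>A. norm (f (b k) - f (a k))) < e"
proof -
  obtain g where g: "bij_betw g {..<card A} A"
    using ex_bij_betw_nat_finite[OF assms(2)] by (auto simp: atLeast0LessThan)
  have s: "(\<Sum>k\<in>A. F k) = (\<Sum>k<card A. F (g k))" for F :: "'i \<Rightarrow> real"
    by (rule sum.reindex_bij_betw[OF g, symmetric])
  have gA: "k < card A \<Longrightarrow> g k \<in> A" for k using g by (auto simp: bij_betw_def)
  have inj: "k < card A \<Longrightarrow> j < card A \<Longrightarrow> k \<noteq> j \<Longrightarrow> g k \<noteq> g j" for k j
    using g by (auto simp: bij_betw_def inj_on_def)
  show ?thesis
    unfolding s
    by (rule assms(1)[unfolded ac_modulus_def, rule_format])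
       (use assms(3,5) assms(4)[OF gA gA inj] gA s in auto)
qed

lemma abs_cont_on_I_imp_continuous:
  assumes "abs_cont_on_I f" shows "continuous_on {0..1} f"
  unfolding continuous_on_iff
proof (intro ballI allI impI)
  fix x e :: real assume x: "x \<in> {0..1}" and e: "0 < e"
  obtain d where d: "d > 0" "ac_modulus f e d"
    using assms e by (auto simp: abs_cont_on_I_iff_modulus)
  have "dist (f y) (f x) < e" if y: "y \<in> {0..1}" "dist y x < d" for y
    using ac_modulus_finite[OF d(2), of "{0::nat}" "\<lambda>_. min x y" "\<lambda>_. max x y"] x y
    by (cases "x \<le> y") (auto simp: dist_norm norm_minus_commute)
  then show "\<exists>d>0. \<forall>x'\<in>{0..1}. dist x' x < d \<longrightarrow> dist (f x') (f x) < e"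
    using d(1) by blast
qed

text \<open>A partition is a nondecreasing sequence together with a number of steps. In this form
  taking \<open>min\<close> or \<open>max\<close> with a point yields a partition again, so cutting
  needs no reindexing.\<close>

definition chain_length :: "(real \<Rightarrow> 'a::real_normed_vector) \<Rightarrow> (nat \<Rightarrow> real) \<Rightarrow> nat \<Rightarrow> real" where
  "chain_length f x N = (\<Sum>k<N. norm (f (x (Suc k)) - f (x k)))"

definition chain_lengths :: "(real \<Rightarrow> 'a::real_normed_vector) \<Rightarrow> real \<Rightarrow> real set" where
  "chain_lengths f t = {chain_length f x N |x N. incseq x \<and> range x \<subseteq> {0..t}}"

definition variation :: "(real \<Rightarrow> 'a::real_normed_vector) \<Rightarrow> real \<Rightarrow> real" where
  "variation f t = Sup (chain_lengths f t)"

text \<open>Only a step that straddles \<open>s\<close> changes, and there the triangle inequality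
  through \<open>f s\<close> applies.\<close>

lemma chain_length_split:
  assumes "incseq x"
  shows "chain_length f x N \<le> chain_length f (\<lambda>k. min s (x k)) N + chain_length f (\<lambda>k. max s (x k)) N"
  unfolding chain_length_def sum.distrib[symmetric]
proof (rule sum_mono)
  fix k
  have "x k \<le> x (Suc k)" using assms by (simp add: incseq_SucD)
  then show "norm (f (x (Suc k)) - f (x k)) \<le> norm (f (min s (x (Suc k))) - f (min s (x k))) +
         norm (f (max s (x (Suc k))) - f (max s (x k)))"
    using norm_triangle_ineq[of "f s - f (x k)" "f (x (Suc k)) - f s"]
    by (auto simp: min_def max_def)
qed

lemma incseq_disjoint_intervals:
  fixes x :: "nat \<Rightarrow> 'a::linorder"
  assumes "incseq x" "k \<noteq> j"
  shows "{x k<..<x (Suc k)} \<inter> {x j<..<x (Suc j)} = {}"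
proof -
  have "Suc k \<le> j \<or> Suc j \<le> k" using assms(2) by auto
  then have "x (Suc k) \<le> x j \<or> x (Suc j) \<le> x k" using assms(1) by (auto dest: incseqD)
  then show ?thesis by auto
qed

lemma chain_length_short:
  assumes "ac_modulus f e d" "incseq x" "range x \<subseteq> {s..t}" "0 \<le> s" "t \<le> 1" "t - s < d"
  shows "chain_length f x N < e"
  unfolding chain_length_def
proof (rule ac_modulus_finite[OF assms(1)])
  have r: "s \<le> x k" "x k \<le> t" for k using assms(3) by (auto simp: image_subset_iff)
  show "0 \<le> x k \<and> x k \<le> x (Suc k) \<and> x (Suc k) \<le> 1" for k
    using r[of k] r[of "Suc k"] assms by (auto simp: incseq_SucD)
  have "(\<Sum>k<N. x (Suc k) - x k) = x N - x 0" by (rule sum_lessThan_telescope)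
  also have "\<dots> < d" using r[of N] r[of 0] assms by auto
  finally show "(\<Sum>k<N. x (Suc k) - x k) < d" .
qed (use incseq_disjoint_intervals[OF assms(2)] in auto)

text \<open>The unit interval is exhausted in blocks of length \<open>d/2\<close>. By induction on
  their number \<open>K\<close>, a chain inside the first \<open>K\<close> blocks has length at most
  \<open>K\<close>: cutting it at the start of the last block leaves a part in an interval shorter
  than \<open>d\<close>, which contributes less than 1.\<close>

lemma bdd_above_chain_lengths:
  assumes "abs_cont_on_I f" "t \<le> 1"
  shows "bdd_above (chain_lengths f t)"
proof -
  obtain d where d: "d > 0" "ac_modulus f 1 d"
    using assms(1) unfolding abs_cont_on_I_iff_modulus by (meson zero_less_one)
  have *: "chain_length f x N \<le> real K" if "incseq x" "range x \<subseteq> {0..min 1 (real K * (d/2))}" for x N K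
    using that
  proof (induction K arbitrary: x)
    case 0
    then have "x k = 0" for k by (auto simp: image_subset_iff min_def split: if_splits)
    then show ?case by (simp add: chain_length_def)
  next
    case (Suc K)
    define s where "s = min 1 (real K * (d/2))"
    have s: "0 \<le> s" "s \<le> 1" using d by (auto simp: s_def)
    have x: "0 \<le> x k" "x k \<le> 1" "x k \<le> real (Suc K) * (d/2)" for k
      using Suc.prems(2) by (auto simp: image_subset_iff)
    have "chain_length f (\<lambda>k. min s (x k)) N \<le> real K"
      by (rule Suc.IH) (use Suc.prems x s in \<open>auto simp: s_def incseq_def min.coboundedI2\<close>)
    moreover have "chain_length f (\<lambda>k. max s (x k)) N < 1"
    proof (rule chain_length_short[OF d(2), where s=s and t="min 1 (s + d/2)"])
      show "incseq (\<lambda>k. max s (x k))" using Suc.prems(1) by (auto simp: incseq_def max.coboundedI2)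
      have "x k \<le> min 1 (s + d/2)" for k
        using x[of k] s d(1) by (auto simp: s_def min_def algebra_simps split: if_splits)
      then show "range (\<lambda>k. max s (x k)) \<subseteq> {s..min 1 (s + d/2)}"
        using s d(1) by auto
    qed (use s d(1) in auto)
    ultimately show ?case using chain_length_split[OF Suc.prems(1), of f N s] by simp
  qed
  obtain K where "real K > 1 / (d/2)" using reals_Archimedean2 by blast
  then have "1 \<le> real K * (d/2)" using d by (simp add: field_simps)
  then show ?thesis
    using * assms(2) unfolding bdd_above_def chain_lengths_def
    by (intro exI[of _ "real K"]) (fastforce simp: image_subset_iff min_def)
qed

text \<open>Any chain in \<open>{0..a}\<close> can be prolonged by the two points \<open>a\<close>
  and \<open>b\<close>, which adds at least the increment from \<open>a\<close> to
  \<open>b\<close>.\<close>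

lemma variation_increment:
  assumes "abs_cont_on_I f" "0 \<le> a" "a \<le> b" "b \<le> 1"
  shows "norm (f b - f a) \<le> variation f b - variation f a"
proof -
  have ne: "chain_lengths f a \<noteq> {}"
    using assms unfolding chain_lengths_def
    by (auto intro!: exI[of _ "\<lambda>_. 0"] simp: incseq_def)
  have "variation f a \<le> variation f b - norm (f b - f a)"
    unfolding variation_def[of f a]
  proof (rule cSup_least[OF ne])
    fix z assume "z \<in> chain_lengths f a"
    then obtain x N where x: "z = chain_length f x N" "incseq x" "range x \<subseteq> {0..a}"
      by (auto simp: chain_lengths_def)
    define y where "y k = (if k \<le> N then x k else if k = Suc N then a else b)" for k
    have "incseq y"
      by (rule incseq_SucI) (use x assms in \<open>auto simp: y_def incseq_SucD image_subset_iff\<close>)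
    moreover have "y k \<in> {0..b}" for k
      using x(3) assms by (auto simp: y_def image_subset_iff intro: order_trans)
    then have "range y \<subseteq> {0..b}" by auto
    ultimately have "chain_length f y (Suc (Suc N)) \<in> chain_lengths f b"
      by (auto simp: chain_lengths_def)
    then have "chain_length f y (Suc (Suc N)) \<le> variation f b"
      unfolding variation_def using bdd_above_chain_lengths[OF assms(1,4)] by (rule cSup_upper)
    moreover have "chain_length f x N = chain_length f y N"
      unfolding chain_length_def by (intro sum.cong) (auto simp: y_def)
    moreover have "chain_length f y (Suc (Suc N)) = chain_length f y N + norm (f a - f (x N)) + norm (f b - f a)"
      by (simp add: chain_length_def y_def)
    ultimately show "z \<le> variation f b - norm (f b - f a)"
      using x(1) by (smt (verit) norm_ge_zero)
  qed
  then show ?thesis by simp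
qed

lemma variation_mono:
  assumes "abs_cont_on_I f" "0 \<le> a" "a \<le> b" "b \<le> 1"
  shows "variation f a \<le> variation f b"
  using variation_increment[OF assms] norm_ge_zero[of "f b - f a"] by linarith

text \<open>A nearly optimal chain in \<open>{0..b}\<close> is cut at \<open>a\<close>. Its lower
  part is bounded by \<open>variation f a\<close>, so the upper part must carry almost the whole
  difference.\<close>

lemma variation_approx:
  assumes "abs_cont_on_I f" "0 \<le> a" "a \<le> b" "b \<le> 1" "\<eta> > 0"
  obtains x N where "incseq x" "range x \<subseteq> {a..b}" "variation f b - variation f a - \<eta> < chain_length f x N"
proof -
  have ne: "chain_lengths f b \<noteq> {}"
    using assms unfolding chain_lengths_def
    by (auto intro!: exI[of _ "\<lambda>_. 0"] simp: incseq_def)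
  have "variation f b - \<eta> < Sup (chain_lengths f b)" using assms by (simp add: variation_def)
  then obtain x N where x: "incseq x" "range x \<subseteq> {0..b}" "variation f b - \<eta> < chain_length f x N"
    unfolding less_cSup_iff[OF ne bdd_above_chain_lengths[OF assms(1,4)]] by (auto simp: chain_lengths_def)
  have "chain_length f (\<lambda>k. min a (x k)) N \<in> chain_lengths f a"
    using x assms unfolding chain_lengths_def
    by (intro CollectI exI conjI refl) (force simp: incseq_def min.coboundedI2 image_subset_iff)+
  then have "chain_length f (\<lambda>k. min a (x k)) N \<le> variation f a"
    unfolding variation_def using assms by (intro cSup_upper bdd_above_chain_lengths) auto
  then have "variation f b - variation f a - \<eta> < chain_length f (\<lambda>k. max a (x k)) N"
    using chain_length_split[OF x(1), of f N a] x(3) by linarith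
  moreover have "incseq (\<lambda>k. max a (x k))" using x(1) by (auto simp: incseq_def max.coboundedI2)
  moreover have "range (\<lambda>k. max a (x k)) \<subseteq> {a..b}" using x assms by (auto simp: image_subset_iff)
  ultimately show thesis using that by blast
qed

text \<open>Each interval of the family is replaced by a nearly optimal chain inside it. The
  subintervals of all chains form a disjoint family of no larger total length, so a \<open>d\<close>
  chosen for \<open>f\<close> also serves its variation.\<close>

lemma abs_cont_variation:
  assumes f: "abs_cont_on_I f"
  shows "abs_cont_on_I (variation f)"
  unfolding abs_cont_on_I_def
proof (intro allI impI)
  fix e :: real assume e: "0 < e"
  obtain d where d: "d > 0" "ac_modulus f (e/4) d"
    using f e by (metis abs_cont_on_I_iff_modulus zero_less_divide_iff zero_less_numeral)
  show "\<exists>d>0. \<forall>(N::nat) a b.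
        (\<forall>k<N. 0 \<le> a k \<and> a k \<le> b k \<and> b k \<le> 1) \<longrightarrow>
        (\<forall>k<N. \<forall>j<N. k \<noteq> j \<longrightarrow> {a k<..<b k} \<inter> {a j<..<b j} = {}) \<longrightarrow>
        (\<Sum>k<N. b k - a k) < d \<longrightarrow>
        (\<Sum>k<N. norm (variation f (b k) - variation f (a k))) < e"
  proof (intro exI[of _ d] conjI d(1) allI impI)
    fix N :: nat and a b :: "nat \<Rightarrow> real"
    assume ab: "\<forall>k<N. 0 \<le> a k \<and> a k \<le> b k \<and> b k \<le> 1"
      and disj: "\<forall>k<N. \<forall>j<N. k \<noteq> j \<longrightarrow> {a k<..<b k} \<inter> {a j<..<b j} = {}"
      and sum: "(\<Sum>k<N. b k - a k) < d"
    \<comment> \<open>The \<open>N\<close> approximation errors together stay below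
      \<open>e/4\<close>; the refined family contributes another \<open>e/4\<close>.\<close>
    define \<eta> where "\<eta> = e / (4 * (real N + 1))"
    have \<eta>: "\<eta> > 0" using e by (simp add: \<eta>_def)
    have "\<forall>k. \<exists>x m. k < N \<longrightarrow> incseq x \<and> range x \<subseteq> {a k..b k} \<and>
        variation f (b k) - variation f (a k) - \<eta> < chain_length f x m"
    proof
      fix k show "\<exists>x m. k < N \<longrightarrow> incseq x \<and> range x \<subseteq> {a k..b k} \<and>
        variation f (b k) - variation f (a k) - \<eta> < chain_length f x m"
      proof (cases "k < N")
        case True
        with ab have "0 \<le> a k" "a k \<le> b k" "b k \<le> 1" by auto
        from variation_approx[OF f this \<eta>] show ?thesis by metis
      qed auto
    qed
    then obtain x m where x: "\<And>k. k < N \<Longrightarrow> incseq (x k)" "\<And>k. k < N \<Longrightarrow> range (x k) \<subseteq> {a k..b k}"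
        "\<And>k. k < N \<Longrightarrow> variation f (b k) - variation f (a k) - \<eta> < chain_length f (x k) (m k)"
      by metis
    have r: "a k \<le> x k i" "x k i \<le> b k" if "k < N" for k i using x(2)[OF that] by (auto simp: image_subset_iff)
    have sub: "{x k i<..<x k j} \<subseteq> {a k<..<b k}" if "k < N" for k i j
      using r(1)[OF that, of i] r(2)[OF that, of j] by auto
    have "(\<Sum>k<N. chain_length f (x k) (m k)) =
        (\<Sum>p\<in>Sigma {..<N} (\<lambda>k. {..<m k}). norm (f (x (fst p) (Suc (snd p))) - f (x (fst p) (snd p))))"
      unfolding chain_length_def by (subst sum.Sigma) (auto simp: case_prod_beta)
    also have "\<dots> < e / 4"
    proof (rule ac_modulus_finite[OF d(2)])
      show "0 \<le> x (fst p) (snd p) \<and> x (fst p) (snd p) \<le> x (fst p) (Suc (snd p)) \<and> x (fst p) (Suc (snd p)) \<le> 1"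
        if "p \<in> Sigma {..<N} (\<lambda>k. {..<m k})" for p
      proof -
        have p: "fst p < N" using that by auto
        then have "0 \<le> a (fst p)" "b (fst p) \<le> 1" using ab by auto
        with r[OF p, of "snd p"] r[OF p, of "Suc (snd p)"] incseq_SucD[OF x(1)[OF p], of "snd p"]
        show ?thesis by linarith
      qed
      show "{x (fst p) (snd p)<..<x (fst p) (Suc (snd p))} \<inter> {x (fst q) (snd q)<..<x (fst q) (Suc (snd q))} = {}"
        if pq: "p \<in> Sigma {..<N} (\<lambda>k. {..<m k})" "q \<in> Sigma {..<N} (\<lambda>k. {..<m k})" "p \<noteq> q" for p q
      proof (cases "fst p = fst q")
        case True
        then have "snd p \<noteq> snd q" using pq(3) by (simp add: prod_eq_iff)
        then show ?thesis unfolding True using pq x(1) by (intro incseq_disjoint_intervals) auto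
      next
        case False
        have "{a (fst p)<..<b (fst p)} \<inter> {a (fst q)<..<b (fst q)} = {}"
          using disj pq False by auto
        moreover have "{x (fst p) (snd p)<..<x (fst p) (Suc (snd p))} \<subseteq> {a (fst p)<..<b (fst p)}"
          "{x (fst q) (snd q)<..<x (fst q) (Suc (snd q))} \<subseteq> {a (fst q)<..<b (fst q)}"
          using pq by (auto simp del: greaterThanLessThan_iff greaterThanLessThan_subseteq_greaterThanLessThan intro!: sub)
        ultimately show ?thesis by blast
      qed
      have "(\<Sum>p\<in>Sigma {..<N} (\<lambda>k. {..<m k}). x (fst p) (Suc (snd p)) - x (fst p) (snd p)) =
         (\<Sum>k<N. \<Sum>i<m k. x k (Suc i) - x k i)"
        by (subst sum.Sigma) (auto simp: case_prod_beta)
      also have "\<dots> = (\<Sum>k<N. x k (m k) - x k 0)" by (simp add: sum_lessThan_telescope)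
      also have "\<dots> \<le> (\<Sum>k<N. b k - a k)" using r by (intro sum_mono diff_mono) auto
      finally show "(\<Sum>p\<in>Sigma {..<N} (\<lambda>k. {..<m k}). x (fst p) (Suc (snd p)) - x (fst p) (snd p)) < d"
        using sum by simp
    qed auto
    finally have *: "(\<Sum>k<N. chain_length f (x k) (m k)) < e / 4" .
    have "(\<Sum>k<N. norm (variation f (b k) - variation f (a k))) \<le> (\<Sum>k<N. chain_length f (x k) (m k) + \<eta>)"
      using x(3) ab variation_mono[OF f] by (intro sum_mono) (fastforce simp: abs_of_nonneg)
    also have "\<dots> < e / 4 + real N * \<eta>" using * by (simp add: sum.distrib)
    also have "real N * \<eta> \<le> e / 4" using e by (simp add: \<eta>_def field_simps)
    finally show "(\<Sum>k<N. norm (variation f (b k) - variation f (a k))) < e" using e by simp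
  qed
qed

lemma abs_cont_on_I_add:
  assumes "abs_cont_on_I f" "abs_cont_on_I g"
  shows "abs_cont_on_I (\<lambda>t. f t + g t)"
  unfolding abs_cont_on_I_iff_modulus
proof (intro allI impI)
  fix e :: real assume e: "e > 0"
  obtain d1 d2 where d: "d1 > 0" "ac_modulus f (e/2) d1" "d2 > 0" "ac_modulus g (e/2) d2"
    using assms e unfolding abs_cont_on_I_iff_modulus by (meson half_gt_zero)
  show "\<exists>d>0. ac_modulus (\<lambda>t. f t + g t) e d"
  proof (intro exI[of _ "min d1 d2"] conjI)
    show "ac_modulus (\<lambda>t. f t + g t) e (min d1 d2)"
      unfolding ac_modulus_def
    proof (intro allI impI)
      fix N :: nat and a b :: "nat \<Rightarrow> real"
      assume *: "\<forall>k<N. 0 \<le> a k \<and> a k \<le> b k \<and> b k \<le> 1"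
        "\<forall>k<N. \<forall>j<N. k \<noteq> j \<longrightarrow> {a k<..<b k} \<inter> {a j<..<b j} = {}"
        "(\<Sum>k<N. b k - a k) < min d1 d2"
      have "(\<Sum>k<N. norm (f (b k) - f (a k))) < e/2" "(\<Sum>k<N. norm (g (b k) - g (a k))) < e/2"
        using d(2,4) * unfolding ac_modulus_def by auto
      moreover have "(\<Sum>k<N. norm (f (b k) + g (b k) - (f (a k) + g (a k)))) \<le>
          (\<Sum>k<N. norm (f (b k) - f (a k)) + norm (g (b k) - g (a k)))"
        by (intro sum_mono) (metis add_diff_add norm_triangle_ineq)
      ultimately show "(\<Sum>k<N. norm (f (b k) + g (b k) - (f (a k) + g (a k)))) < e"
        by (simp add: sum.distrib)
    qed
  qed (use d in auto)
qed

lemma abs_cont_on_I_inner: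
  fixes f :: "real \<Rightarrow> 'a::real_inner"
  assumes "abs_cont_on_I f" "norm u \<le> 1"
  shows "abs_cont_on_I (\<lambda>t. f t \<bullet> u)"
  unfolding abs_cont_on_I_def
proof (intro allI impI)
  fix e :: real assume e: "e > 0"
  obtain d where d: "d > 0" "ac_modulus f e d"
    using assms(1) e unfolding abs_cont_on_I_iff_modulus by meson
  have "norm (f s \<bullet> u - f t \<bullet> u) \<le> norm (f s - f t)" for s t
    using Cauchy_Schwarz_ineq2[of "f s - f t" u] assms(2)
    by (simp add: inner_diff_left) (meson mult_left_le norm_ge_zero order_trans)
  then have *: "(\<Sum>k<N. norm (f (b k) \<bullet> u - f (a k) \<bullet> u)) \<le> (\<Sum>k<N. norm (f (b k) - f (a k)))" for N :: nat and a b
    by (intro sum_mono) auto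
  show "\<exists>d>0. \<forall>(N::nat) a b.
        (\<forall>k<N. 0 \<le> a k \<and> a k \<le> b k \<and> b k \<le> 1) \<longrightarrow>
        (\<forall>k<N. \<forall>j<N. k \<noteq> j \<longrightarrow> {a k<..<b k} \<inter> {a j<..<b j} = {}) \<longrightarrow>
        (\<Sum>k<N. b k - a k) < d \<longrightarrow>
        (\<Sum>k<N. norm (f (b k) \<bullet> u - f (a k) \<bullet> u)) < e"
    using d(1) by (intro exI[of _ d] conjI allI impI le_less_trans[OF *] d(2)[unfolded ac_modulus_def, rule_format]) auto
qed

lemma abs_cont_on_I_lipschitz:
  assumes "\<And>s t. s \<in> {0..1} \<Longrightarrow> t \<in> {0..1} \<Longrightarrow> norm (f s - f t) \<le> L * \<bar>s - t\<bar>"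
  shows "abs_cont_on_I f"
  unfolding abs_cont_on_I_def
proof (intro allI impI)
  fix e :: real assume e: "e > 0"
  show "\<exists>d>0. \<forall>(N::nat) a b.
        (\<forall>k<N. 0 \<le> a k \<and> a k \<le> b k \<and> b k \<le> 1) \<longrightarrow>
        (\<forall>k<N. \<forall>j<N. k \<noteq> j \<longrightarrow> {a k<..<b k} \<inter> {a j<..<b j} = {}) \<longrightarrow>
        (\<Sum>k<N. b k - a k) < d \<longrightarrow>
        (\<Sum>k<N. norm (f (b k) - f (a k))) < e"
  proof (intro exI[of _ "e / (\<bar>L\<bar> + 1)"] conjI allI impI)
    fix N :: nat and a b :: "nat \<Rightarrow> real"
    assume *: "\<forall>k<N. 0 \<le> a k \<and> a k \<le> b k \<and> b k \<le> 1" "(\<Sum>k<N. b k - a k) < e / (\<bar>L\<bar> + 1)"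
    have "(\<Sum>k<N. norm (f (b k) - f (a k))) \<le> (\<Sum>k<N. (\<bar>L\<bar> + 1) * (b k - a k))"
    proof (rule sum_mono)
      fix k assume "k \<in> {..<N}"
      then have k: "0 \<le> a k" "a k \<le> b k" "b k \<le> 1" using * by auto
      have "norm (f (b k) - f (a k)) \<le> L * \<bar>b k - a k\<bar>" using k by (intro assms) auto
      also have "\<dots> \<le> (\<bar>L\<bar> + 1) * (b k - a k)" using k by (auto intro!: mult_right_mono)
      finally show "norm (f (b k) - f (a k)) \<le> (\<bar>L\<bar> + 1) * (b k - a k)" .
    qed
    also have "\<dots> = (\<bar>L\<bar> + 1) * (\<Sum>k<N. b k - a k)" by (simp add: sum_distrib_left)
    also have "\<dots> < e" using *(2) by (simp add: pos_less_divide_eq mult.commute add_nonneg_pos)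
    finally show "(\<Sum>k<N. norm (f (b k) - f (a k))) < e" .
  qed (use e in \<open>auto intro!: divide_pos_pos\<close>)
qed

lemma ex_nat_Icc: "\<exists>n. (x::real) \<in> {-real n..real n}"
proof -
  obtain n where "\<bar>x\<bar> \<le> real n" using real_arch_simple by blast
  then show ?thesis by (intro exI[of _ n]) auto
qed

section \<open>Densities of absolutely continuous functions\<close>

definition clamp01 :: "real \<Rightarrow> real" where "clamp01 t = max 0 (min 1 t)"

lemma clamp01_bounds [simp]: "0 \<le> clamp01 t" "clamp01 t \<le> 1"
  by (auto simp: clamp01_def)

lemma clamp01_id [simp]: "0 \<le> t \<Longrightarrow> t \<le> 1 \<Longrightarrow> clamp01 t = t"
  by (auto simp: clamp01_def)

lemma clamp01_mono: "s \<le> t \<Longrightarrow> clamp01 s \<le> clamp01 t"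
  by (auto simp: clamp01_def)

lemma continuous_on_clamp01: "continuous_on A clamp01"
  unfolding clamp01_def by (intro continuous_intros)

lemma borel_measurable_clamp01 [measurable]: "clamp01 \<in> borel_measurable borel"
  by (rule borel_measurable_continuous_onI[OF continuous_on_clamp01])

text \<open>The part of a null set in a box is covered by countably many nonoverlapping closed
  intervals of total length less than \<open>d\<close>. On finitely many of them the modulus bounds
  the growth of \<open>f\<close> by \<open>e\<close>, and continuity from below extends this bound
  to the whole cover.\<close>

lemma absolutely_continuous_interval_measure:
  fixes f :: "real \<Rightarrow> real"
  assumes f: "abs_cont_on_I f" and mono: "\<And>s t. 0 \<le> s \<Longrightarrow> s \<le> t \<Longrightarrow> t \<le> 1 \<Longrightarrow> f s \<le> f t"
  shows "absolutely_continuous lborel (interval_measure (\<lambda>t. f (clamp01 t)))"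
proof -
  define F where "F t = f (clamp01 t)" for t
  have monoF: "F s \<le> F t" if "s \<le> t" for s t
    unfolding F_def by (rule mono) (auto intro: clamp01_mono that)
  have contF: "continuous_on UNIV F"
    unfolding F_def
    by (rule continuous_on_compose2[OF abs_cont_on_I_imp_continuous[OF f] continuous_on_clamp01]) auto
  define \<mu> where "\<mu> = interval_measure F"
  have [measurable_cong, simp]: "sets \<mu> = sets borel" by (simp add: \<mu>_def)
  have Icc: "emeasure \<mu> (cbox c d) = ennreal (F d - F c)" if "c \<le> d" for c d
    unfolding \<mu>_def using that monoF contF
    by (simp add: emeasure_interval_measure_Icc)
  have "emeasure \<mu> N = 0" if N: "N \<in> null_sets lborel" for N
  proof -
    have [measurable]: "N \<in> sets borel" using N by auto
    have "emeasure \<mu> (N \<inter> cbox (-real n) (real n)) = 0" for n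
    proof -
      let ?N = "N \<inter> cbox (-real n) (real n)"
      have "emeasure \<mu> ?N \<le> ennreal e" if e: "e > 0" for e
      proof -
        obtain d where d: "d > 0" "ac_modulus f e d"
          using f e unfolding abs_cont_on_I_iff_modulus by meson
        have neg: "negligible ?N"
          using N by (auto simp: negligible_iff_null_sets null_sets_completionI intro!: null_set_Int2)
        have L: "?N \<in> lmeasurable" using neg by (simp only: negligible_imp_measurable)
        have d2: "d/2 > 0" using d(1) by simp
        obtain D where D: "countable D"
          "\<And>K. K \<in> D \<Longrightarrow> K \<subseteq> cbox (-real n) (real n) \<and> K \<noteq> {} \<and> (\<exists>c d. K = cbox c d)"
          "pairwise (\<lambda>A B. interior A \<inter> interior B = {}) D"
          "?N \<subseteq> \<Union>D" "\<Union>D \<in> lmeasurable" "measure lebesgue (\<Union>D) \<le> measure lebesgue ?N + d/2"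
          by (rule measurable_outer_intervals_bounded[OF L Int_lower2 d2]) (rule that; assumption)
        have mD: "measure lebesgue (\<Union>D) < d" using D(6) d(1) unfolding negligible_imp_measure0[OF neg] by simp
        \<comment> \<open>The covering intervals are given only as sets. Choosing end points for
          each makes the interval itself the index of the sums below.\<close>
        define lo hi where "lo K = (SOME c. \<exists>d\<ge>c. K = cbox c d)" and "hi K = (SOME d. d \<ge> lo K \<and> K = cbox (lo K) d)" for K :: "real set"
        have lohi: "lo K \<le> hi K" "cbox (lo K) (hi K) = K" if KD: "K \<in> D" for K
        proof -
          obtain c d where "K = cbox c d" "K \<noteq> {}" using D(2)[OF KD] by blast
          then have "\<exists>c. \<exists>d\<ge>c. K = cbox c d" by auto
          then have "\<exists>d\<ge>lo K. K = cbox (lo K) d" unfolding lo_def by (rule someI_ex)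
          then have "\<exists>d. d \<ge> lo K \<and> K = cbox (lo K) d" by blast
          then have *: "hi K \<ge> lo K \<and> K = cbox (lo K) (hi K)" unfolding hi_def by (rule someI_ex)
          show "lo K \<le> hi K" by (rule conjunct1[OF *])
          show "cbox (lo K) (hi K) = K" by (rule conjunct2[OF *, symmetric])
        qed
        have int: "interior K = {lo K<..<hi K}" if "K \<in> D" for K
          using interior_cbox[of "lo K" "hi K"] unfolding lohi(2)[OF that] by simp
        have fin: "emeasure \<mu> (\<Union>A) \<le> ennreal e" if A: "finite A" "A \<subseteq> D" for A
        proof -
          have lenA: "(\<Sum>K\<in>A. hi K - lo K) = measure lebesgue (\<Union>A)"
          proof -
            have "measure lebesgue (\<Union>K\<in>A. K) = (\<Sum>K\<in>A. measure lebesgue K)"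
            proof (rule measure_negligible_finite_Union_image[OF A(1)])
              show "K \<in> A \<Longrightarrow> K \<in> lmeasurable" for K using A(2) lohi by (metis lmeasurable_cbox subsetD)
              show "pairwise (\<lambda>K K'. negligible (K \<inter> K')) A"
              proof (rule pairwiseI)
                fix K K' assume K: "K \<in> A" "K' \<in> A" "K \<noteq> K'"
                then have "interior K \<inter> interior K' = {}" using A(2) D(3) by (auto simp: pairwise_def)
                moreover have "convex (K \<inter> K')"
                  using K A(2) lohi by (metis convex_Int convex_box(1) subsetD)
                ultimately show "negligible (K \<inter> K')"
                  by (simp add: negligible_convex_interior)
              qed
            qed
            also have "\<dots> = (\<Sum>K\<in>A. hi K - lo K)"
            proof (rule sum.cong[OF refl])
              fix K assume "K \<in> A"
              then have "K \<in> D" using A by auto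
              have "measure lebesgue (cbox (lo K) (hi K)) = hi K - lo K"
                using lohi(1)[OF \<open>K \<in> D\<close>] by simp
              then show "measure lebesgue K = hi K - lo K"
                unfolding lohi(2)[OF \<open>K \<in> D\<close>] .
            qed
            finally show ?thesis by simp
          qed
          have "emeasure \<mu> (\<Union>A) \<le> (\<Sum>K\<in>A. emeasure \<mu> K)"
          proof -
            have "K \<in> sets \<mu>" if "K \<in> A" for K
              using lohi(2)[of K] that A(2) by (metis borel_closed closed_cbox \<open>sets \<mu> = sets borel\<close> subsetD)
            then show ?thesis using emeasure_subadditive_finite[OF A(1), of "\<lambda>x. x" \<mu>] by auto
          qed
          also have "\<dots> = (\<Sum>K\<in>A. ennreal (F (hi K) - F (lo K)))"
          proof (rule sum.cong[OF refl])
            fix K assume "K \<in> A"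
            then have "K \<in> D" using A by auto
            show "emeasure \<mu> K = ennreal (F (hi K) - F (lo K))"
              using Icc[OF lohi(1)[OF \<open>K \<in> D\<close>]] unfolding lohi(2)[OF \<open>K \<in> D\<close>] .
          qed
          also have "\<dots> = ennreal (\<Sum>K\<in>A. F (hi K) - F (lo K))"
            using lohi(1) A(2) by (intro sum_ennreal) (auto simp: monoF subset_eq)
          also have "(\<Sum>K\<in>A. F (hi K) - F (lo K)) \<le> (\<Sum>K\<in>A. norm (f (clamp01 (hi K)) - f (clamp01 (lo K))))"
            by (intro sum_mono) (auto simp: F_def)
          also have "\<dots> \<le> e"
          proof (rule less_imp_le, rule ac_modulus_finite[OF d(2) A(1)])
            show "K \<in> A \<Longrightarrow> 0 \<le> clamp01 (lo K) \<and> clamp01 (lo K) \<le> clamp01 (hi K) \<and> clamp01 (hi K) \<le> 1" for K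
              using lohi(1) A(2) by (auto intro: clamp01_mono)
            show "{clamp01 (lo K)<..<clamp01 (hi K)} \<inter> {clamp01 (lo K')<..<clamp01 (hi K')} = {}"
              if "K \<in> A" "K' \<in> A" "K \<noteq> K'" for K K'
            proof -
              have "interior K \<inter> interior K' = {}" using that A(2) D(3) by (auto simp: pairwise_def)
              then have "{lo K<..<hi K} \<inter> {lo K'<..<hi K'} = {}" using int that A(2) by (metis subsetD)
              moreover have "{clamp01 (lo K)<..<clamp01 (hi K)} \<subseteq> {lo K<..<hi K}" for K
                by (auto simp: clamp01_def)
              ultimately show ?thesis by blast
            qed
            have "(\<Sum>K\<in>A. clamp01 (hi K) - clamp01 (lo K)) \<le> (\<Sum>K\<in>A. hi K - lo K)"
              using lohi(1) A(2) by (intro sum_mono) (force simp: clamp01_def)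
            also have "\<dots> \<le> measure lebesgue (\<Union>D)"
              unfolding lenA using A(2) D(5)
              by (intro measure_mono_fmeasurable)
                 (auto intro!: sets.finite_Union A(1), metis lohi(2) lmeasurable_cbox fmeasurableD subsetD)
            finally show "(\<Sum>K\<in>A. clamp01 (hi K) - clamp01 (lo K)) < d" using mD by simp
          qed
          finally show ?thesis by (simp add: ennreal_leI)
        qed
        show ?thesis
        proof (cases "D = {}")
          case True then show ?thesis using D(4) by auto
        next
          case False
          \<comment> \<open>The bound is known for finite subfamilies only; an enumeration of
            \<open>D\<close> exhausts its union by increasing finite unions.\<close>
          define U where "U m = \<Union>(from_nat_into D ` {..<m})" for m :: nat
          have Um: "emeasure \<mu> (U m) \<le> ennreal e" for m
            unfolding U_def by (rule fin) (use False in \<open>auto intro: from_nat_into\<close>)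
          have Ksets: "from_nat_into D k \<in> sets \<mu>" for k
            using lohi(2)[of "from_nat_into D k"] from_nat_into[OF False, of k]
            by (metis borel_closed closed_cbox \<open>sets \<mu> = sets borel\<close>)
          have Us: "U m \<in> sets \<mu>" for m using Ksets unfolding U_def by (auto intro!: sets.finite_Union)
          have inc: "incseq U" unfolding U_def incseq_def by (auto intro: less_le_trans)
          have range: "range (from_nat_into D) = D" using False D(1) by (rule range_from_nat_into)
          have UD: "\<Union>D \<subseteq> (\<Union>m. U m)"
          proof
            fix x assume "x \<in> \<Union>D"
            then have "x \<in> \<Union>(range (from_nat_into D))" unfolding range .
            then obtain k where "x \<in> from_nat_into D k" by blast
            then have "x \<in> U (Suc k)" unfolding U_def by blast
            then show "x \<in> (\<Union>m. U m)" by blast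
          qed
          have "(\<Union>m. U m) \<in> sets \<mu>" using Us by (intro sets.countable_UN) auto
          with D(4) UD have "emeasure \<mu> ?N \<le> emeasure \<mu> (\<Union>m. U m)"
            by (intro emeasure_mono) (rule order_trans)
          also have "\<dots> = (SUP m. emeasure \<mu> (U m))"
            using inc Us by (intro SUP_emeasure_incseq[symmetric]) auto
          also have "\<dots> \<le> ennreal e" using Um by (rule SUP_least)
          finally show ?thesis .
        qed
      qed
      then have "emeasure \<mu> ?N \<le> 0 + ennreal e" if "e > 0" for e using that by simp
      then have "emeasure \<mu> ?N \<le> 0" by (rule ennreal_le_epsilon)
      then show ?thesis by simp
    qed
    then have "(\<Union>n. N \<inter> cbox (-real n) (real n)) \<in> null_sets \<mu>"
      by (intro null_sets_UN) (auto simp: null_sets_def)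
    moreover have "N = (\<Union>n. N \<inter> cbox (-real n) (real n))"
    proof -
      have "\<exists>n. x \<in> cbox (-real n) (real n)" for x :: real
        using ex_nat_Icc by simp
      then show ?thesis by blast
    qed
    ultimately show ?thesis by (metis null_setsD1)
  qed
  then show ?thesis
    unfolding absolutely_continuous_def \<mu>_def F_def by (auto simp: null_sets_def)
qed

text \<open>\<open>h\<close> is the Radon-Nikodym density of the Stieltjes measure of the clamped
  function. The total mass is at most \<open>f 1 - f 0\<close>, so the density is integrable and
  almost everywhere finite.\<close>

lemma mono_abs_cont_integral:
  fixes f :: "real \<Rightarrow> real"
  assumes f: "abs_cont_on_I f" and mono: "\<And>s t. 0 \<le> s \<Longrightarrow> s \<le> t \<Longrightarrow> t \<le> 1 \<Longrightarrow> f s \<le> f t"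
  obtains h where "integrable lborel h"
    "\<And>a b. a \<le> b \<Longrightarrow> f (clamp01 b) - f (clamp01 a) = (LINT t:{a..b}|lborel. h t)"
proof -
  define F where "F t = f (clamp01 t)" for t
  have monoF: "F s \<le> F t" if "s \<le> t" for s t
    unfolding F_def by (rule mono) (auto intro: clamp01_mono that)
  have contF: "continuous_on UNIV F"
    unfolding F_def
    by (rule continuous_on_compose2[OF abs_cont_on_I_imp_continuous[OF f] continuous_on_clamp01]) auto
  define \<mu> where "\<mu> = interval_measure F"
  have [measurable_cong, simp]: "sets \<mu> = sets borel" by (simp add: \<mu>_def)
  have Icc: "emeasure \<mu> {c..d} = ennreal (F d - F c)" if "c \<le> d" for c d
    unfolding \<mu>_def using that monoF contF
    by (simp add: emeasure_interval_measure_Icc)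
  have "\<exists>g\<in>borel_measurable lborel. density lborel g = \<mu>"
    by (rule sigma_finite_measure.Radon_Nikodym[OF sigma_finite_lborel])
       (use absolutely_continuous_interval_measure[OF f mono] in \<open>auto simp: \<mu>_def F_def[abs_def]\<close>)
  then obtain g where [measurable]: "g \<in> borel_measurable borel" and g: "density lborel g = \<mu>" by auto
  have gI: "emeasure \<mu> X = (\<integral>\<^sup>+x. g x * indicator X x \<partial>lborel)" if "X \<in> sets borel" for X
    using that unfolding g[symmetric] by (subst emeasure_density) auto
  have "emeasure \<mu> UNIV = (SUP n. emeasure \<mu> {-real n..real n})"
  proof -
    have "(\<Union>n. {-real n..real n}) = UNIV"
    proof -
      show ?thesis using ex_nat_Icc by blast
    qed
    then show ?thesis by (subst SUP_emeasure_incseq) (auto simp: incseq_def)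
  qed
  also have "\<dots> \<le> ennreal (f 1 - f 0)"
    by (intro SUP_least) (auto simp: Icc F_def intro!: ennreal_leI diff_mono mono)
  finally have "emeasure \<mu> UNIV < \<infinity>" by (simp add: le_less_trans)
  then have gfin: "(\<integral>\<^sup>+x. g x \<partial>lborel) < \<infinity>" by (simp add: gI)
  then have AEg: "AE x in lborel. g x \<noteq> \<infinity>" by (intro nn_integral_PInf_AE) auto
  define h where "h x = enn2real (g x)" for x
  have [measurable]: "h \<in> borel_measurable borel" unfolding h_def by measurable
  have AEh: "AE x in lborel. ennreal (h x) = g x" using AEg by eventually_elim (auto simp: h_def less_top)
  have int: "integrable lborel h"
    unfolding integrable_iff_bounded using gfin nn_integral_cong_AE[OF AEh]
    by (auto simp: h_def)
  show thesis
  proof (rule that[OF int])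
    fix a b :: real assume ab: "a \<le> b"
    have "ennreal (F b - F a) = (\<integral>\<^sup>+x. g x * indicator {a..b} x \<partial>lborel)"
      using Icc[OF ab] gI[of "{a..b}"] by simp
    also have "\<dots> = (\<integral>\<^sup>+x. ennreal (indicator {a..b} x * h x) \<partial>lborel)"
      using AEh by (intro nn_integral_cong_AE) (auto elim!: eventually_mono simp: indicator_def)
    also have "\<dots> = ennreal (LINT x|lborel. indicator {a..b} x * h x)"
    proof (rule nn_integral_eq_integral)
      show "integrable lborel (\<lambda>x. indicator {a..b} x * h x)"
        using integrable_mult_indicator[OF _ int, of "{a..b}"] by simp
    qed (auto simp: h_def)
    finally have "F b - F a = (LINT x|lborel. indicator {a..b} x * h x)"
      by (subst (asm) ennreal_inj) (auto simp: monoF ab h_def intro!: integral_nonneg_AE)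
    then show "f (clamp01 b) - f (clamp01 a) = (LINT t:{a..b}|lborel. h t)"
      by (simp add: set_lebesgue_integral_def F_def)
  qed
qed

text \<open>Jordan decomposition: \<open>f\<close> is the difference of
  \<open>f + variation f\<close> and \<open>variation f\<close>, both nondecreasing and absolutely
  continuous.\<close>

lemma abs_cont_integral_real:
  fixes f :: "real \<Rightarrow> real"
  assumes f: "abs_cont_on_I f"
  obtains h where "integrable lborel h"
    "\<And>a b. a \<le> b \<Longrightarrow> f (clamp01 b) - f (clamp01 a) = (LINT t:{a..b}|lborel. h t)"
    "AE t in lborel. 0 < t \<and> t < 1 \<longrightarrow> (f has_real_derivative h t) (at t)"
proof -
  note V = abs_cont_variation[OF f]
  obtain h1 where h1: "integrable lborel h1"
    "\<And>a b. a \<le> b \<Longrightarrow> variation f (clamp01 b) - variation f (clamp01 a) = (LINT t:{a..b}|lborel. h1 t)"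
    by (rule mono_abs_cont_integral[OF V variation_mono[OF f]]) (assumption | rule that; assumption)+
  have "f s + variation f s \<le> f t + variation f t" if "0 \<le> s" "s \<le> t" "t \<le> 1" for s t
    using variation_increment[OF f that] by (auto simp: abs_le_iff)
  then obtain h2 where h2: "integrable lborel h2"
    "\<And>a b. a \<le> b \<Longrightarrow> (f (clamp01 b) + variation f (clamp01 b)) - (f (clamp01 a) + variation f (clamp01 a)) = (LINT t:{a..b}|lborel. h2 t)"
    by (rule mono_abs_cont_integral[OF abs_cont_on_I_add[OF f V]]) (assumption | rule that; assumption)+
  define h where "h t = h2 t - h1 t" for t
  have h: "integrable lborel h" unfolding h_def using h1 h2 by auto
  have si: "set_integrable lborel {a..b} h1" "set_integrable lborel {a..b} h2" for a b
    unfolding set_integrable_def by (intro integrable_mult_indicator h1 h2; simp)+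
  have hF: "f (clamp01 b) - f (clamp01 a) = (LINT t:{a..b}|lborel. h t)" if "a \<le> b" for a b
    using h1(2)[OF that] h2(2)[OF that] set_integral_diff(2)[OF si(2) si(1)]
    unfolding h_def by simp
  have "AE t in lborel. ((\<lambda>t. f (clamp01 t)) has_real_derivative h t) (at t)"
    by (rule AE_has_real_derivative_integral[OF h hF])
  then have "AE t in lborel. 0 < t \<and> t < 1 \<longrightarrow> (f has_real_derivative h t) (at t)"
  proof eventually_elim
    case (elim t)
    show ?case
    proof
      assume t: "0 < t \<and> t < 1"
      show "(f has_real_derivative h t) (at t)"
        using elim
        by (rule has_field_derivative_transform_within_open[where S="{0<..<1}"]) (use t in auto)
    qed
  qed
  with h hF show thesis using that by blast
qed

theorem abs_cont_AE_has_vector_derivative: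
  fixes f :: "real \<Rightarrow> 'b::euclidean_space"
  assumes f: "abs_cont_on_I f"
  shows "AE t in lborel. 0 < t \<and> t < 1 \<longrightarrow> (\<exists>v. (f has_vector_derivative v) (at t))"
proof -
  have "\<exists>h. AE t in lborel. 0 < t \<and> t < 1 \<longrightarrow> ((\<lambda>t. f t \<bullet> i) has_real_derivative h t) (at t)"
    if "i \<in> Basis" for i
  proof -
    have "norm i \<le> 1" using that by simp
    from abs_cont_on_I_inner[OF f this] obtain h where
      "AE t in lborel. 0 < t \<and> t < 1 \<longrightarrow> ((\<lambda>t. f t \<bullet> i) has_real_derivative h t) (at t)"
      by (rule abs_cont_integral_real)
    then show ?thesis by (intro exI[of _ h])
  qed
  then obtain h where "\<And>i. i \<in> Basis \<Longrightarrow> AE t in lborel. 0 < t \<and> t < 1 \<longrightarrow> ((\<lambda>t. f t \<bullet> i) has_real_derivative h i t) (at t)"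
    by metis
  then have "AE t in lborel. \<forall>i\<in>Basis. 0 < t \<and> t < 1 \<longrightarrow> ((\<lambda>t. f t \<bullet> i) has_real_derivative h i t) (at t)"
    by (intro AE_finite_allI) auto
  then show ?thesis
  proof eventually_elim
    case (elim t)
    show ?case
    proof
      assume t: "0 < t \<and> t < 1"
      have "((\<lambda>x. \<Sum>i\<in>Basis. (f x \<bullet> i) *\<^sub>R i) has_vector_derivative (\<Sum>i\<in>Basis. h i t *\<^sub>R i)) (at t)"
        using elim t
        by (intro has_vector_derivative_sum has_vector_derivative_scaleR[THEN has_vector_derivative_eq_rhs])
           (auto intro: derivative_eq_intros)
      then show "\<exists>v. (f has_vector_derivative v) (at t)" by (auto simp: euclidean_representation)
    qed
  qed
qed

text \<open>The curve is tested against the unit direction \<open>u\<close> of its increment: the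
  increment of the scalar function \<open>f t \<bullet> u\<close> is the full norm, whereas its
  derivative is at most \<open>norm (v t)\<close>. The half-open interval lets consecutive pieces be
  added without overlap.\<close>

theorem abs_cont_norm_diff_le:
  fixes f v :: "real \<Rightarrow> 'b::euclidean_space"
  assumes f: "abs_cont_on_I f" and v: "AE t in lborel. 0 < t \<and> t < 1 \<longrightarrow> (f has_vector_derivative v t) (at t)"
    and ab: "0 \<le> a" "a \<le> b" "b \<le> 1"
  shows "ennreal (norm (f b - f a)) \<le> (\<integral>\<^sup>+t. ennreal (norm (v t)) * indicator {a..<b} t \<partial>lborel)"
proof -
  define u where "u = sgn (f b - f a)"
  have u: "norm u \<le> 1" by (simp add: u_def norm_sgn)
  obtain h where h: "integrable lborel h"
    "\<And>a b. a \<le> b \<Longrightarrow> f (clamp01 b) \<bullet> u - f (clamp01 a) \<bullet> u = (LINT t:{a..b}|lborel. h t)"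
    "AE t in lborel. 0 < t \<and> t < 1 \<longrightarrow> ((\<lambda>t. f t \<bullet> u) has_real_derivative h t) (at t)"
    by (rule abs_cont_integral_real[OF abs_cont_on_I_inner[OF f u]]) (rule that; assumption)
  have hv: "AE t in lborel. 0 < t \<and> t < 1 \<longrightarrow> \<bar>h t\<bar> \<le> norm (v t)"
    using v h(3)
  proof eventually_elim
    case (elim t)
    show ?case
    proof
      assume t: "0 < t \<and> t < 1"
      have "((\<lambda>t. f t \<bullet> u) has_vector_derivative (v t \<bullet> u)) (at t)"
        using bounded_linear.has_vector_derivative[OF bounded_linear_inner_left] elim t by blast
      then have "((\<lambda>t. f t \<bullet> u) has_real_derivative (v t \<bullet> u)) (at t)"
        by (simp add: has_real_derivative_iff_has_vector_derivative)
      then have "h t = v t \<bullet> u" using elim t DERIV_unique by blast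
      then show "\<bar>h t\<bar> \<le> norm (v t)"
        using Cauchy_Schwarz_ineq2[of "v t" u] u by (metis mult_left_le norm_ge_zero order_trans)
    qed
  qed
  have "norm (f b - f a) = f b \<bullet> u - f a \<bullet> u"
    unfolding u_def sgn_div_norm inner_diff_left[symmetric]
    by (cases "f b = f a") (auto simp: dot_square_norm power2_eq_square)
  also have "\<dots> = (LINT t:{a..b}|lborel. h t)" using h(2)[of a b] ab by simp
  finally have "ennreal (norm (f b - f a)) \<le> ennreal (norm (LINT t|lborel. indicator {a..b} t *\<^sub>R h t))"
    by (simp add: set_lebesgue_integral_def ennreal_leI)
  also have "\<dots> \<le> (\<integral>\<^sup>+t. ennreal (norm (indicator {a..b} t *\<^sub>R h t)) \<partial>lborel)"
    by (intro integral_norm_bound_ennreal integrable_mult_indicator h) auto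
  also have "\<dots> \<le> (\<integral>\<^sup>+t. ennreal (norm (v t)) * indicator {a..<b} t \<partial>lborel)"
  proof (rule nn_integral_mono_AE)
    have "AE t in lborel. t \<noteq> a \<and> t \<noteq> b"
      using AE_lborel_singleton[of a] AE_lborel_singleton[of b] by eventually_elim auto
    then show "AE t in lborel. ennreal (norm (indicator {a..b} t *\<^sub>R h t)) \<le> ennreal (norm (v t)) * indicator {a..<b} t"
      using hv by eventually_elim (use ab in \<open>auto simp: indicator_def intro!: ennreal_leI\<close>)
  qed
  finally show ?thesis .
qed

section \<open>Measurability of the derivative of a family of curves\<close>

lemma tendsto_one_over_Suc: "(\<lambda>n. 1 / real (Suc n)) \<longlonglongrightarrow> 0"
  using LIMSEQ_inverse_real_of_nat by (simp only: inverse_eq_divide)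

text \<open>Continuity extends the difference estimate from rational increments to real ones. All
  quantifiers then range over countable sets, which makes differentiability a measurable
  condition.\<close>

lemma has_vector_derivative_iff_rational:
  fixes f :: "real \<Rightarrow> 'b::real_normed_vector"
  assumes f: "continuous_on UNIV f"
  shows "(f has_vector_derivative v) (at t) \<longleftrightarrow>
    (\<forall>n. \<exists>m. \<forall>h::rat. \<bar>real_of_rat h\<bar> < 1 / real (Suc m) \<longrightarrow>
        norm (f (t + real_of_rat h) - f t - real_of_rat h *\<^sub>R v) \<le> \<bar>real_of_rat h\<bar> / real (Suc n))"
    (is "?L \<longleftrightarrow> ?R")
proof -
  have L: "?L \<longleftrightarrow> (\<forall>e>0. \<exists>d>0. \<forall>y. norm (y - t) < d \<longrightarrow> norm (f y - f t - (y - t) *\<^sub>R v) \<le> e * norm (y - t))"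
    unfolding has_vector_derivative_def has_derivative_within_alt by (auto intro: bounded_linear_scaleR_left)
  show ?thesis
  proof
    assume ?L
    show ?R
    proof
      fix n
      obtain d where d: "d > 0" "\<And>y. norm (y - t) < d \<Longrightarrow> norm (f y - f t - (y - t) *\<^sub>R v) \<le> (1 / real (Suc n)) * norm (y - t)"
        using \<open>?L\<close> unfolding L by (metis of_nat_0_less_iff zero_less_Suc zero_less_divide_1_iff)
      obtain m where "1 / real (Suc m) < d"
        using reals_Archimedean[OF d(1)] by (auto simp: inverse_eq_divide)
      then show "\<exists>m. \<forall>h::rat. \<bar>real_of_rat h\<bar> < 1 / real (Suc m) \<longrightarrow>
        norm (f (t + real_of_rat h) - f t - real_of_rat h *\<^sub>R v) \<le> \<bar>real_of_rat h\<bar> / real (Suc n)"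
        using d(2)[of "t + real_of_rat h" for h] by (intro exI[of _ m]) auto
    qed
  next
    assume R: ?R
    show ?L unfolding L
    proof (intro allI impI)
      fix e :: real assume e: "e > 0"
      obtain n where n: "1 / real (Suc n) < e"
        using reals_Archimedean[OF e] by (auto simp: inverse_eq_divide)
      obtain m where m: "\<And>h::rat. \<bar>real_of_rat h\<bar> < 1 / real (Suc m) \<Longrightarrow>
        norm (f (t + real_of_rat h) - f t - real_of_rat h *\<^sub>R v) \<le> \<bar>real_of_rat h\<bar> / real (Suc n)"
        using R by blast
      have "norm (f y - f t - (y - t) *\<^sub>R v) \<le> e * norm (y - t)" if y: "norm (y - t) < 1 / real (Suc m)" for y
      proof -
        have "\<exists>h::rat. \<bar>real_of_rat h - (y - t)\<bar> < 1 / real (Suc k)" for k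
        proof -
          have "(y - t) < (y - t) + 1 / real (Suc k)" by simp
          from of_rat_dense[OF this] obtain q where "y - t < real_of_rat q" "real_of_rat q < y - t + 1 / real (Suc k)" by blast
          then show ?thesis by (intro exI[of _ q]) auto
        qed
        then obtain h where h: "\<And>k. \<bar>real_of_rat (h k) - (y - t)\<bar> < 1 / real (Suc k)" by metis
        have lim: "(\<lambda>k. real_of_rat (h k)) \<longlonglongrightarrow> y - t"
        proof (rule LIM_zero_cancel, rule tendsto_rabs_zero_cancel)
          show "(\<lambda>k. \<bar>real_of_rat (h k) - (y - t)\<bar>) \<longlonglongrightarrow> 0"
            by (rule tendsto_sandwich[OF _ _ tendsto_const tendsto_one_over_Suc])
               (use h in \<open>auto intro!: always_eventually less_imp_le simp del: of_nat_Suc\<close>)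
        qed
        have "isCont f (t + (y - t))" using f by (auto simp: continuous_on_eq_continuous_at)
        then have "(\<lambda>k. f (t + real_of_rat (h k))) \<longlonglongrightarrow> f (t + (y - t))"
          by (rule isCont_tendsto_compose) (intro tendsto_intros lim)
        then have 1: "(\<lambda>k. norm (f (t + real_of_rat (h k)) - f t - real_of_rat (h k) *\<^sub>R v)) \<longlonglongrightarrow>
            norm (f y - f t - (y - t) *\<^sub>R v)"
          by (intro tendsto_intros lim) simp
        have 2: "(\<lambda>k. \<bar>real_of_rat (h k)\<bar> / real (Suc n)) \<longlonglongrightarrow> \<bar>y - t\<bar> / real (Suc n)"
          by (intro tendsto_intros lim) simp
        have "eventually (\<lambda>k. \<bar>real_of_rat (h k)\<bar> < 1 / real (Suc m)) sequentially"
          using order_tendstoD(2)[OF tendsto_rabs[OF lim]] y by simp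
        then have "eventually (\<lambda>k. norm (f (t + real_of_rat (h k)) - f t - real_of_rat (h k) *\<^sub>R v) \<le> \<bar>real_of_rat (h k)\<bar> / real (Suc n)) sequentially"
          by eventually_elim (rule m)
        from tendsto_le[OF _ 2 1 this] have "norm (f y - f t - (y - t) *\<^sub>R v) \<le> \<bar>y - t\<bar> / real (Suc n)"
          by simp
        also have "\<dots> = (1 / real (Suc n)) * \<bar>y - t\<bar>" by simp
        also have "\<dots> \<le> e * \<bar>y - t\<bar>" using n by (intro mult_right_mono) auto
        finally show ?thesis by simp
      qed
      then show "\<exists>d>0. \<forall>y. norm (y - t) < d \<longrightarrow> norm (f y - f t - (y - t) *\<^sub>R v) \<le> e * norm (y - t)"
        by (intro exI[of _ "1 / real (Suc m)"]) auto
    qed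
  qed
qed

text \<open>A measurable selection of the derivative; the limit is unspecified where it does not exist.\<close>

definition right_derivative :: "(real \<Rightarrow> 'b::real_normed_vector) \<Rightarrow> real \<Rightarrow> 'b" where
  "right_derivative f t = lim (\<lambda>n. real (Suc n) *\<^sub>R (f (t + 1 / real (Suc n)) - f t))"

lemma right_derivative_eq:
  fixes f :: "real \<Rightarrow> 'b::real_normed_vector"
  assumes "(f has_vector_derivative v) (at t)"
  shows "right_derivative f t = v"
proof -
  have "((\<lambda>y. norm (f y - f t - (y - t) *\<^sub>R v) / norm (y - t)) \<longlongrightarrow> 0) (at t)"
    using assms unfolding has_vector_derivative_def has_derivative_iff_norm by simp
  then have "(\<lambda>n. norm (f (t + 1 / real (Suc n)) - f t - (t + 1 / real (Suc n) - t) *\<^sub>R v) / norm (t + 1 / real (Suc n) - t)) \<longlonglongrightarrow> 0"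
  proof (rule filterlim_compose)
    have "(\<lambda>n. t + 1 / real (Suc n)) \<longlonglongrightarrow> t + 0"
      by (intro tendsto_add tendsto_const tendsto_one_over_Suc)
    then show "filterlim (\<lambda>n. t + 1 / real (Suc n)) (at t) sequentially"
      by (simp add: filterlim_at)
  qed
  moreover have "norm (f (t + 1 / real (Suc n)) - f t - (t + 1 / real (Suc n) - t) *\<^sub>R v) / norm (t + 1 / real (Suc n) - t)
      = norm (real (Suc n) *\<^sub>R (f (t + 1 / real (Suc n)) - f t) - v)" for n
  proof -
    have "real (Suc n) *\<^sub>R (f (t + 1 / real (Suc n)) - f t) - v =
        real (Suc n) *\<^sub>R (f (t + 1 / real (Suc n)) - f t - (1 / real (Suc n)) *\<^sub>R v)"
      by (simp add: scaleR_diff_right del: of_nat_Suc)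
    then show ?thesis by (simp add: del: of_nat_Suc)
  qed
  ultimately have "(\<lambda>n. norm (real (Suc n) *\<^sub>R (f (t + 1 / real (Suc n)) - f t) - v)) \<longlonglongrightarrow> 0"
    by simp
  then have "(\<lambda>n. real (Suc n) *\<^sub>R (f (t + 1 / real (Suc n)) - f t)) \<longlonglongrightarrow> v"
    by (rule LIM_zero_cancel[OF tendsto_norm_zero_cancel])
  then show ?thesis unfolding right_derivative_def by (rule limI)
qed

lemma measurable_right_derivative:
  fixes X :: "'g \<Rightarrow> real \<Rightarrow> 'b::euclidean_space"
  assumes [measurable]: "(\<lambda>z. X (fst z) (snd z)) \<in> borel_measurable (P \<Otimes>\<^sub>M borel)"
  shows "(\<lambda>z. right_derivative (X (fst z)) (snd z)) \<in> borel_measurable (P \<Otimes>\<^sub>M borel)"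
proof -
  have "(\<lambda>z. X (fst z) (snd z + c)) \<in> borel_measurable (P \<Otimes>\<^sub>M borel)" for c
  proof -
    have "(\<lambda>z. (fst z, snd z + c)) \<in> P \<Otimes>\<^sub>M borel \<rightarrow>\<^sub>M P \<Otimes>\<^sub>M borel" by measurable
    from measurable_compose[OF this assms] show ?thesis by simp
  qed
  then show ?thesis
    unfolding right_derivative_def by (intro borel_measurable_lim_metric) auto
qed

text \<open>An existing derivative equals \<open>right_derivative\<close>; naming this candidate
  removes the uncountable quantifier over possible derivatives.\<close>

lemma pred_has_vector_derivative:
  fixes X :: "'g \<Rightarrow> real \<Rightarrow> 'b::euclidean_space"
  assumes X [measurable]: "(\<lambda>z. X (fst z) (snd z)) \<in> borel_measurable (P \<Otimes>\<^sub>M borel)"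
    and cont: "\<And>p. continuous_on UNIV (X p)"
  shows "Measurable.pred (P \<Otimes>\<^sub>M borel)
     (\<lambda>z. (X (fst z) has_vector_derivative right_derivative (X (fst z)) (snd z)) (at (snd z)))"
proof -
  note measurable_right_derivative[OF X, measurable]
  have [measurable]: "(\<lambda>z. X (fst z) (snd z + c)) \<in> borel_measurable (P \<Otimes>\<^sub>M borel)" for c
  proof -
    have "(\<lambda>z. (fst z, snd z + c)) \<in> P \<Otimes>\<^sub>M borel \<rightarrow>\<^sub>M P \<Otimes>\<^sub>M borel" by measurable
    from measurable_compose[OF this X] show ?thesis by simp
  qed
  show ?thesis
    unfolding has_vector_derivative_iff_rational[OF cont] by measurable
qed

lemma measurable_restrict_I: "(\<lambda>z. (fst z, snd z)) \<in> P \<Otimes>\<^sub>M I_measure \<rightarrow>\<^sub>M P \<Otimes>\<^sub>M borel"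
proof (rule measurable_Pair)
  show "(\<lambda>z. snd z) \<in> P \<Otimes>\<^sub>M I_measure \<rightarrow>\<^sub>M borel"
    by (rule measurable_compose[OF measurable_snd]) (auto intro: measurable_restrict_space1)
qed simp

lemma measurable_snd_I [measurable]: "(\<lambda>z. snd z) \<in> borel_measurable (P \<Otimes>\<^sub>M I_measure)"
  using measurable_compose[OF measurable_restrict_I measurable_snd] by simp

lemma sigma_finite_I_measure: "sigma_finite_measure I_measure"
  by (rule sigma_finite_measure_restrict_space[OF sigma_finite_lborel]) auto

text \<open>Measurability of the differentiability condition allows the statement for almost every
  path and almost every time to be read on the product space.\<close>

lemma AE_pair_has_vector_derivative:
  fixes X :: "'g \<Rightarrow> real \<Rightarrow> 'b::euclidean_space"
  assumes P: "sigma_finite_measure P"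
    and X: "(\<lambda>z. X (fst z) (snd z)) \<in> borel_measurable (P \<Otimes>\<^sub>M borel)"
    and cont: "\<And>p. continuous_on UNIV (X p)"
    and AE: "AE p in P. AE t in lborel. 0 < t \<and> t < 1 \<longrightarrow> (\<exists>v. (X p has_vector_derivative v) (at t))"
  shows "AE z in P \<Otimes>\<^sub>M I_measure.
     0 < snd z \<and> snd z < 1 \<and> (X (fst z) has_vector_derivative right_derivative (X (fst z)) (snd z)) (at (snd z))"
proof -
  interpret pair_sigma_finite P I_measure
    using P sigma_finite_I_measure by (simp add: pair_sigma_finite_def)
  have [measurable]: "Measurable.pred (P \<Otimes>\<^sub>M I_measure)
     (\<lambda>z. (X (fst z) has_vector_derivative right_derivative (X (fst z)) (snd z)) (at (snd z)))"
    using measurable_compose[OF measurable_restrict_I pred_has_vector_derivative[OF X cont]] by simp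
  have "AE p in P. AE t in I_measure. 0 < snd (p, t) \<and> snd (p, t) < 1 \<and>
     (X (fst (p, t)) has_vector_derivative right_derivative (X (fst (p, t))) (snd (p, t))) (at (snd (p, t)))"
    using AE
  proof eventually_elim
    case (elim p)
    have "AE t in lborel. t \<noteq> 0 \<and> t \<noteq> (1::real)"
      using AE_lborel_singleton[of "0::real"] AE_lborel_singleton[of "1::real"] by eventually_elim auto
    with elim have "AE t in lborel. t \<in> {0..1} \<longrightarrow> 0 < t \<and> t < 1 \<and>
        (X p has_vector_derivative right_derivative (X p) t) (at t)"
      by eventually_elim (auto simp: right_derivative_eq)
    then show ?case by (subst AE_restrict_space_iff) auto
  qed
  then show ?thesis by (intro AE_pair_measure) measurable
qed

section \<open>Discrete energies of Lipschitz patterns\<close>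

lemma cost_ratio_antimono:
  assumes \<tau>: "transportation_cost \<tau>" "concave_on {0..} \<tau>" and vw: "0 < v" "v \<le> w"
  shows "\<tau> w / w \<le> \<tau> v / v"
proof -
  \<comment> \<open>The point \<open>v\<close> lies on the segment from 0 to \<open>w\<close> with
    weight \<open>v / w\<close>; since \<tau> vanishes at 0, concavity compares the slopes of two
    chords from the origin.\<close>
  have "(1 - v / w) * \<tau> 0 + (v / w) * \<tau> w \<le> \<tau> ((1 - v / w) *\<^sub>R 0 + (v / w) *\<^sub>R w)"
    by (rule concave_onD[OF \<tau>(2)]) (use vw in auto)
  moreover have "\<tau> 0 = 0" using \<tau>(1) by (simp add: transportation_cost_def)
  ultimately have "(v / w) * \<tau> w \<le> \<tau> v" using vw by simp
  then show ?thesis using vw by (simp add: field_simps)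
qed

text \<open>The quotient grows as the mass decreases to 0, so the limit in the definition exists and
  is a supremum, possibly infinite.\<close>

lemma r_tau_zero:
  assumes \<tau>: "transportation_cost \<tau>" "concave_on {0..} \<tau>"
  shows "r_tau \<tau> 0 = (SUP v\<in>{0<..}. ennreal (\<tau> v / v))"
proof -
  let ?g = "\<lambda>v. ennreal (\<tau> v / v)" and ?S = "SUP v\<in>{0<..}. ennreal (\<tau> v / v)"
  have "(?g \<longlongrightarrow> ?S) (at_right 0)"
  proof (rule order_tendstoI)
    fix a assume "a < ?S"
    then obtain v0 where v0: "v0 > 0" "a < ?g v0" by (auto simp: less_SUP_iff)
    have "a < ?g v" if "0 < v" "v < v0" for v
      using v0(2) cost_ratio_antimono[OF \<tau>, of v v0] that by (auto intro: less_le_trans ennreal_leI)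
    then show "eventually (\<lambda>v. a < ?g v) (at_right 0)"
      using v0(1) unfolding eventually_at_right_field by blast
  next
    fix a assume "?S < a"
    then have "?g v < a" if "0 < v" for v using that by (meson SUP_upper greaterThan_iff le_less_trans)
    then show "eventually (\<lambda>v. ?g v < a) (at_right 0)"
      unfolding eventually_at_right_field by (intro exI[of _ 1]) auto
  qed
  then have "Lim (at_right 0) ?g = ?S" by (intro tendsto_Lim) auto
  then show ?thesis by (simp add: r_tau_def)
qed

lemma r_tau_antimono:
  assumes \<tau>: "transportation_cost \<tau>" "concave_on {0..} \<tau>" and vw: "0 \<le> v" "v \<le> w"
  shows "r_tau \<tau> w \<le> r_tau \<tau> v"
proof (cases "v = 0")
  case True
  show ?thesis
  proof (cases "w = 0")
    case False
    then have "0 < w" using vw by simp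
    then have "r_tau \<tau> w = ennreal (\<tau> w / w)" by (simp add: r_tau_def)
    also have "\<dots> \<le> (SUP v\<in>{0<..}. ennreal (\<tau> v / v))" using \<open>0 < w\<close> by (intro SUP_upper) auto
    finally show ?thesis unfolding True r_tau_zero[OF \<tau>] .
  qed (use True in auto)
next
  case False
  then show ?thesis using vw cost_ratio_antimono[OF \<tau>, of v w] by (auto simp: r_tau_def intro: ennreal_leI)
qed

text \<open>Lower semicontinuity from the right. For \<open>w > 0\<close> the numerator is bounded
  below by \<open>\<tau> w\<close> while the denominator tends to \<open>w\<close>; for
  \<open>w = 0\<close> the supremum formula applies.\<close>

lemma r_tau_right_approx:
  assumes \<tau>: "transportation_cost \<tau>" "concave_on {0..} \<tau>" and w: "0 \<le> w"
  shows "r_tau \<tau> w \<le> (SUP n. r_tau \<tau> (w + 1 / real (Suc n)))"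
proof (cases "w = 0")
  case True
  have "ennreal (\<tau> v / v) \<le> (SUP n. r_tau \<tau> (1 / real (Suc n)))" if v: "v > 0" for v
  proof -
    obtain n where n: "1 / real (Suc n) < v" using reals_Archimedean[OF v] by (auto simp: inverse_eq_divide)
    have "ennreal (\<tau> v / v) = r_tau \<tau> v" using v by (simp add: r_tau_def)
    also have "\<dots> \<le> r_tau \<tau> (1 / real (Suc n))" using n by (intro r_tau_antimono[OF \<tau>]) auto
    also have "\<dots> \<le> (SUP n. r_tau \<tau> (1 / real (Suc n)))" by (rule SUP_upper) simp
    finally show ?thesis .
  qed
  then show ?thesis unfolding True r_tau_zero[OF \<tau>] by (auto intro!: SUP_least)
next
  case False
  then have w: "w > 0" using w by simp
  have mono: "\<tau> v \<le> \<tau> u" if "0 \<le> v" "v \<le> u" for u v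
    using \<tau>(1) that by (auto simp: transportation_cost_def)
  have "(\<lambda>n. \<tau> w / (w + 1 / real (Suc n))) \<longlonglongrightarrow> \<tau> w / (w + 0)"
    by (intro tendsto_intros tendsto_one_over_Suc) (use w in auto)
  then have "(\<lambda>n. ennreal (\<tau> w / (w + 1 / real (Suc n)))) \<longlonglongrightarrow> ennreal (\<tau> w / w)"
    by (intro tendsto_ennrealI) simp
  then have "ennreal (\<tau> w / w) \<le> (SUP n. r_tau \<tau> (w + 1 / real (Suc n)))"
  proof (rule LIMSEQ_le_const2, intro exI allI impI)
    fix n :: nat
    have pos: "w + 1 / real (Suc n) > 0" using w by (simp add: add_pos_nonneg)
    have "\<tau> w / (w + 1 / real (Suc n)) \<le> \<tau> (w + 1 / real (Suc n)) / (w + 1 / real (Suc n))"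
      using pos w by (intro divide_right_mono mono) auto
    then have "ennreal (\<tau> w / (w + 1 / real (Suc n))) \<le> r_tau \<tau> (w + 1 / real (Suc n))"
      using pos by (simp add: r_tau_def ennreal_leI del: of_nat_Suc)
    also have "\<dots> \<le> (SUP n. r_tau \<tau> (w + 1 / real (Suc n)))" by (rule SUP_upper) simp
    finally show "ennreal (\<tau> w / (w + 1 / real (Suc n))) \<le> (SUP n. r_tau \<tau> (w + 1 / real (Suc n)))" .
  qed
  then show ?thesis using w by (simp add: r_tau_def)
qed

text \<open>Here upper semicontinuity of masses turns into lower semicontinuity of unit costs: each
  \<open>w + 1 / real (Suc n)\<close> eventually bounds \<open>u k\<close> from above.\<close>

lemma r_tau_le_liminf:
  assumes \<tau>: "transportation_cost \<tau>" "concave_on {0..} \<tau>" and w: "0 \<le> w" "\<And>k. 0 \<le> u k"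
    and ev: "\<And>e. e > 0 \<Longrightarrow> eventually (\<lambda>k. u k < w + e) sequentially"
  shows "r_tau \<tau> w \<le> liminf (\<lambda>k. r_tau \<tau> (u k))"
proof -
  have "r_tau \<tau> (w + 1 / real (Suc n)) \<le> liminf (\<lambda>k. r_tau \<tau> (u k))" for n
  proof (rule Liminf_bounded)
    have "eventually (\<lambda>k. u k < w + 1 / real (Suc n)) sequentially" by (rule ev) simp
    then show "eventually (\<lambda>k. r_tau \<tau> (w + 1 / real (Suc n)) \<le> r_tau \<tau> (u k)) sequentially"
      by eventually_elim (rule r_tau_antimono[OF \<tau> w(2) less_imp_le])
  qed
  then show ?thesis using r_tau_right_approx[OF \<tau> w(1)] by (meson SUP_least order_trans)
qed

lemma borel_measurable_r_tau [measurable]: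
  assumes \<tau>: "transportation_cost \<tau>"
  shows "r_tau \<tau> \<in> borel_measurable borel"
proof -
  \<comment> \<open>Monotonicity of \<tau> is available for nonnegative arguments only, hence the
    truncation at 0.\<close>
  have "mono (\<lambda>w. \<tau> (max 0 w))"
    using \<tau> by (auto simp: mono_def transportation_cost_def)
  then have [measurable]: "(\<lambda>w. \<tau> (max 0 w)) \<in> borel_measurable borel" by (rule borel_measurable_mono)
  have "r_tau \<tau> = (\<lambda>w. if w > 0 then ennreal (\<tau> (max 0 w) / w) else r_tau \<tau> 0)"
    by (auto simp: r_tau_def fun_eq_iff)
  also have "\<dots> \<in> borel_measurable borel" by measurable
  finally show ?thesis .
qed

text \<open>\<open>f\<close> is replaced by its running infima, which converge to the lower limit.
  The factor 0 is treated apart, since \<open>a\<close> may be infinite and multiplication is not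
  continuous there.\<close>

lemma mult_le_liminf_ennreal:
  fixes a :: ennreal
  assumes a: "a \<le> liminf f" and b: "g \<longlonglongrightarrow> ennreal b"
  shows "a * ennreal b \<le> liminf (\<lambda>k. f k * g k)"
proof (cases "ennreal b = 0")
  case False
  define h where "h k = (INF j\<in>{k..}. f j)" for k
  have inc: "incseq h" unfolding h_def by (auto simp: incseq_def intro!: INF_superset_mono)
  have "h \<longlonglongrightarrow> liminf f"
    using LIMSEQ_SUP[OF inc] by (simp add: liminf_SUP_INF h_def)
  then have "(\<lambda>k. h k * g k) \<longlonglongrightarrow> liminf f * ennreal b"
    using b by (rule tendsto_mult_ennreal) (use False in auto)
  then have "liminf (\<lambda>k. h k * g k) = liminf f * ennreal b" by (intro lim_imp_Liminf) auto
  moreover have "liminf (\<lambda>k. h k * g k) \<le> liminf (\<lambda>k. f k * g k)"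
    by (intro Liminf_mono always_eventually allI mult_right_mono) (auto simp: h_def intro: INF_lower)
  ultimately show ?thesis using a by (metis mult_right_mono order_trans zero_le)
qed simp

text \<open>Fatou's lemma for counting measure.\<close>

lemma sum_liminf_le_ennreal:
  fixes f :: "'i \<Rightarrow> nat \<Rightarrow> ennreal"
  assumes "finite A"
  shows "(\<Sum>i\<in>A. liminf (f i)) \<le> liminf (\<lambda>k. \<Sum>i\<in>A. f i k)"
proof -
  have "(\<Sum>i\<in>A. liminf (f i)) = (\<integral>\<^sup>+i. liminf (\<lambda>k. f i k) \<partial>count_space A)"
    using assms by (simp add: nn_integral_count_space_finite)
  also have "\<dots> \<le> liminf (\<lambda>k. \<integral>\<^sup>+i. f i k \<partial>count_space A)"
    by (rule nn_integral_liminf) auto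
  also have "\<dots> = liminf (\<lambda>k. \<Sum>i\<in>A. f i k)"
    using assms by (simp add: nn_integral_count_space_finite)
  finally show ?thesis .
qed

section \<open>Tubes, discrete energies and their lower semicontinuity\<close>

lemma floor_div_tendsto: "(\<lambda>n. real_of_int \<lfloor>real (Suc n) * t\<rfloor> / real (Suc n)) \<longlonglongrightarrow> t"
proof (rule LIM_zero_cancel, rule tendsto_rabs_zero_cancel,
    rule tendsto_sandwich[OF _ _ tendsto_const tendsto_one_over_Suc])
  show "\<forall>\<^sub>F n in sequentially. \<bar>real_of_int \<lfloor>real (Suc n) * t\<rfloor> / real (Suc n) - t\<bar> \<le> 1 / real (Suc n)"
  proof (intro always_eventually allI)
    fix n
    have "\<bar>real_of_int \<lfloor>real (Suc n) * t\<rfloor> - real (Suc n) * t\<bar> \<le> 1" by linarith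
    then have "\<bar>real_of_int \<lfloor>real (Suc n) * t\<rfloor> - real (Suc n) * t\<bar> / real (Suc n) \<le> 1 / real (Suc n)"
      by (intro divide_right_mono) auto
    moreover have "real_of_int \<lfloor>real (Suc n) * t\<rfloor> / real (Suc n) - t =
        (real_of_int \<lfloor>real (Suc n) * t\<rfloor> - real (Suc n) * t) / real (Suc n)"
      by (simp add: diff_divide_distrib del: of_nat_Suc)
    ultimately show "\<bar>real_of_int \<lfloor>real (Suc n) * t\<rfloor> / real (Suc n) - t\<bar> \<le> 1 / real (Suc n)"
      by (simp only: abs_divide abs_of_nat)
  qed
qed auto

text \<open>The non-strict inequality is deliberate: it passes to limits of paths and centres, and
  as \<open>d\<close> decreases to 0 it leaves exactly the paths through \<open>x\<close>.\<close>

definition tube :: "'g measure \<Rightarrow> ('g \<Rightarrow> real \<Rightarrow> 'b::metric_space) \<Rightarrow> real \<Rightarrow> 'b \<Rightarrow> 'g set" where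
  "tube P X d x = {q \<in> space P. \<exists>t\<in>{0..1}. dist (X q t) x \<le> d}"

text \<open>The cutoff \<open>L p < d * N\<close> keeps each of the \<open>N\<close> pieces of the path within distance
  \<open>d\<close> of its starting point; it is strict in order to be lower semicontinuous in \<open>L p\<close>.\<close>

definition discrete_energy ::
  "(real \<Rightarrow> real) \<Rightarrow> 'g measure \<Rightarrow> ('g \<Rightarrow> real \<Rightarrow> 'b::euclidean_space) \<Rightarrow> ('g \<Rightarrow> real) \<Rightarrow> nat \<Rightarrow> real \<Rightarrow> ennreal" where
  "discrete_energy \<tau> P X L N d = (\<integral>\<^sup>+p. (if L p < d * real N then
      (\<Sum>i<N. r_tau \<tau> (measure P (tube P X d (X p (real i / real N)))) *
        ennreal (norm (X p (real (Suc i) / real N) - X p (real i / real N)))) else 0) \<partial>P)"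

text \<open>The bounds hold for every \<open>p\<close> and on the whole time axis. Exceptional paths
  are replaced by constant ones beforehand, so no null set has to be carried along.\<close>

locale lipschitz_paths = finite_measure P for P :: "'g measure" +
  fixes X :: "'g \<Rightarrow> real \<Rightarrow> 'b::euclidean_space" and L :: "'g \<Rightarrow> real"
  assumes measurable_L [measurable]: "L \<in> borel_measurable P"
    and measurable_X [measurable]: "\<And>t. (\<lambda>p. X p t) \<in> borel_measurable P"
    and L_nonneg: "\<And>p. 0 \<le> L p"
    and lipschitz: "\<And>p s t. norm (X p s - X p t) \<le> L p * \<bar>s - t\<bar>"
begin

lemma continuous_X: "continuous_on A (X p)"
proof (rule continuous_on_subset[of UNIV])
  have "(L p)-lipschitz_on UNIV (X p)"
    using lipschitz L_nonneg by (auto intro!: lipschitz_onI simp: dist_norm)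
  then show "continuous_on UNIV (X p)" by (rule lipschitz_on_continuous_on)
qed simp

lemma tendsto_X: "(t \<longlongrightarrow> s) F \<Longrightarrow> ((\<lambda>k. X p (t k)) \<longlongrightarrow> X p s) F"
  using continuous_X[of UNIV p] by (rule continuous_on_tendsto_compose) auto

text \<open>Rounding time down to a grid gives a function that is measurable because the rounded
  time takes countably many values; continuity in time gives the limit.\<close>

lemma measurable_joint: "(\<lambda>z. X (fst z) (snd z)) \<in> borel_measurable (P \<Otimes>\<^sub>M borel)"
proof (rule borel_measurable_LIMSEQ_metric)
  fix n :: nat
  show "(\<lambda>z. X (fst z) (real_of_int \<lfloor>real (Suc n) * snd z\<rfloor> / real (Suc n))) \<in> borel_measurable (P \<Otimes>\<^sub>M borel)"
    by (rule measurable_compose_countable[where f="\<lambda>i z. X (fst z) (real_of_int i / real (Suc n))"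
          and g="\<lambda>z. \<lfloor>real (Suc n) * snd z\<rfloor>"]) measurable
next
  fix z :: "'g \<times> real"
  have "(\<lambda>n. real_of_int \<lfloor>real (Suc n) * snd z\<rfloor> / real (Suc n)) \<longlonglongrightarrow> snd z"
    by (rule floor_div_tendsto)
  then show "(\<lambda>n. X (fst z) (real_of_int \<lfloor>real (Suc n) * snd z\<rfloor> / real (Suc n))) \<longlonglongrightarrow> X (fst z) (snd z)"
    by (rule tendsto_X)
qed

text \<open>A strict inequality is open in time and so reaches a rational time; conversely the
  distance attains its minimum on the compact unit interval, and this minimum lies below every
  \<open>d + 1 / real (Suc n)\<close>.\<close>

lemma tube_iff_rational:
  "(\<exists>t\<in>{0..1}. dist (X q t) x \<le> d) \<longleftrightarrow>
    (\<forall>n. \<exists>r::rat. dist (X q (clamp01 (real_of_rat r))) x < d + 1 / real (Suc n))"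
proof
  assume "\<exists>t\<in>{0..1}. dist (X q t) x \<le> d"
  then obtain t where t: "t \<in> {0..1}" "dist (X q t) x \<le> d" by blast
  show "\<forall>n. \<exists>r::rat. dist (X q (clamp01 (real_of_rat r))) x < d + 1 / real (Suc n)"
  proof
    fix n
    have "continuous_on UNIV (\<lambda>s. dist (X q (clamp01 s)) x)"
      by (intro continuous_intros continuous_on_compose2[OF continuous_X[of UNIV] continuous_on_clamp01]) auto
    then have "isCont (\<lambda>s. dist (X q (clamp01 s)) x) t" by (auto simp: continuous_on_eq_continuous_at)
    moreover have "dist (X q (clamp01 t)) x < d + 1 / real (Suc n)" using t
      by (simp add: add_strict_increasing2 less_add_same_cancel1 le_less_trans[of _ d])
    ultimately have "eventually (\<lambda>s. dist (X q (clamp01 s)) x < d + 1 / real (Suc n)) (at t)"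
      unfolding isCont_def by (rule order_tendstoD(2))
    then obtain e where e: "e > 0" "\<And>s. s \<noteq> t \<Longrightarrow> dist s t < e \<Longrightarrow> dist (X q (clamp01 s)) x < d + 1 / real (Suc n)"
      by (auto simp: eventually_at)
    have "t < t + e" using e by simp
    from of_rat_dense[OF this] obtain r where "t < real_of_rat r" "real_of_rat r < t + e" by blast
    with e(2)[of "real_of_rat r"] show "\<exists>r::rat. dist (X q (clamp01 (real_of_rat r))) x < d + 1 / real (Suc n)"
      by (auto simp: dist_real_def)
  qed
next
  assume "\<forall>n. \<exists>r::rat. dist (X q (clamp01 (real_of_rat r))) x < d + 1 / real (Suc n)"
  then obtain r :: "nat \<Rightarrow> rat" where r: "\<And>n. dist (X q (clamp01 (real_of_rat (r n)))) x < d + 1 / real (Suc n)" by metis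
  have "continuous_on {0..1} (\<lambda>t. dist (X q t) x)" by (intro continuous_intros continuous_X)
  then obtain t where t: "t \<in> {0..1}" "\<And>s. s \<in> {0..1} \<Longrightarrow> dist (X q t) x \<le> dist (X q s) x"
    using continuous_attains_inf[of "{0..1::real}" "\<lambda>t. dist (X q t) x"] by auto
  have "dist (X q t) x \<le> d + 1 / real (Suc n)" for n
    using t(2)[of "clamp01 (real_of_rat (r n))"] r[of n] by auto
  moreover have "(\<lambda>n. d + 1 / real (Suc n)) \<longlonglongrightarrow> d + 0"
    by (intro tendsto_add tendsto_const tendsto_one_over_Suc)
  ultimately have "dist (X q t) x \<le> d + 0" by (intro LIMSEQ_le_const) auto
  with t show "\<exists>t\<in>{0..1}. dist (X q t) x \<le> d" by auto
qed

lemma pred_tube [measurable]: 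
  "Measurable.pred (borel \<Otimes>\<^sub>M P) (\<lambda>z. \<exists>t\<in>{0..1}. dist (X (snd z) t) (fst z) \<le> d)"
  unfolding tube_iff_rational by measurable

lemma sets_tube [measurable]: "tube P X d x \<in> sets P"
  unfolding tube_def tube_iff_rational by measurable

lemma measurable_measure_tube [measurable]: "(\<lambda>x. measure P (tube P X d x)) \<in> borel_measurable borel"
proof -
  have "{z \<in> space (borel \<Otimes>\<^sub>M P). \<exists>t\<in>{0..1}. dist (X (snd z) t) (fst z) \<le> d} \<in> sets (borel \<Otimes>\<^sub>M P)"
    by measurable
  from measurable_emeasure_Pair[OF this] 
  have "(\<lambda>x. emeasure P (tube P X d x)) \<in> borel_measurable borel"
    by (rule measurable_cong[THEN iffD1, rotated]) (auto simp: space_pair_measure tube_def intro!: arg_cong[where f="emeasure P"])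
  then show ?thesis unfolding measure_def by measurable
qed

end

text \<open>Convergence is required at each time separately; together with the convergent Lipschitz
  bounds it also yields convergence along moving times.\<close>

definition paths_converge ::
  "'g measure \<Rightarrow> (nat \<Rightarrow> 'g \<Rightarrow> real \<Rightarrow> 'b::euclidean_space) \<Rightarrow> (nat \<Rightarrow> 'g \<Rightarrow> real)
    \<Rightarrow> ('g \<Rightarrow> real \<Rightarrow> 'b) \<Rightarrow> ('g \<Rightarrow> real) \<Rightarrow> bool" where
  "paths_converge P Xs Ls X L \<longleftrightarrow>
    (AE q in P. (\<forall>t\<in>{0..1}. (\<lambda>k. Xs k q t) \<longlonglongrightarrow> X q t) \<and> (\<lambda>k. Ls k q) \<longlonglongrightarrow> L q)"

lemma tendsto_lipschitz_paths:
  fixes x :: "nat \<Rightarrow> real \<Rightarrow> 'b::real_normed_vector"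
  assumes lip: "\<And>k s t. norm (x k s - x k t) \<le> l k * \<bar>s - t\<bar>" and l: "l \<longlonglongrightarrow> l'"
    and x: "(\<lambda>k. x k u) \<longlonglongrightarrow> y" and t: "t \<longlonglongrightarrow> u" and m: "filterlim m at_top sequentially"
  shows "(\<lambda>j. x (m j) (t j)) \<longlonglongrightarrow> y"
proof (rule LIM_zero_cancel, rule tendsto_norm_zero_cancel)
  have "(\<lambda>j. l (m j) * \<bar>t j - u\<bar> + norm (x (m j) u - y)) \<longlonglongrightarrow> l' * \<bar>u - u\<bar> + norm (y - y)"
    by (intro tendsto_intros t filterlim_compose[OF l m] filterlim_compose[OF x m])
  then have "(\<lambda>j. l (m j) * \<bar>t j - u\<bar> + norm (x (m j) u - y)) \<longlonglongrightarrow> 0" by simp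
  then show "(\<lambda>j. norm (x (m j) (t j) - y)) \<longlonglongrightarrow> 0"
  proof (rule tendsto_sandwich[OF _ _ tendsto_const, rotated 2])
    have "norm (x (m j) (t j) - y) \<le> l (m j) * \<bar>t j - u\<bar> + norm (x (m j) u - y)" for j
      using lip[of "m j" "t j" u] norm_triangle_ineq[of "x (m j) (t j) - x (m j) u" "x (m j) u - y"] by simp
    then show "\<forall>\<^sub>F j in sequentially. norm (x (m j) (t j) - y) \<le> l (m j) * \<bar>t j - u\<bar> + norm (x (m j) u - y)"
      by simp
  qed simp
qed

text \<open>If \<open>q\<close> lies in infinitely many of the approximating tubes, the
  corresponding times accumulate in the compact unit interval, and at the accumulation point the
  limit path is within \<open>d\<close> of \<open>x\<close>. So almost all of the limit superior of
  the tubes lies in the limit tube.\<close>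

lemma tube_measure_upper_semicontinuous:
  fixes Xs :: "nat \<Rightarrow> 'g \<Rightarrow> real \<Rightarrow> 'b::euclidean_space"
  assumes Xs: "\<And>k. lipschitz_paths P (Xs k) (Ls k)" and X: "lipschitz_paths P X L"
    and conv: "paths_converge P Xs Ls X L" and x: "xs \<longlonglongrightarrow> x" and e: "e > 0"
  shows "eventually (\<lambda>k. measure P (tube P (Xs k) d (xs k)) < measure P (tube P X d x) + e) sequentially"
proof -
  interpret P: finite_measure P using X by (rule lipschitz_paths.axioms(1))
  interpret Xs: lipschitz_paths P "Xs k" "Ls k" for k by (rule Xs)
  interpret X: lipschitz_paths P X L by (rule X)
  define A where "A k = tube P (Xs k) d (xs k)" for k
  \<comment> \<open>The tail unions decrease to the limit superior, and continuity from above of a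
    finite measure converts the inclusion into an eventual inequality.\<close>
  define B where "B n = (\<Union>k\<in>{n..}. A k)" for n
  have [measurable]: "A k \<in> sets P" for k by (simp add: A_def)
  have [measurable]: "B n \<in> sets P" for n unfolding B_def by measurable
  have dec: "decseq B" unfolding B_def decseq_def by force
  have "AE q in P. q \<in> (\<Inter>n. B n) \<longrightarrow> q \<in> tube P X d x"
    using conv unfolding paths_converge_def
  proof eventually_elim
    case (elim q)
    show ?case
    proof
      assume q: "q \<in> (\<Inter>n. B n)"
      then have "\<forall>n. \<exists>k\<ge>n. q \<in> A k" by (auto simp: B_def)
      then obtain m where m: "\<And>n. m n \<ge> n" "\<And>n. q \<in> A (m n)" by metis
      then have "\<forall>n. \<exists>t\<in>{0..1}. dist (Xs (m n) q t) (xs (m n)) \<le> d" by (auto simp: A_def tube_def)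
      then obtain t where t: "\<And>n. t n \<in> {0..1}" "\<And>n. dist (Xs (m n) q (t n)) (xs (m n)) \<le> d" by metis
      obtain s r where s: "s \<in> {0..1}" "strict_mono r" "(t \<circ> r) \<longlonglongrightarrow> s"
        using compact_Icc[of "0::real" 1] t(1) unfolding compact_def by meson
      have m_top: "filterlim (\<lambda>j. m (r j)) at_top sequentially"
        by (rule filterlim_at_top_mono[OF filterlim_subseq[OF s(2)]]) (use m(1) in auto)
      have "(\<lambda>j. Xs (m (r j)) q ((t \<circ> r) j)) \<longlonglongrightarrow> X q s"
        by (rule tendsto_lipschitz_paths[where x="\<lambda>k. Xs k q" and l="\<lambda>k. Ls k q" and u=s and l'="L q", OF Xs.lipschitz])
           (use elim s m_top in \<open>auto simp: o_def\<close>)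
      moreover have "(\<lambda>j. xs (m (r j))) \<longlonglongrightarrow> x" by (rule filterlim_compose[OF x m_top])
      ultimately have "(\<lambda>j. dist (Xs (m (r j)) q ((t \<circ> r) j)) (xs (m (r j)))) \<longlonglongrightarrow> dist (X q s) x"
        by (rule tendsto_dist)
      then have "dist (X q s) x \<le> d" by (rule LIMSEQ_le_const2) (use t in auto)
      moreover have "q \<in> space P" using q sets.sets_into_space[of "B 0" P] by auto
      ultimately show "q \<in> tube P X d x" using s(1) by (auto simp: tube_def)
    qed
  qed
  then have "measure P (\<Inter>n. B n) \<le> measure P (tube P X d x)"
    by (intro P.finite_measure_mono_AE) auto
  then have "measure P (\<Inter>n. B n) < measure P (tube P X d x) + e" using e by simp
  moreover have "(\<lambda>n. measure P (B n)) \<longlonglongrightarrow> measure P (\<Inter>n. B n)"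
    by (rule P.finite_Lim_measure_decseq) (use dec in auto)
  ultimately have "eventually (\<lambda>n. measure P (B n) < measure P (tube P X d x) + e) sequentially"
    by (metis order_tendstoD(2))
  then show ?thesis
  proof eventually_elim
    case (elim n)
    have "measure P (A n) \<le> measure P (B n)" by (rule P.finite_measure_mono) (auto simp: B_def)
    with elim show ?case by (simp add: A_def)
  qed
qed

text \<open>For a fixed path every summand is lower semicontinuous: tube masses through
  \<open>r_tau_le_liminf\<close>, increments by convergence. Fatou's lemma integrates this over the
  paths.\<close>

lemma discrete_energy_lower_semicontinuous:
  fixes Xs :: "nat \<Rightarrow> 'g \<Rightarrow> real \<Rightarrow> 'b::euclidean_space"
  assumes \<tau>: "transportation_cost \<tau>" "concave_on {0..} \<tau>"
    and Xs: "\<And>k. lipschitz_paths P (Xs k) (Ls k)" and X: "lipschitz_paths P X L"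
    and conv: "paths_converge P Xs Ls X L"
  shows "discrete_energy \<tau> P X L N d \<le> liminf (\<lambda>k. discrete_energy \<tau> P (Xs k) (Ls k) N d)"
proof -
  interpret Xs: lipschitz_paths P "Xs k" "Ls k" for k by (rule Xs)
  interpret X: lipschitz_paths P X L by (rule X)
  note borel_measurable_r_tau[OF \<tau>(1), measurable]
  define F where "F X L p = (if L p < d * real N then
      (\<Sum>i<N. r_tau \<tau> (measure P (tube P X d (X p (real i / real N)))) *
        ennreal (norm (X p (real (Suc i) / real N) - X p (real i / real N)))) else 0)" for X :: "'g \<Rightarrow> real \<Rightarrow> 'b" and L p
  have "discrete_energy \<tau> P X L N d = (\<integral>\<^sup>+p. F X L p \<partial>P)" by (simp add: discrete_energy_def F_def)
  also have "\<dots> \<le> (\<integral>\<^sup>+p. liminf (\<lambda>k. F (Xs k) (Ls k) p) \<partial>P)"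
  proof (rule nn_integral_mono_AE)
    show "AE p in P. F X L p \<le> liminf (\<lambda>k. F (Xs k) (Ls k) p)"
      using conv unfolding paths_converge_def
    proof eventually_elim
      case (elim p)
      show ?case
      proof (cases "L p < d * real N")
        case True
        have Xc: "(\<lambda>k. Xs k p (real i / real N)) \<longlonglongrightarrow> X p (real i / real N)" if "i \<le> N" for i
          using elim that by (auto simp: divide_le_eq)
        define f where "f i k = r_tau \<tau> (measure P (tube P (Xs k) d (Xs k p (real i / real N)))) *
            ennreal (norm (Xs k p (real (Suc i) / real N) - Xs k p (real i / real N)))" for i k
        have "F X L p \<le> (\<Sum>i<N. liminf (f i))"
        proof -
          have "r_tau \<tau> (measure P (tube P X d (X p (real i / real N)))) *
            ennreal (norm (X p (real (Suc i) / real N) - X p (real i / real N))) \<le> liminf (f i)" if "i < N" for i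
            unfolding f_def
          proof (rule mult_le_liminf_ennreal)
            show "r_tau \<tau> (measure P (tube P X d (X p (real i / real N)))) \<le>
              liminf (\<lambda>k. r_tau \<tau> (measure P (tube P (Xs k) d (Xs k p (real i / real N)))))"
              by (rule r_tau_le_liminf[OF \<tau> _ _ tube_measure_upper_semicontinuous[OF Xs X conv Xc]])
                 (use that in auto)
            show "(\<lambda>k. ennreal (norm (Xs k p (real (Suc i) / real N) - Xs k p (real i / real N)))) \<longlonglongrightarrow>
              ennreal (norm (X p (real (Suc i) / real N) - X p (real i / real N)))"
              by (intro tendsto_ennrealI tendsto_norm tendsto_diff Xc) (use that in auto)
          qed
          then show ?thesis unfolding F_def using True by (auto intro!: sum_mono)
        qed
        also have "\<dots> \<le> liminf (\<lambda>k. \<Sum>i<N. f i k)" by (rule sum_liminf_le_ennreal) simp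
        also have "\<dots> \<le> liminf (\<lambda>k. F (Xs k) (Ls k) p)"
        proof (rule Liminf_mono)
          \<comment> \<open>The strict cutoff for the limit is inherited by all late indices; if it
            fails for the limit, the left side is 0.\<close>
          have "(\<lambda>k. Ls k p) \<longlonglongrightarrow> L p" using elim by blast
          then have "eventually (\<lambda>k. Ls k p < d * real N) sequentially" using True by (rule order_tendstoD(2))
          then show "eventually (\<lambda>k. (\<Sum>i<N. f i k) \<le> F (Xs k) (Ls k) p) sequentially"
            by eventually_elim (simp add: F_def f_def)
        qed
        finally show ?thesis .
      qed (simp add: F_def)
    qed
  qed
  also have "\<dots> \<le> liminf (\<lambda>k. \<integral>\<^sup>+p. F (Xs k) (Ls k) p \<partial>P)"
  proof (rule nn_integral_liminf)
    show "F (Xs k) (Ls k) \<in> borel_measurable P" for k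
      unfolding F_def by measurable
  qed
  also have "\<dots> = liminf (\<lambda>k. discrete_energy \<tau> P (Xs k) (Ls k) N d)"
    by (simp add: discrete_energy_def F_def)
  finally show ?thesis .
qed

section \<open>Recovering the cost from discrete energies\<close>

lemma straddle_tendsto:
  fixes f :: "real \<Rightarrow> 'b::real_normed_vector"
  assumes f: "(f has_vector_derivative v) (at t)"
    and ab: "\<And>n. a n \<le> t" "\<And>n. t \<le> a n + 1 / real (Suc n)"
  shows "(\<lambda>n. real (Suc n) * norm (f (a n + 1 / real (Suc n)) - f (a n))) \<longlonglongrightarrow> norm v"
proof -
  define b where "b n = a n + 1 / real (Suc n)" for n
  have "(\<lambda>n. real (Suc n) *\<^sub>R (f (b n) - f (a n)) - v) \<longlonglongrightarrow> 0"
  proof (rule tendsto_norm_zero_cancel, rule LIMSEQ_I)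
    fix e :: real assume e: "e > 0"
    have alt: "\<forall>e>0. \<exists>d>0. \<forall>y. norm (y - t) < d \<longrightarrow> norm (f y - f t - (y - t) *\<^sub>R v) \<le> e * norm (y - t)"
      using f unfolding has_vector_derivative_def has_derivative_within_alt by auto
    then obtain d where d: "d > 0" "\<And>y. norm (y - t) < d \<Longrightarrow> norm (f y - f t - (y - t) *\<^sub>R v) \<le> (e / 2) * norm (y - t)"
      using e half_gt_zero by meson
    have "eventually (\<lambda>n. 1 / real (Suc n) < d) sequentially"
      using order_tendstoD(2)[OF tendsto_one_over_Suc d(1)] .
    then obtain n0 where n0: "\<And>n. n \<ge> n0 \<Longrightarrow> 1 / real (Suc n) < d" by (auto simp: eventually_sequentially)
    have half: "norm (real (Suc n) *\<^sub>R (f (b n) - f (a n)) - v) \<le> e / 2" if n: "n \<ge> n0" for n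
    proof -
      have ba: "b n - a n = 1 / real (Suc n)" "a n \<le> t" "t \<le> b n" using ab[of n] by (auto simp: b_def)
      have 1: "norm (f (b n) - f t - (b n - t) *\<^sub>R v) \<le> (e / 2) * (b n - t)"
        using d(2)[of "b n"] n0[OF n] ba by auto
      have 2: "norm (f (a n) - f t - (a n - t) *\<^sub>R v) \<le> (e / 2) * (t - a n)"
        using d(2)[of "a n"] n0[OF n] ba by auto
      \<comment> \<open>Neither end point need be \<open>t\<close>. The two linearization errors are
        at most \<open>e/2\<close> times the distances of the end points from \<open>t\<close>, and
        these distances add up to the length of the interval.\<close>
      have "f (b n) - f (a n) - (b n - a n) *\<^sub>R v = (f (b n) - f t - (b n - t) *\<^sub>R v) - (f (a n) - f t - (a n - t) *\<^sub>R v)"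
        by (simp add: algebra_simps)
      then have "norm (f (b n) - f (a n) - (b n - a n) *\<^sub>R v) \<le> (e / 2) * (b n - t) + (e / 2) * (t - a n)"
        using norm_triangle_ineq4[of "f (b n) - f t - (b n - t) *\<^sub>R v" "f (a n) - f t - (a n - t) *\<^sub>R v"] 1 2
        by (simp only:)
      also have "\<dots> = (e / 2) * (1 / real (Suc n))" unfolding distrib_left[symmetric] ba(1)[symmetric] by simp
      finally have 3: "norm (f (b n) - f (a n) - (1 / real (Suc n)) *\<^sub>R v) \<le> (e / 2) * (1 / real (Suc n))"
        unfolding ba(1) .
      have "real (Suc n) *\<^sub>R (f (b n) - f (a n)) - v = real (Suc n) *\<^sub>R (f (b n) - f (a n) - (1 / real (Suc n)) *\<^sub>R v)"
        by (simp add: scaleR_diff_right del: of_nat_Suc)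
      then have "norm (real (Suc n) *\<^sub>R (f (b n) - f (a n)) - v) = real (Suc n) * norm (f (b n) - f (a n) - (1 / real (Suc n)) *\<^sub>R v)"
        by (simp del: of_nat_Suc)
      also have "\<dots> \<le> real (Suc n) * ((e / 2) * (1 / real (Suc n)))" using 3 by (intro mult_left_mono) auto
      finally show ?thesis by (simp del: of_nat_Suc)
    qed
    then show "\<exists>n0. \<forall>n\<ge>n0. norm (norm (real (Suc n) *\<^sub>R (f (b n) - f (a n)) - v) - 0) < e"
    proof (intro exI[of _ n0] allI impI)
      fix n assume "n \<ge> n0"
      then have "norm (real (Suc n) *\<^sub>R (f (b n) - f (a n)) - v) \<le> e / 2" by (rule half)
      then show "norm (norm (real (Suc n) *\<^sub>R (f (b n) - f (a n)) - v) - 0) < e"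
        using e by (simp del: of_nat_Suc)
    qed
  qed
  then have "(\<lambda>n. real (Suc n) *\<^sub>R (f (b n) - f (a n))) \<longlonglongrightarrow> v" by (rule LIM_zero_cancel)
  then have "(\<lambda>n. norm (real (Suc n) *\<^sub>R (f (b n) - f (a n)))) \<longlonglongrightarrow> norm v" by (rule tendsto_norm)
  then show ?thesis by (simp add: b_def del: of_nat_Suc)
qed

context lipschitz_paths
begin

lemma abs_cont_X: "abs_cont_on_I (X p)"
  by (rule abs_cont_on_I_lipschitz[of _ "L p"]) (rule lipschitz)

text \<open>The distance to \<open>x\<close> attains its minimum on the compact unit interval, so a
  path that comes arbitrarily near \<open>x\<close> passes through it.\<close>

lemma Inter_tube: "(\<Inter>n. tube P X (1 / real (Suc n)) x) = {q \<in> space P. x \<in> X q ` {0..1}}"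
proof (intro equalityI subsetI)
  fix q assume q: "q \<in> (\<Inter>n. tube P X (1 / real (Suc n)) x)"
  then have sp: "q \<in> space P" by (auto simp: tube_def)
  have "continuous_on {0..1} (\<lambda>t. dist (X q t) x)" by (intro continuous_intros continuous_X)
  then obtain t where t: "t \<in> {0..1}" "\<And>s. s \<in> {0..1} \<Longrightarrow> dist (X q t) x \<le> dist (X q s) x"
    using continuous_attains_inf[of "{0..1::real}" "\<lambda>t. dist (X q t) x"] by auto
  have "dist (X q t) x \<le> 1 / real (Suc n)" for n
  proof -
    have "q \<in> tube P X (1 / real (Suc n)) x" using q by blast
    then obtain s where "s \<in> {0..1}" "dist (X q s) x \<le> 1 / real (Suc n)" unfolding tube_def by blast
    then show ?thesis using t(2) order_trans by blast
  qed
  then have "dist (X q t) x \<le> 0" by (intro LIMSEQ_le_const[OF tendsto_one_over_Suc]) blast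
  then have "x = X q t" by simp
  with sp t(1) show "q \<in> {q \<in> space P. x \<in> X q ` {0..1}}" by blast
next
  fix q assume "q \<in> {q \<in> space P. x \<in> X q ` {0..1}}"
  then obtain t where "q \<in> space P" "t \<in> {0..1}" "dist (X q t) x = 0" by auto
  then have "q \<in> tube P X (1 / real (Suc n)) x" for n
    unfolding tube_def by (auto intro!: bexI[of _ t])
  then show "q \<in> (\<Inter>n. tube P X (1 / real (Suc n)) x)" by blast
qed

text \<open>The tubes decrease to the set of paths through \<open>x\<close>, so their masses tend to
  the multiplicity. That set is already measurable for \<open>P\<close>, where the completion
  assigns the same mass.\<close>

lemma r_tau_m_chi_le_liminf:
  assumes \<tau>: "transportation_cost \<tau>" "concave_on {0..} \<tau>"
  shows "r_tau \<tau> (m_chi P X x) \<le> liminf (\<lambda>n. r_tau \<tau> (measure P (tube P X (1 / real (Suc n)) x)))"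
proof (rule r_tau_le_liminf[OF \<tau>])
  have "decseq (\<lambda>n. tube P X (1 / real (Suc n)) x)"
    unfolding decseq_Suc_iff
  proof (intro allI subsetI)
    fix n q assume "q \<in> tube P X (1 / real (Suc (Suc n))) x"
    moreover have "1 / real (Suc (Suc n)) \<le> 1 / real (Suc n)" by (intro divide_left_mono) auto
    ultimately show "q \<in> tube P X (1 / real (Suc n)) x" unfolding tube_def by (blast intro: order_trans)
  qed
  then have "(\<lambda>n. measure P (tube P X (1 / real (Suc n)) x)) \<longlonglongrightarrow> measure P (\<Inter>n. tube P X (1 / real (Suc n)) x)"
    by (intro finite_Lim_measure_decseq) auto
  moreover have "measure P (\<Inter>n. tube P X (1 / real (Suc n)) x) = m_chi P X x"
  proof -
    have "(\<Inter>n. tube P X (1 / real (Suc n)) x) \<in> sets P" by measurable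
    then show ?thesis unfolding m_chi_def Inter_tube by (simp add: measure_completion)
  qed
  ultimately have lim: "(\<lambda>n. measure P (tube P X (1 / real (Suc n)) x)) \<longlonglongrightarrow> m_chi P X x" by simp
  show "eventually (\<lambda>n. measure P (tube P X (1 / real (Suc n)) x) < m_chi P X x + e) sequentially" if "e > 0" for e
    by (rule order_tendstoD(2)[OF lim]) (use that in simp)
qed (auto simp: m_chi_def)

lemma measurable_X_I: "(\<lambda>z. X (fst z) (snd z)) \<in> borel_measurable (P \<Otimes>\<^sub>M I_measure)"
  using measurable_compose[OF measurable_restrict_I measurable_joint] by simp

lemma measurable_right_derivative_I:
  "(\<lambda>z. right_derivative (X (fst z)) (snd z)) \<in> borel_measurable (P \<Otimes>\<^sub>M I_measure)"
  using measurable_compose[OF measurable_restrict_I measurable_right_derivative[OF measurable_joint]] by simp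

lemma AE_derivative:
  "AE z in P \<Otimes>\<^sub>M I_measure.
     0 < snd z \<and> snd z < 1 \<and> (X (fst z) has_vector_derivative right_derivative (X (fst z)) (snd z)) (at (snd z))"
proof (rule AE_pair_has_vector_derivative[OF _ measurable_joint continuous_X])
  show "sigma_finite_measure P" ..
qed (intro AE_I2 abs_cont_AE_has_vector_derivative abs_cont_X)

text \<open>At fixed radius the discrete energies are integrals of step functions in time. Almost
  everywhere their lower limit dominates the integrand: increments over the grid interval around
  \<open>t\<close> approximate the speed, and tube masses are upper semicontinuous in the centre.
  Fatou's lemma concludes.\<close>

lemma nn_integral_tube_le:
  assumes \<tau>: "transportation_cost \<tau>" "concave_on {0..} \<tau>"
    and C: "\<And>N. discrete_energy \<tau> P X L (Suc N) d \<le> C" and d: "d > 0"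
  shows "(\<integral>\<^sup>+z. r_tau \<tau> (measure P (tube P X d (X (fst z) (snd z)))) *
      ennreal (norm (right_derivative (X (fst z)) (snd z))) \<partial>(P \<Otimes>\<^sub>M I_measure)) \<le> C"
proof -
  interpret I: sigma_finite_measure I_measure by (rule sigma_finite_I_measure)
  interpret pair_sigma_finite P I_measure ..
  note borel_measurable_r_tau[OF \<tau>(1), measurable]
  \<comment> \<open>The factor \<open>real (Suc N)\<close> cancels the length of a grid interval, so
    integrating over time returns the summand of the discrete energy.\<close>
  define c where "c N i p = r_tau \<tau> (measure P (tube P X d (X p (real i / real (Suc N))))) *
        ennreal (real (Suc N) * norm (X p (real (Suc i) / real (Suc N)) - X p (real i / real (Suc N))))" for N i p
  define A where "A N i = {real i / real (Suc N)..<real (Suc i) / real (Suc N)}" for N i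
  define s where "s N z = (if L (fst z) < d * real (Suc N) then
      (\<Sum>i<Suc N. c N i (fst z) * indicator (A N i) (snd z)) else 0)" for N z
  have A_sub: "A N i \<subseteq> {0..1}" if "i < Suc N" for N i
  proof
    fix x assume "x \<in> A N i"
    moreover have "real (Suc i) / real (Suc N) \<le> 1" using that by (simp add: divide_le_eq)
    moreover have "0 \<le> real i / real (Suc N)" by simp
    ultimately show "x \<in> {0..1}" unfolding A_def atLeastLessThan_iff atLeastAtMost_iff by linarith
  qed
  have [measurable]: "c N i \<in> borel_measurable P" for N i unfolding c_def by measurable
  have [measurable]: "A N i \<in> sets borel" for N i unfolding A_def by measurable
  have "(\<lambda>z. indicator (A N i) (snd z) :: ennreal) \<in> borel_measurable (P \<Otimes>\<^sub>M I_measure)" for N i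
    using measurable_compose[OF measurable_snd_I, of "indicator (A N i)"] by simp
  then have [measurable]: "s N \<in> borel_measurable (P \<Otimes>\<^sub>M I_measure)" for N unfolding s_def by measurable
  have int_s: "(\<integral>\<^sup>+z. s N z \<partial>(P \<Otimes>\<^sub>M I_measure)) = discrete_energy \<tau> P X L (Suc N) d" for N
  proof -
    have emA: "emeasure I_measure (A N i) = ennreal (1 / real (Suc N))" if "i < Suc N" for i
    proof -
      have sub: "A N i \<subseteq> {0..1}"
        using that by (rule A_sub)
      then have "emeasure I_measure (A N i) = emeasure lborel (A N i)"
        by (subst emeasure_restrict_space) auto
      also have "\<dots> = ennreal (real (Suc i) / real (Suc N) - real i / real (Suc N))"
        unfolding A_def by (rule emeasure_lborel_Ico) (simp add: divide_right_mono)
      also have "real (Suc i) / real (Suc N) - real i / real (Suc N) = 1 / real (Suc N)"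
        by (simp add: diff_divide_distrib[symmetric])
      finally show ?thesis .
    qed
    have AI: "A N i \<in> sets I_measure" if "i < Suc N" for i
    proof -
      have "A N i \<subseteq> {0..1}"
        using that by (rule A_sub)
      then show ?thesis by (subst sets_restrict_space_iff) auto
    qed
    have inner: "(\<integral>\<^sup>+t. s N (p, t) \<partial>I_measure) = (if L p < d * real (Suc N) then
      (\<Sum>i<Suc N. r_tau \<tau> (measure P (tube P X d (X p (real i / real (Suc N))))) *
        ennreal (norm (X p (real (Suc i) / real (Suc N)) - X p (real i / real (Suc N))))) else 0)" for p
    proof (cases "L p < d * real (Suc N)")
      case True
      have "(\<integral>\<^sup>+t. s N (p, t) \<partial>I_measure) = (\<integral>\<^sup>+t. (\<Sum>i<Suc N. c N i p * indicator (A N i) t) \<partial>I_measure)"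
        using True by (simp add: s_def)
      also have "\<dots> = (\<Sum>i<Suc N. c N i p * emeasure I_measure (A N i))"
        using AI by (subst nn_integral_sum) (auto simp: nn_integral_cmult_indicator)
      also have "\<dots> = (\<Sum>i<Suc N. r_tau \<tau> (measure P (tube P X d (X p (real i / real (Suc N))))) *
        ennreal (norm (X p (real (Suc i) / real (Suc N)) - X p (real i / real (Suc N)))))"
      proof (rule sum.cong[OF refl])
        fix i assume "i \<in> {..<Suc N}"
        then have "c N i p * emeasure I_measure (A N i) = c N i p * ennreal (1 / real (Suc N))" using emA by simp
        also have "\<dots> = r_tau \<tau> (measure P (tube P X d (X p (real i / real (Suc N))))) *
          (ennreal (real (Suc N) * norm (X p (real (Suc i) / real (Suc N)) - X p (real i / real (Suc N)))) * ennreal (1 / real (Suc N)))"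
          by (simp add: c_def mult.assoc)
        also have "ennreal (real (Suc N) * norm (X p (real (Suc i) / real (Suc N)) - X p (real i / real (Suc N)))) * ennreal (1 / real (Suc N)) =
           ennreal (norm (X p (real (Suc i) / real (Suc N)) - X p (real i / real (Suc N))))"
          by (subst ennreal_mult[symmetric]) auto
        finally show "c N i p * emeasure I_measure (A N i) = r_tau \<tau> (measure P (tube P X d (X p (real i / real (Suc N))))) *
           ennreal (norm (X p (real (Suc i) / real (Suc N)) - X p (real i / real (Suc N))))" .
      qed
      finally show ?thesis using True by simp
    qed (simp add: s_def)
    have "(\<integral>\<^sup>+z. s N z \<partial>(P \<Otimes>\<^sub>M I_measure)) = (\<integral>\<^sup>+p. \<integral>\<^sup>+t. s N (p, t) \<partial>I_measure \<partial>P)"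
      by (rule I.nn_integral_fst[symmetric]) measurable
    then show ?thesis unfolding inner discrete_energy_def .
  qed
  have "(\<integral>\<^sup>+z. r_tau \<tau> (measure P (tube P X d (X (fst z) (snd z)))) *
      ennreal (norm (right_derivative (X (fst z)) (snd z))) \<partial>(P \<Otimes>\<^sub>M I_measure))
    \<le> (\<integral>\<^sup>+z. liminf (\<lambda>N. s N z) \<partial>(P \<Otimes>\<^sub>M I_measure))"
  proof (rule nn_integral_mono_AE)
    show "AE z in P \<Otimes>\<^sub>M I_measure. r_tau \<tau> (measure P (tube P X d (X (fst z) (snd z)))) *
      ennreal (norm (right_derivative (X (fst z)) (snd z))) \<le> liminf (\<lambda>N. s N z)"
      using AE_derivative
    proof eventually_elim
      case (elim z)
      obtain p t where z: "z = (p, t)" by (cases z)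
      have t: "0 < t" "t < 1" and der: "(X p has_vector_derivative right_derivative (X p) t) (at t)"
        using elim by (auto simp: z)
      \<comment> \<open>Index of the grid interval that contains \<open>t\<close>.\<close>
      define i where "i N = nat \<lfloor>real (Suc N) * t\<rfloor>" for N
      define a where "a N = real (i N) / real (Suc N)" for N
      have i1: "real (i N) \<le> real (Suc N) * t" "real (Suc N) * t < real (i N) + 1" for N
        unfolding i_def using t by (simp_all add: of_nat_nat)
      have iN: "i N < Suc N" for N
      proof -
        have "real (i N) \<le> real (Suc N) * t" by (rule i1)
        also have "\<dots> < real (Suc N)" using t by simp
        finally show ?thesis by simp
      qed
      have aN: "a N \<le> t" "t < real (Suc (i N)) / real (Suc N)" for N
        using i1[of N] by (auto simp: a_def field_simps simp del: of_nat_Suc)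
      have aS: "real (Suc (i N)) / real (Suc N) = a N + 1 / real (Suc N)" for N
        by (simp add: a_def add_divide_distrib)
      have alim: "a \<longlonglongrightarrow> t"
      proof (rule tendsto_sandwich)
        show "(\<lambda>N. t - 1 / real (Suc N)) \<longlonglongrightarrow> t"
          using tendsto_diff[OF tendsto_const tendsto_one_over_Suc, of t] by simp
        show "\<forall>\<^sub>F N in sequentially. t - 1 / real (Suc N) \<le> a N"
        proof (intro always_eventually allI)
          fix N show "t - 1 / real (Suc N) \<le> a N" using aN(2)[of N] unfolding aS by linarith
        qed
      qed (use aN in auto)
      define f where "f N = r_tau \<tau> (measure P (tube P X d (X p (a N))))" for N
      define g where "g N = ennreal (real (Suc N) * norm (X p (a N + 1 / real (Suc N)) - X p (a N)))" for N
      have "r_tau \<tau> (measure P (tube P X d (X p t))) \<le> liminf f"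
        unfolding f_def
      proof (rule r_tau_le_liminf[OF \<tau>])
        fix e :: real assume e: "e > 0"
        have "lipschitz_paths P X L" ..
        \<comment> \<open>The constant sequence of patterns reduces the semicontinuity of tube
          masses to the moving centre alone.\<close>
        moreover have "paths_converge P (\<lambda>_. X) (\<lambda>_. L) X L" by (simp add: paths_converge_def)
        ultimately show "\<forall>\<^sub>F k in sequentially. measure P (tube P X d (X p (a k))) < measure P (tube P X d (X p t)) + e"
          using tendsto_X[OF alim] e by (intro tube_measure_upper_semicontinuous[of P "\<lambda>_. X"])
      qed auto
      moreover have "g \<longlonglongrightarrow> ennreal (norm (right_derivative (X p) t))"
        unfolding g_def
        by (intro tendsto_ennrealI straddle_tendsto[OF der])
           (use aN[unfolded aS] in \<open>auto intro: less_imp_le simp del: of_nat_Suc\<close>)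
      ultimately have "r_tau \<tau> (measure P (tube P X d (X p t))) * ennreal (norm (right_derivative (X p) t)) \<le> liminf (\<lambda>N. f N * g N)"
        by (rule mult_le_liminf_ennreal)
      also have "\<dots> \<le> liminf (\<lambda>N. s N z)"
      proof (rule Liminf_mono)
        \<comment> \<open>For fixed \<open>d > 0\<close> every finite length eventually satisfies
          the cutoff.\<close>
        obtain N0 where N0: "L p / d < real N0" using reals_Archimedean2 by blast
        show "eventually (\<lambda>N. f N * g N \<le> s N z) sequentially"
          using eventually_ge_at_top[of N0]
        proof eventually_elim
          case (elim N)
          have "L p / d < real (Suc N)" using N0 elim by simp
          then have LN: "L p < d * real (Suc N)" using d by (simp add: field_simps)
          have "t \<in> A N (i N)" using aN[of N] by (simp add: A_def a_def)
          then have "f N * g N = c N (i N) p * indicator (A N (i N)) t"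
            unfolding f_def g_def c_def aS by (simp add: a_def)
          also have "\<dots> \<le> (\<Sum>i<Suc N. c N i p * indicator (A N i) t)"
            by (rule member_le_sum) (use iN in auto)
          finally show ?case using LN by (simp add: s_def z)
        qed
      qed
      finally show ?case by (simp add: z)
    qed
  qed
  also have "\<dots> \<le> liminf (\<lambda>N. \<integral>\<^sup>+z. s N z \<partial>(P \<Otimes>\<^sub>M I_measure))"
    by (rule nn_integral_liminf) measurable
  also have "\<dots> \<le> limsup (\<lambda>N. \<integral>\<^sup>+z. s N z \<partial>(P \<Otimes>\<^sub>M I_measure))" by (rule Liminf_le_Limsup) simp
  also have "\<dots> \<le> C" by (rule Limsup_bounded) (simp add: int_s C)
  finally show ?thesis .
qed

text \<open>The bound at each radius is uniform, so the radii \<open>1 / real (Suc n)\<close> may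
  tend to 0 under one more application of Fatou's lemma.\<close>

theorem J_tau_le_discrete_energy:
  assumes \<tau>: "transportation_cost \<tau>" "concave_on {0..} \<tau>"
    and C: "\<And>N d. d > 0 \<Longrightarrow> discrete_energy \<tau> P X L (Suc N) d \<le> C"
  shows "J_tau \<tau> P X \<le> C"
proof -
  note borel_measurable_r_tau[OF \<tau>(1), measurable] measurable_X_I[measurable] measurable_right_derivative_I[measurable]
  define f where "f n z = r_tau \<tau> (measure P (tube P X (1 / real (Suc n)) (X (fst z) (snd z)))) *
      ennreal (norm (right_derivative (X (fst z)) (snd z)))" for n z
  have [measurable]: "f n \<in> borel_measurable (P \<Otimes>\<^sub>M I_measure)" for n unfolding f_def by measurable
  have "J_tau \<tau> P X \<le> (\<integral>\<^sup>+z. liminf (\<lambda>n. f n z) \<partial>(P \<Otimes>\<^sub>M I_measure))"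
    unfolding J_tau_def
  proof (rule nn_integral_mono_AE)
    show "AE z in P \<Otimes>\<^sub>M I_measure. (case z of (p, t) \<Rightarrow> r_tau \<tau> (m_chi P X (X p t)) *
        ennreal (norm (vector_derivative (X p) (at t)))) \<le> liminf (\<lambda>n. f n z)"
      using AE_derivative
    proof eventually_elim
      case (elim z)
      obtain p t where z: "z = (p, t)" by (cases z)
      have "(X p has_vector_derivative right_derivative (X p) t) (at t)" using elim by (auto simp: z)
      then have "vector_derivative (X p) (at t) = right_derivative (X p) t" by (rule vector_derivative_at)
      then show ?case
        unfolding z f_def using mult_le_liminf_ennreal[OF r_tau_m_chi_le_liminf[OF \<tau>, of "X p t"] tendsto_const]
        by simp
    qed
  qed
  also have "\<dots> \<le> liminf (\<lambda>n. \<integral>\<^sup>+z. f n z \<partial>(P \<Otimes>\<^sub>M I_measure))"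
    by (rule nn_integral_liminf) measurable
  also have "\<dots> \<le> limsup (\<lambda>n. \<integral>\<^sup>+z. f n z \<partial>(P \<Otimes>\<^sub>M I_measure))" by (rule Liminf_le_Limsup) simp
  also have "\<dots> \<le> C"
    unfolding f_def by (rule Limsup_bounded, intro always_eventually allI nn_integral_tube_le[OF \<tau>] C) auto
  finally show ?thesis .
qed

end

section \<open>Reparametrization by arc length\<close>

lemma abs_cont_on_I_cong:
  assumes "\<And>t. 0 \<le> t \<Longrightarrow> t \<le> 1 \<Longrightarrow> f t = g t" "abs_cont_on_I f"
  shows "abs_cont_on_I g"
  unfolding abs_cont_on_I_def
proof (intro allI impI)
  fix e :: real assume e: "e > 0"
  obtain d where d: "d > 0" "ac_modulus f e d" using assms(2) e unfolding abs_cont_on_I_iff_modulus by meson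
  show "\<exists>d>0. \<forall>(N::nat) a b.
        (\<forall>k<N. 0 \<le> a k \<and> a k \<le> b k \<and> b k \<le> 1) \<longrightarrow>
        (\<forall>k<N. \<forall>j<N. k \<noteq> j \<longrightarrow> {a k<..<b k} \<inter> {a j<..<b j} = {}) \<longrightarrow>
        (\<Sum>k<N. b k - a k) < d \<longrightarrow>
        (\<Sum>k<N. norm (g (b k) - g (a k))) < e"
  proof (intro exI[of _ d] conjI d(1) allI impI)
    fix N :: nat and a b :: "nat \<Rightarrow> real"
    assume ab: "\<forall>k<N. 0 \<le> a k \<and> a k \<le> b k \<and> b k \<le> 1"
      and disj: "\<forall>k<N. \<forall>j<N. k \<noteq> j \<longrightarrow> {a k<..<b k} \<inter> {a j<..<b j} = {}"
      and sum: "(\<Sum>k<N. b k - a k) < d"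
    have "(\<Sum>k<N. norm (g (b k) - g (a k))) = (\<Sum>k<N. norm (f (b k) - f (a k)))"
    proof (rule sum.cong[OF refl])
      fix k assume "k \<in> {..<N}"
      then have "0 \<le> a k" "a k \<le> b k" "b k \<le> 1" using ab by auto
      then show "norm (g (b k) - g (a k)) = norm (f (b k) - f (a k))" by (simp add: assms(1))
    qed
    also have "\<dots> < e" using d(2) ab disj sum unfolding ac_modulus_def by blast
    finally show "(\<Sum>k<N. norm (g (b k) - g (a k))) < e" .
  qed
qed

locale irrigation = finite_measure P for P :: "'g measure" +
  fixes chi :: "'g \<Rightarrow> real \<Rightarrow> 'b::euclidean_space" and B :: "'g set"
  assumes chi_measurable: "(\<lambda>(p, t). chi p t) \<in> borel_measurable (P \<Otimes>\<^sub>M I_measure)"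
    and B_null: "B \<in> null_sets P"
    and chi_abs_cont: "\<And>p. p \<in> space P \<Longrightarrow> p \<notin> B \<Longrightarrow> abs_cont_on_I (chi p)"
begin

lemma sets_B [measurable]: "B \<in> sets P" using B_null by auto

text \<open>Null paths are set to 0 and the others extended by their end values, so that every path
  is continuous on the line and absolutely continuous on the unit interval.\<close>

definition "Y p t = (if p \<in> space P - B then chi p (clamp01 t) else 0)"

lemma measurable_Y [measurable]: "(\<lambda>z. Y (fst z) (snd z)) \<in> borel_measurable (P \<Otimes>\<^sub>M borel)"
proof -
  have "clamp01 \<in> borel \<rightarrow>\<^sub>M I_measure" by (rule measurable_restrict_space2) auto
  then have "(\<lambda>z. (fst z, clamp01 (snd z))) \<in> P \<Otimes>\<^sub>M borel \<rightarrow>\<^sub>M P \<Otimes>\<^sub>M I_measure" by measurable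
  from measurable_compose[OF this chi_measurable]
  have [measurable]: "(\<lambda>z. chi (fst z) (clamp01 (snd z))) \<in> borel_measurable (P \<Otimes>\<^sub>M borel)" by simp
  show ?thesis unfolding Y_def by measurable
qed

lemma abs_cont_Y: "abs_cont_on_I (Y p)"
proof (cases "p \<in> space P - B")
  case True
  have "abs_cont_on_I (chi p)" using True chi_abs_cont by blast
  then show ?thesis by (rule abs_cont_on_I_cong[rotated]) (use True in \<open>simp add: Y_def\<close>)
next
  case False
  then show ?thesis by (intro abs_cont_on_I_lipschitz[of _ 0]) (auto simp: Y_def)
qed

lemma continuous_Y: "continuous_on UNIV (Y p)"
proof -
  have "continuous_on UNIV (\<lambda>t. Y p (clamp01 t))"
    by (rule continuous_on_compose2[OF abs_cont_on_I_imp_continuous[OF abs_cont_Y] continuous_on_clamp01]) auto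
  moreover have "(\<lambda>t. Y p (clamp01 t)) = Y p" by (auto simp: Y_def)
  ultimately show ?thesis by (simp only:)
qed

definition "speed p t = ennreal (norm (right_derivative (Y p) t))"

lemma measurable_speed [measurable]: "(\<lambda>z. speed (fst z) (snd z)) \<in> borel_measurable (P \<Otimes>\<^sub>M borel)"
  unfolding speed_def using measurable_right_derivative[OF measurable_Y] by measurable

lemma AE_derivative_Y: "AE t in lborel. 0 < t \<and> t < 1 \<longrightarrow> (Y p has_vector_derivative right_derivative (Y p) t) (at t)"
  using abs_cont_AE_has_vector_derivative[OF abs_cont_Y[of p]]
  by eventually_elim (auto simp: right_derivative_eq)

lemma norm_Y_diff_le:
  assumes "0 \<le> a" "a \<le> b" "b \<le> 1"
  shows "ennreal (norm (Y p b - Y p a)) \<le> (\<integral>\<^sup>+t. speed p t * indicator {a..<b} t \<partial>lborel)"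
  unfolding speed_def by (rule abs_cont_norm_diff_le[OF abs_cont_Y AE_derivative_Y assms])

text \<open>With half-open intervals the integrands over adjacent intervals add up at every single
  time.\<close>

definition "arclength p t = (\<integral>\<^sup>+s. speed p s * indicator {0..<t} s \<partial>lborel)"

lemma measurable_speed_section [measurable]: "p \<in> space P \<Longrightarrow> speed p \<in> borel_measurable borel"
  using measurable_compose[OF measurable_Pair1' measurable_speed, of p] by simp

lemma measurable_arc [measurable]: "(\<lambda>p. arclength p t) \<in> borel_measurable P"
proof -
  have "(\<lambda>z. speed (fst z) (snd z) * indicator {0..<t} (snd z)) \<in> borel_measurable (P \<Otimes>\<^sub>M lborel)"
  proof -
    have "sets (P \<Otimes>\<^sub>M lborel) = sets (P \<Otimes>\<^sub>M (borel :: real measure))" by (rule sets_pair_measure_cong) auto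
    moreover have "(\<lambda>z. speed (fst z) (snd z) * indicator {0..<t} (snd z)) \<in> borel_measurable (P \<Otimes>\<^sub>M borel)" by measurable
    ultimately show ?thesis by (subst measurable_cong_sets) auto
  qed
  from lborel.borel_measurable_nn_integral_fst[OF this] show ?thesis unfolding arclength_def by simp
qed

text \<open>Finite length is known only almost surely and only for patterns of finite cost; the
  remaining paths get length 0 and are replaced by the zero path.\<close>

definition "good p \<longleftrightarrow> p \<in> space P \<and> p \<notin> B \<and> arclength p 1 < \<infinity>"

lemma pred_good [measurable]: "Measurable.pred P good"
  unfolding good_def by measurable

definition "len p t = (if good p then enn2real (arclength p (clamp01 t)) else 0)"

lemma measurable_len [measurable]: "(\<lambda>p. len p t) \<in> borel_measurable P"
  unfolding len_def by measurable

lemma arc_mono: "s \<le> t \<Longrightarrow> arclength p s \<le> arclength p t"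
  unfolding arclength_def by (intro nn_integral_mono mult_left_mono) (auto simp: indicator_def)

lemma arc_fin: assumes "good p" "t \<le> 1" shows "arclength p t < \<infinity>"
  using arc_mono[OF assms(2), of p] assms(1) by (auto simp: good_def intro: le_less_trans)

lemma ennreal_len: "good p \<Longrightarrow> 0 \<le> t \<Longrightarrow> t \<le> 1 \<Longrightarrow> ennreal (len p t) = arclength p t"
  using arc_fin[of p t] by (simp add: len_def)

lemma len_nonneg: "0 \<le> len p t" by (simp add: len_def)

lemma len_mono: "s \<le> t \<Longrightarrow> len p s \<le> len p t"
  using arc_mono[OF clamp01_mono, of s t p] arc_fin[of p "clamp01 t"]
  by (auto simp: len_def intro!: enn2real_mono)

lemma len_0: "len p 0 = 0" by (simp add: len_def arclength_def)

lemma arc_split: assumes "good p" "0 \<le> a" "a \<le> b" "b \<le> 1"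
  shows "(\<integral>\<^sup>+t. speed p t * indicator {a..<b} t \<partial>lborel) = ennreal (len p b - len p a)"
proof -
  have [measurable]: "speed p \<in> borel_measurable borel" using assms(1) by (auto simp: good_def)
  have "arclength p b = (\<integral>\<^sup>+t. speed p t * indicator {0..<a} t + speed p t * indicator {a..<b} t \<partial>lborel)"
    unfolding arclength_def by (intro nn_integral_cong) (use assms in \<open>auto simp: indicator_def\<close>)
  also have "\<dots> = arclength p a + (\<integral>\<^sup>+t. speed p t * indicator {a..<b} t \<partial>lborel)"
    unfolding arclength_def by (subst nn_integral_add) auto
  finally have *: "ennreal (len p b) = ennreal (len p a) + (\<integral>\<^sup>+t. speed p t * indicator {a..<b} t \<partial>lborel)"
    using assms by (simp add: ennreal_len)
  have "ennreal (len p b - len p a) = ennreal (len p b) - ennreal (len p a)"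
    by (simp add: ennreal_minus len_nonneg)
  also have "\<dots> = (\<integral>\<^sup>+t. speed p t * indicator {a..<b} t \<partial>lborel)"
    unfolding * by (simp add: ennreal_add_diff_cancel_left)
  finally show ?thesis by simp
qed

lemma norm_Y_diff_le_len: assumes "good p" "0 \<le> a" "a \<le> b" "b \<le> 1"
  shows "norm (Y p b - Y p a) \<le> len p b - len p a"
proof -
  have "ennreal (norm (Y p b - Y p a)) \<le> ennreal (len p b - len p a)"
    using norm_Y_diff_le[OF assms(2-4), of p] arc_split[OF assms] by simp
  then show ?thesis using len_mono[OF assms(3), of p] by (simp add: ennreal_le_iff)
qed

lemma continuous_len: "continuous_on {0..1} (len p)"
proof (cases "good p")
  case True
  have [measurable]: "speed p \<in> borel_measurable borel" using True by (auto simp: good_def)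
  define f where "f s = enn2real (speed p s)" for s
  have [measurable]: "f \<in> borel_measurable borel" unfolding f_def by measurable
  have sf: "speed p s = ennreal (f s)" for s by (simp add: f_def speed_def)
  have f0: "0 \<le> f s" for s by (simp add: f_def)
  have int: "set_integrable lborel {0..1} f"
    unfolding set_integrable_def
  proof (rule integrableI_nonneg)
    have "(\<integral>\<^sup>+s. ennreal (indicator {0..1} s *\<^sub>R f s) \<partial>lborel) = arclength p 1"
      unfolding arclength_def
    proof (rule nn_integral_cong_AE)
      show "AE s in lborel. ennreal (indicator {0..1} s *\<^sub>R f s) = speed p s * indicator {0..<1} s"
        using AE_lborel_singleton[of 1] by eventually_elim (auto simp: sf indicator_def)
    qed
    then show "(\<integral>\<^sup>+s. ennreal (indicator {0..1} s *\<^sub>R f s) \<partial>lborel) < \<infinity>" using True by (simp add: good_def)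
  qed (auto simp: f0)
  have "f integrable_on {0..1}" using set_borel_integral_eq_integral(1)[OF int] .
  then have "continuous_on {0..1} (\<lambda>t. integral {0..t} f)" by (rule indefinite_integral_continuous_1)
  moreover have "integral {0..t} f = len p t" if t: "t \<in> {0..1}" for t
  proof -
    have int_t: "set_integrable lborel {0..t} f" by (rule set_integrable_subset[OF int]) (use t in auto)
    have "ennreal (LINT s:{0..t}|lborel. f s) = (\<integral>\<^sup>+s. ennreal (indicator {0..t} s *\<^sub>R f s) \<partial>lborel)"
      unfolding set_lebesgue_integral_def using int_t
      by (intro nn_integral_eq_integral[symmetric]) (auto simp: set_integrable_def f0)
    also have "\<dots> = arclength p t" unfolding arclength_def
    proof (rule nn_integral_cong_AE)
      show "AE s in lborel. ennreal (indicator {0..t} s *\<^sub>R f s) = speed p s * indicator {0..<t} s"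
        using AE_lborel_singleton[of t] by eventually_elim (auto simp: sf indicator_def)
    qed
    also have "\<dots> = ennreal (len p t)" using ennreal_len[OF True] t by simp
    finally have "(LINT s:{0..t}|lborel. f s) = len p t"
      by (subst (asm) ennreal_inj) (auto simp: len_nonneg set_lebesgue_integral_def f0 intro!: integral_nonneg_AE)
    then show ?thesis using set_borel_integral_eq_integral(2)[OF int_t] by simp
  qed
  ultimately show ?thesis by (metis (no_types, lifting) continuous_on_cong)
qed (simp add: len_def)

text \<open>The first time at which the fraction \<open>s\<close> of the total length has been
  covered. The infimum settles the choice when the path rests, and it also makes sense for a path of
  length 0.\<close>

definition "arrival p s = Inf {t \<in> {0..1}. s * len p 1 \<le> len p t}"

text \<open>Continuity of the length makes the set in the infimum closed, so the infimum is
  attained; the intermediate value theorem makes its length exact. The equivalence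
  \<open>arrival_le_iff\<close> reduces measurability of arrival times to that of lengths at fixed
  times.\<close>

lemma arrival:
  assumes s: "0 \<le> s" "s \<le> 1"
  shows "0 \<le> arrival p s" "arrival p s \<le> 1" "len p (arrival p s) = s * len p 1"
    and arrival_le_iff: "\<And>t. 0 \<le> t \<Longrightarrow> t \<le> 1 \<Longrightarrow> arrival p s \<le> t \<longleftrightarrow> s * len p 1 \<le> len p t"
proof -
  define S where "S = {t \<in> {0..1}. s * len p 1 \<le> len p t}"
  have sL: "s * len p 1 \<le> len p 1" using s len_nonneg[of p 1] by (simp add: mult_left_le_one_le)
  have ne: "S \<noteq> {}" using sL by (auto simp: S_def intro!: exI[of _ 1])
  have "closed S"
  proof -
    have "S = {0..1} \<inter> (len p -` {s * len p 1..})" by (auto simp: S_def)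
    moreover have "closed ({0..1} \<inter> (len p -` {s * len p 1..}))"
      by (rule continuous_closed_preimage[OF continuous_len]) auto
    ultimately show ?thesis by simp
  qed
  moreover have bdd: "bdd_below S" by (auto simp: S_def intro!: bdd_belowI[of _ 0])
  ultimately have inS: "arrival p s \<in> S"
    unfolding arrival_def S_def[symmetric] using ne by (intro closed_contains_Inf)
  then show 1: "0 \<le> arrival p s" "arrival p s \<le> 1" by (auto simp: S_def)
  show iff: "arrival p s \<le> t \<longleftrightarrow> s * len p 1 \<le> len p t" if "0 \<le> t" "t \<le> 1" for t
  proof
    assume "arrival p s \<le> t"
    then have "len p (arrival p s) \<le> len p t" by (rule len_mono)
    then show "s * len p 1 \<le> len p t" using inS by (auto simp: S_def)
  next
    assume "s * len p 1 \<le> len p t"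
    then have "t \<in> S" using that by (auto simp: S_def)
    then show "arrival p s \<le> t" unfolding arrival_def S_def[symmetric] using bdd by (rule cInf_lower)
  qed
  have "\<exists>t\<ge>0. t \<le> 1 \<and> len p t = s * len p 1"
    by (rule IVT') (use continuous_len sL len_0 s len_nonneg in auto)
  then obtain t where t: "0 \<le> t" "t \<le> 1" "len p t = s * len p 1" by blast
  then have "arrival p s \<le> t" using iff by simp
  then have "len p (arrival p s) \<le> s * len p 1" using len_mono t by metis
  then show "len p (arrival p s) = s * len p 1" using inS by (auto simp: S_def)
qed

lemma arrival_mono: "0 \<le> s \<Longrightarrow> s \<le> s' \<Longrightarrow> s' \<le> 1 \<Longrightarrow> arrival p s \<le> arrival p s'"
  using arrival(1-3)[of s' p] len_nonneg[of p 1] by (subst arrival_le_iff) (auto intro: mult_right_mono)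

lemma measurable_arrival [measurable]:
  assumes s: "0 \<le> s" "s \<le> 1"
  shows "(\<lambda>p. arrival p s) \<in> borel_measurable P"
proof (rule borel_measurableI_le)
  fix t :: real
  consider "t < 0" | "1 < t" | "0 \<le> t" "t \<le> 1" by linarith
  then show "{p \<in> space P. arrival p s \<le> t} \<in> sets P"
  proof cases
    case 1
    have "\<not> arrival p s \<le> t" for p using arrival(1)[OF s, of p] 1 by linarith
    then show ?thesis by simp
  next
    case 2
    have "arrival p s \<le> t" for p using arrival(2)[OF s, of p] 2 by linarith
    then show ?thesis by simp
  next
    case 3
    show ?thesis unfolding arrival_le_iff[OF s 3] by measurable
  qed
qed

definition "X p s = (if good p then Y p (arrival p (clamp01 s)) else 0)"

text \<open>Increments of the path are at most increments of length, and along arrival times the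
  length is linear in the parameter.\<close>

lemma lipschitz_X: "lipschitz_paths P X (\<lambda>p. len p 1)"
proof
  show "(\<lambda>p. X p t) \<in> borel_measurable P" for t
  proof -
    have "(\<lambda>p. (p, arrival p (clamp01 t))) \<in> P \<rightarrow>\<^sub>M P \<Otimes>\<^sub>M borel"
      using measurable_arrival[of "clamp01 t"] by simp
    from measurable_compose[OF this measurable_Y]
    have [measurable]: "(\<lambda>p. Y p (arrival p (clamp01 t))) \<in> borel_measurable P" by simp
    show ?thesis unfolding X_def by measurable
  qed
  show "norm (X p s - X p t) \<le> len p 1 * \<bar>s - t\<bar>" for p s t
  proof (cases "good p")
    case True
    have *: "norm (X p b - X p a) \<le> len p 1 * (b - a)" if "a \<le> b" for a b
    proof -
      have "norm (X p b - X p a) \<le> len p (arrival p (clamp01 b)) - len p (arrival p (clamp01 a))"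
        using True by (auto simp: X_def intro!: norm_Y_diff_le_len arrival arrival_mono clamp01_mono that)
      also have "\<dots> = len p 1 * (clamp01 b - clamp01 a)" by (simp add: arrival algebra_simps)
      also have "\<dots> \<le> len p 1 * (b - a)"
        using that len_nonneg by (intro mult_left_mono) (auto simp: clamp01_def)
      finally show ?thesis .
    qed
    show ?thesis
    proof (cases "s \<le> t")
      case True then show ?thesis using *[of s t] by (simp add: norm_minus_commute)
    next
      case False then show ?thesis using *[of t s] by simp
    qed
  qed (simp add: X_def len_def)
qed (auto simp: len_nonneg)

lemma Y_eq_if_len_eq:
  assumes "good p" "s \<in> {0..1}" "t \<in> {0..1}" "len p s = len p t"
  shows "Y p s = Y p t"
proof (cases "s \<le> t")
  case True
  then show ?thesis using norm_Y_diff_le_len[of p s t] assms by simp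
next
  case False
  then show ?thesis using norm_Y_diff_le_len[of p t s] assms by simp
qed

lemma Y_good: "good p \<Longrightarrow> 0 \<le> t \<Longrightarrow> t \<le> 1 \<Longrightarrow> Y p t = chi p t"
  by (auto simp: Y_def good_def)

text \<open>The arrival time at fraction 1 may precede time 1 if the path ends with a rest; equal
  lengths still force equal positions.\<close>

lemma X_endpoints: assumes "good p" shows "X p 0 = chi p 0" "X p 1 = chi p 1"
proof -
  have "X p 0 = Y p 0"
    using assms arrival(1-3)[of 0 p] by (auto simp: X_def len_0 intro!: Y_eq_if_len_eq)
  then show "X p 0 = chi p 0" using Y_good[OF assms, of 0] by simp
  have "X p 1 = Y p 1"
    using assms arrival(1-3)[of 1 p] by (auto simp: X_def intro!: Y_eq_if_len_eq)
  then show "X p 1 = chi p 1" using Y_good[OF assms, of 1] by simp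
qed

text \<open>No visited point is lost: each position depends only on the length covered so far. This
  keeps the tube masses of the new paths above the old multiplicities.\<close>

lemma chi_image_subset: assumes "good p" shows "chi p ` {0..1} \<subseteq> X p ` {0..1}"
proof
  fix y assume "y \<in> chi p ` {0..1}"
  then obtain t where t: "t \<in> {0..1}" "y = Y p t" using Y_good[OF assms] by force
  \<comment> \<open>For a path of length 0 the quotient is 0 by convention, and
    \<open>s * len p 1 = len p t\<close> still holds.\<close>
  define s where "s = len p t / len p 1"
  have tl: "len p t \<le> len p 1" "0 \<le> len p t" using t len_mono[of t 1 p] len_nonneg by auto
  then have s: "0 \<le> s" "s \<le> 1" "s * len p 1 = len p t"
    unfolding s_def by (auto simp: divide_le_eq_1)
  have "X p s = Y p t"
    using assms s t arrival(1-3)[OF s(1,2), of p] by (auto simp: X_def intro!: Y_eq_if_len_eq)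
  then show "y \<in> X p ` {0..1}" using t s by force
qed

end

section \<open>Mean length and discrete energies are bounded by the cost\<close>

context irrigation
begin

lemma m_chi_le: "m_chi P chi y \<le> measure P (space P)"
proof -
  interpret C: finite_measure "completion P"
    by (rule finite_measureI) (simp add: emeasure_completion)
  have "measure (completion P) {q \<in> space P. y \<in> chi q ` {0..1}} \<le> measure (completion P) (space (completion P))"
    by (rule C.bounded_measure)
  then show ?thesis by (simp add: m_chi_def measure_completion)
qed

lemma m_chi_nonneg: "0 \<le> m_chi P chi y"
  by (simp add: m_chi_def)

lemma measurable_speed_I [measurable]: "(\<lambda>z. speed (fst z) (snd z)) \<in> borel_measurable (P \<Otimes>\<^sub>M I_measure)"
  using measurable_compose[OF measurable_restrict_I measurable_speed] by simp

text \<open>Links the derivative of the raw pattern, as it occurs in \<open>J_tau\<close>, to the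
  measurable speed of the cleaned paths.\<close>

lemma AE_chi_derivative:
  "AE z in P \<Otimes>\<^sub>M I_measure. fst z \<in> space P \<and> fst z \<notin> B \<and> 0 < snd z \<and> snd z < 1 \<and>
      ennreal (norm (vector_derivative (chi (fst z)) (at (snd z)))) = speed (fst z) (snd z)"
proof -
  have P: "sigma_finite_measure P" ..
  interpret pair_sigma_finite P I_measure
    using P sigma_finite_I_measure by (simp add: pair_sigma_finite_def)
  have "AE z in P \<Otimes>\<^sub>M I_measure. fst z \<notin> B"
  proof (rule AE_pair_measure)
    show "AE p in P. AE t in I_measure. fst (p, t) \<notin> B"
      using AE_not_in[OF B_null] by eventually_elim simp
  qed measurable
  moreover have "AE z in P \<Otimes>\<^sub>M I_measure. 0 < snd z \<and> snd z < 1 \<and>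
      (Y (fst z) has_vector_derivative right_derivative (Y (fst z)) (snd z)) (at (snd z))"
    by (rule AE_pair_has_vector_derivative[OF P measurable_Y continuous_Y])
       (intro AE_I2 abs_cont_AE_has_vector_derivative abs_cont_Y)
  moreover have "AE z in P \<Otimes>\<^sub>M I_measure. z \<in> space (P \<Otimes>\<^sub>M I_measure)" by simp
  ultimately show ?thesis
  proof eventually_elim
    case (elim z)
    have sp: "fst z \<in> space P" using elim by (auto simp: space_pair_measure)
    have "(chi (fst z) has_vector_derivative right_derivative (Y (fst z)) (snd z)) (at (snd z))"
      by (rule has_vector_derivative_transform_within_open[where f="Y (fst z)" and S="{0<..<1}"])
         (use elim sp in \<open>auto simp: Y_def\<close>)
    then have "vector_derivative (chi (fst z)) (at (snd z)) = right_derivative (Y (fst z)) (snd z)"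
      by (rule vector_derivative_at)
    then show ?case using elim sp by (simp add: speed_def)
  qed
qed

lemma nn_integral_I_speed:
  assumes "p \<in> space P" "0 \<le> a" "b \<le> 1"
  shows "(\<integral>\<^sup>+t. speed p t * indicator {a..<b} t \<partial>I_measure) = (\<integral>\<^sup>+t. speed p t * indicator {a..<b} t \<partial>lborel)"
  by (subst nn_integral_restrict_space) (use assms in \<open>auto simp: indicator_def intro!: nn_integral_cong\<close>)

text \<open>No measurability of the multiplicity along the paths is established; Fubini is applied
  to a measurable minorant \<open>g\<close>, and monotonicity of the integral does the rest.\<close>

lemma J_tau_ge_speed:
  assumes g: "g \<in> borel_measurable (P \<Otimes>\<^sub>M I_measure)"
    and le: "\<And>p t. p \<in> space P \<Longrightarrow> p \<notin> B \<Longrightarrow> 0 < t \<Longrightarrow> t < 1 \<Longrightarrow>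
        g (p, t) \<le> r_tau \<tau> (m_chi P chi (chi p t)) * speed p t"
  shows "(\<integral>\<^sup>+p. \<integral>\<^sup>+t. g (p, t) \<partial>I_measure \<partial>P) \<le> J_tau \<tau> P chi"
proof -
  interpret I: sigma_finite_measure I_measure by (rule sigma_finite_I_measure)
  have "(\<integral>\<^sup>+p. \<integral>\<^sup>+t. g (p, t) \<partial>I_measure \<partial>P) = (\<integral>\<^sup>+z. g z \<partial>(P \<Otimes>\<^sub>M I_measure))"
    by (rule I.nn_integral_fst[OF g])
  also have "\<dots> \<le> J_tau \<tau> P chi"
    unfolding J_tau_def
  proof (rule nn_integral_mono_AE)
    show "AE z in P \<Otimes>\<^sub>M I_measure. g z \<le> (case z of (p, t) \<Rightarrow> r_tau \<tau> (m_chi P chi (chi p t)) *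
        ennreal (norm (vector_derivative (chi p) (at t))))"
      using AE_chi_derivative by eventually_elim (use le in \<open>auto split: prod.splits\<close>)
  qed
  finally show ?thesis .
qed

text \<open>No multiplicity exceeds the total mass, so the unit cost is nowhere below its value at
  the total mass.\<close>

lemma arclength_le_J_tau:
  assumes \<tau>: "transportation_cost \<tau>" "concave_on {0..} \<tau>"
  shows "r_tau \<tau> (measure P (space P)) * (\<integral>\<^sup>+p. arclength p 1 \<partial>P) \<le> J_tau \<tau> P chi"
proof -
  let ?r = "r_tau \<tau> (measure P (space P))"
  define g where "g z = ?r * (speed (fst z) (snd z) * indicator {0..<1} (snd z))" for z
  have g [measurable]: "g \<in> borel_measurable (P \<Otimes>\<^sub>M I_measure)" unfolding g_def by measurable
  have "?r * (\<integral>\<^sup>+p. arclength p 1 \<partial>P) = (\<integral>\<^sup>+p. ?r * arclength p 1 \<partial>P)"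
    by (rule nn_integral_cmult[symmetric]) measurable
  also have "\<dots> = (\<integral>\<^sup>+p. \<integral>\<^sup>+t. g (p, t) \<partial>I_measure \<partial>P)"
  proof (rule nn_integral_cong)
    fix p assume p: "p \<in> space P"
    have "(\<integral>\<^sup>+t. g (p, t) \<partial>I_measure) = ?r * (\<integral>\<^sup>+t. speed p t * indicator {0..<1} t \<partial>I_measure)"
    proof -
      have "(\<lambda>t. speed p t * indicator {0..<1} t) \<in> borel_measurable borel" using p by measurable
      then have "(\<lambda>t. speed p t * indicator {0..<1} t) \<in> borel_measurable I_measure"
        by (intro measurable_restrict_space1) simp
      then show ?thesis unfolding g_def by (simp add: nn_integral_cmult)
    qed
    then show "?r * arclength p 1 = (\<integral>\<^sup>+t. g (p, t) \<partial>I_measure)"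
      using nn_integral_I_speed[OF p, of 0 1] by (simp add: arclength_def)
  qed
  also have "\<dots> \<le> J_tau \<tau> P chi"
  proof (rule J_tau_ge_speed[OF g])
    fix p t assume "0 < t" "t < (1::real)"
    then have "g (p, t) = ?r * speed p t" by (simp add: g_def)
    also have "\<dots> \<le> r_tau \<tau> (m_chi P chi (chi p t)) * speed p t"
      by (intro mult_right_mono r_tau_antimono[OF \<tau>] m_chi_nonneg m_chi_le) simp
    finally show "g (p, t) \<le> r_tau \<tau> (m_chi P chi (chi p t)) * speed p t" .
  qed
  finally show ?thesis .
qed

context
  fixes \<tau> :: "real \<Rightarrow> real"
  assumes \<tau>: "transportation_cost \<tau>" "concave_on {0..} \<tau>"
    and mass: "0 < measure P (space P)" and J_fin: "J_tau \<tau> P chi < \<infinity>"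
begin

lemma r_mass_pos: "0 < r_tau \<tau> (measure P (space P))"
  using mass \<tau>(1) by (simp add: r_tau_def transportation_cost_def)

lemma AE_good: "AE p in P. good p"
proof -
  have "(\<integral>\<^sup>+p. arclength p 1 \<partial>P) \<noteq> \<infinity>"
  proof
    assume "(\<integral>\<^sup>+p. arclength p 1 \<partial>P) = \<infinity>"
    then have "J_tau \<tau> P chi = \<infinity>"
      using arclength_le_J_tau[OF \<tau>] r_mass_pos by (auto simp: ennreal_mult_top top_unique split: if_splits)
    then show False using J_fin by simp
  qed
  then have "AE p in P. arclength p 1 \<noteq> \<infinity>" by (intro nn_integral_PInf_AE) measurable
  with AE_not_in[OF B_null] AE_space show ?thesis
    by eventually_elim (auto simp: good_def less_top)
qed

lemma integral_len_le: "r_tau \<tau> (measure P (space P)) * (\<integral>\<^sup>+p. ennreal (len p 1) \<partial>P) \<le> J_tau \<tau> P chi"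
proof -
  have "(\<integral>\<^sup>+p. ennreal (len p 1) \<partial>P) \<le> (\<integral>\<^sup>+p. arclength p 1 \<partial>P)"
  proof (rule nn_integral_mono)
    fix p show "ennreal (len p 1) \<le> arclength p 1"
      by (cases "good p") (auto simp: ennreal_len, simp add: len_def)
  qed
  then show ?thesis using arclength_le_J_tau[OF \<tau>] by (meson mult_left_mono order_trans zero_le)
qed

interpretation LX: lipschitz_paths P X "\<lambda>p. len p 1" by (rule lipschitz_X)

text \<open>Almost every original path through \<open>y\<close> is covered by its reparametrization,
  which therefore comes within \<open>d\<close> of \<open>x\<close>.\<close>

lemma m_chi_le_tube:
  assumes "dist y x \<le> d"
  shows "m_chi P chi y \<le> measure P (tube P X d x)"
proof (cases "{q \<in> space P. y \<in> chi q ` {0..1}} \<in> sets (completion P)")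
  case True
  have "emeasure (completion P) {q \<in> space P. y \<in> chi q ` {0..1}} \<le> emeasure (completion P) (tube P X d x)"
  proof (rule emeasure_mono_AE)
    have "AE q in completion P. good q" using AE_good by (rule AE_completion)
    then show "AE q in completion P. q \<in> {q \<in> space P. y \<in> chi q ` {0..1}} \<longrightarrow> q \<in> tube P X d x"
    proof eventually_elim
      case (elim q)
      show ?case
      proof
        assume q: "q \<in> {q \<in> space P. y \<in> chi q ` {0..1}}"
        then have "y \<in> X q ` {0..1}" using chi_image_subset[OF elim] by blast
        then show "q \<in> tube P X d x" using q assms by (auto simp: tube_def)
      qed
    qed
  qed simp
  also have "\<dots> = emeasure P (tube P X d x)" by (simp add: emeasure_completion)
  finally show ?thesis
    unfolding m_chi_def measure_def by (intro enn2real_mono) (auto simp: less_top[symmetric])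
next
  \<comment> \<open>A set outside the sigma-algebra has measure 0 by convention, so the inequality
    holds here as well.\<close>
  case False
  then show ?thesis by (simp add: m_chi_def measure_notin_sets)
qed

text \<open>While the original path runs through one of the \<open>Suc N\<close> pieces of equal
  length, the cutoff keeps it within \<open>d\<close> of the start of the piece. There its
  multiplicity is at most the tube mass, so the unit cost in \<open>J_tau\<close> is at least that
  of the summand, and the increment is at most the integral of the speed over the piece.\<close>

lemma discrete_energy_le_J_tau: "discrete_energy \<tau> P X (\<lambda>p. len p 1) (Suc N) d \<le> J_tau \<tau> P chi"
proof -
  note borel_measurable_r_tau[OF \<tau>(1), measurable]
  \<comment> \<open>The pieces are compared in the time of the original path: piece \<open>i\<close>
    is traversed between the arrival times at two consecutive fractions.\<close>
  define \<alpha> where "\<alpha> i p = arrival p (real i / real (Suc N))" for i p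
  define c where "c i p = r_tau \<tau> (measure P (tube P X d (X p (real i / real (Suc N)))))" for i p
  define g where "g z = (if good (fst z) \<and> len (fst z) 1 < d * real (Suc N) then
      (\<Sum>i<Suc N. c i (fst z) * (speed (fst z) (snd z) * indicator {\<alpha> i (fst z)..<\<alpha> (Suc i) (fst z)} (snd z))) else 0)" for z
  have frac: "0 \<le> real i / real (Suc N)" "real i / real (Suc N) \<le> 1" if "i \<le> Suc N" for i
    using that by (simp_all add: divide_le_eq)
  have \<alpha>m: "\<alpha> i \<in> borel_measurable P" if "i \<le> Suc N" for i
    unfolding \<alpha>_def using frac[OF that] by measurable
  have [measurable]: "c i \<in> borel_measurable P" for i unfolding c_def by measurable
  have g [measurable]: "g \<in> borel_measurable (P \<Otimes>\<^sub>M I_measure)"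
  proof -
    have "(\<lambda>z. indicator {\<alpha> i (fst z)..<\<alpha> (Suc i) (fst z)} (snd z) :: ennreal) \<in> borel_measurable (P \<Otimes>\<^sub>M I_measure)"
      if "i < Suc N" for i
    proof -
      have [measurable]: "\<alpha> i \<in> borel_measurable P" "\<alpha> (Suc i) \<in> borel_measurable P" using \<alpha>m that by auto
      have "(\<lambda>z. indicator {z \<in> space (P \<Otimes>\<^sub>M I_measure). \<alpha> i (fst z) \<le> snd z \<and> snd z < \<alpha> (Suc i) (fst z)} z :: ennreal) \<in> borel_measurable (P \<Otimes>\<^sub>M I_measure)"
        by measurable
      then show ?thesis
        by (rule measurable_cong[THEN iffD1, rotated]) (auto simp: indicator_def)
    qed
    then show ?thesis unfolding g_def by measurable
  qed
  have \<alpha>b: "0 \<le> \<alpha> i p" "\<alpha> i p \<le> 1" "len p (\<alpha> i p) = real i / real (Suc N) * len p 1" if "i \<le> Suc N" for i p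
    unfolding \<alpha>_def using arrival(1-3)[OF frac[OF that], of p] by auto
  have \<alpha>mono: "\<alpha> i p \<le> \<alpha> j p" if "i \<le> j" "j \<le> Suc N" for i j p
    unfolding \<alpha>_def by (rule arrival_mono) (use frac that in \<open>auto intro: divide_right_mono\<close>)
  have XY: "X p (real i / real (Suc N)) = Y p (\<alpha> i p)" if "good p" "i \<le> Suc N" for i p
    using that frac[OF that(2)] by (simp add: X_def \<alpha>_def)
  have "discrete_energy \<tau> P X (\<lambda>p. len p 1) (Suc N) d \<le> (\<integral>\<^sup>+p. \<integral>\<^sup>+t. g (p, t) \<partial>I_measure \<partial>P)"
    unfolding discrete_energy_def
  proof (rule nn_integral_mono)
    fix p assume p: "p \<in> space P"
    show "(if len p 1 < d * real (Suc N) then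
      (\<Sum>i<Suc N. r_tau \<tau> (measure P (tube P X d (X p (real i / real (Suc N))))) *
        ennreal (norm (X p (real (Suc i) / real (Suc N)) - X p (real i / real (Suc N))))) else 0) \<le> (\<integral>\<^sup>+t. g (p, t) \<partial>I_measure)"
    proof (cases "good p \<and> len p 1 < d * real (Suc N)")
      case True
      then have gp: "good p" by simp
      have ind: "(\<lambda>t. speed p t * indicator {a..<b} t) \<in> borel_measurable I_measure" for a b
      proof -
        have "(\<lambda>t. speed p t * indicator {a..<b} t) \<in> borel_measurable borel"
          using measurable_speed_section[OF p] by measurable
        then show ?thesis by (intro measurable_restrict_space1) simp
      qed
      have "(\<Sum>i<Suc N. c i p * ennreal (norm (X p (real (Suc i) / real (Suc N)) - X p (real i / real (Suc N)))))
        \<le> (\<Sum>i<Suc N. c i p * (\<integral>\<^sup>+t. speed p t * indicator {\<alpha> i p..<\<alpha> (Suc i) p} t \<partial>I_measure))"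
      proof (intro sum_mono mult_left_mono)
        fix i assume "i \<in> {..<Suc N}"
        then have i: "i \<le> Suc N" "Suc i \<le> Suc N" by auto
        have "ennreal (norm (Y p (\<alpha> (Suc i) p) - Y p (\<alpha> i p))) \<le> (\<integral>\<^sup>+t. speed p t * indicator {\<alpha> i p..<\<alpha> (Suc i) p} t \<partial>lborel)"
          by (rule norm_Y_diff_le) (use \<alpha>b i \<alpha>mono in auto)
        then show "ennreal (norm (X p (real (Suc i) / real (Suc N)) - X p (real i / real (Suc N)))) \<le>
            (\<integral>\<^sup>+t. speed p t * indicator {\<alpha> i p..<\<alpha> (Suc i) p} t \<partial>I_measure)"
          unfolding XY[OF gp i(1)] XY[OF gp i(2)] using \<alpha>b i by (subst nn_integral_I_speed[OF p]) auto
      qed simp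
      also have "\<dots> = (\<integral>\<^sup>+t. (\<Sum>i<Suc N. c i p * (speed p t * indicator {\<alpha> i p..<\<alpha> (Suc i) p} t)) \<partial>I_measure)"
        using ind by (subst nn_integral_sum) (auto simp: nn_integral_cmult)
      also have "\<dots> = (\<integral>\<^sup>+t. g (p, t) \<partial>I_measure)" using True by (simp add: g_def)
      finally show ?thesis using True by (simp add: c_def)
    next
      \<comment> \<open>For a path that is not good, \<open>X p\<close> is constant and all
        increments vanish; otherwise the cutoff fails.\<close>
      case False
      then show ?thesis by (auto simp: X_def)
    qed
  qed
  also have "\<dots> \<le> J_tau \<tau> P chi"
  proof (rule J_tau_ge_speed[OF g])
    fix p and t :: real assume p: "p \<in> space P" "p \<notin> B" and t: "0 < t" "t < 1"
    show "g (p, t) \<le> r_tau \<tau> (m_chi P chi (chi p t)) * speed p t"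
    proof (cases "good p \<and> len p 1 < d * real (Suc N) \<and> (\<exists>i<Suc N. t \<in> {\<alpha> i p..<\<alpha> (Suc i) p})")
      case True
      then obtain i where gp: "good p" and L: "len p 1 < d * real (Suc N)"
        and i: "i < Suc N" "t \<in> {\<alpha> i p..<\<alpha> (Suc i) p}" by blast
      \<comment> \<open>Arrival times are monotone, so the half-open time intervals are disjoint and
        at most one summand of \<open>g\<close> is present.\<close>
      have uniq: "t \<notin> {\<alpha> j p..<\<alpha> (Suc j) p}" if j: "j < Suc N" "j \<noteq> i" for j
      proof (cases "j < i")
        case True
        then have "\<alpha> (Suc j) p \<le> \<alpha> i p" using i by (intro \<alpha>mono) auto
        then show ?thesis using i by auto
      next
        case False
        then have "\<alpha> (Suc i) p \<le> \<alpha> j p" using j by (intro \<alpha>mono) auto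
        then show ?thesis using i by auto
      qed
      have "g (p, t) = (\<Sum>j<Suc N. c j p * (speed p t * indicator {\<alpha> j p..<\<alpha> (Suc j) p} t))"
        using gp L by (simp add: g_def)
      also have "\<dots> = (\<Sum>j<Suc N. if j = i then c i p * speed p t else 0)"
        by (intro sum.cong refl) (use i uniq in auto)
      also have "\<dots> = c i p * speed p t" using i(1) by (subst sum.delta) auto
      also have "\<dots> \<le> r_tau \<tau> (m_chi P chi (chi p t)) * speed p t"
        unfolding c_def
      proof (intro mult_right_mono r_tau_antimono[OF \<tau>] m_chi_nonneg m_chi_le_tube)
        have ii: "i \<le> Suc N" "Suc i \<le> Suc N" using i by auto
        have "dist (chi p t) (X p (real i / real (Suc N))) = norm (Y p t - Y p (\<alpha> i p))"
          using XY[OF gp ii(1)] Y_good[OF gp, of t] t by (simp add: dist_norm)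
        also have "\<dots> \<le> len p t - len p (\<alpha> i p)"
          using gp i t \<alpha>b[OF ii(1)] by (intro norm_Y_diff_le_len) auto
        also have "len p t \<le> len p (\<alpha> (Suc i) p)" using i by (intro len_mono) auto
        also have "len p (\<alpha> (Suc i) p) - len p (\<alpha> i p) = len p 1 / real (Suc N)"
        proof -
          have "real (Suc i) / real (Suc N) - real i / real (Suc N) = 1 / real (Suc N)"
            by (simp add: diff_divide_distrib[symmetric])
          then show ?thesis
            unfolding \<alpha>b(3)[OF ii(1)] \<alpha>b(3)[OF ii(2)] left_diff_distrib[symmetric] by simp
        qed
        also have "\<dots> \<le> d" using L by (simp add: divide_le_eq less_imp_le del: of_nat_Suc)
        finally show "dist (chi p t) (X p (real i / real (Suc N))) \<le> d" by simp
      qed simp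
      finally show ?thesis .
    next
      case False
      then have "g (p, t) = 0" unfolding g_def by (auto intro!: sum.neutral simp: indicator_def)
      then show ?thesis by simp
    qed
  qed
  finally show ?thesis .
qed

end

end

section \<open>Almost sure convergence of random sequences\<close>

text \<open>Binary digits are written in base 4, so that the tail of an expansion is at most one third
  of a unit and the digits depend continuously on the code.\<close>

definition bits_code :: "(nat \<Rightarrow> bool) \<Rightarrow> real" where
  "bits_code b = (\<Sum>m. of_bool (b m) / 4 ^ Suc m)"

definition bits_digit :: "nat \<Rightarrow> real \<Rightarrow> bool" where
  "bits_digit m y \<longleftrightarrow> odd \<lfloor>4 ^ Suc m * y\<rfloor>"

lemma summable_bits_code: "summable (\<lambda>m. of_bool (b m) / 4 ^ Suc m :: real)"
proof (rule summable_comparison_test')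
  show "summable (\<lambda>m. (1/4::real) ^ m)" by (rule summable_geometric) simp
  show "norm (of_bool (b m) / 4 ^ Suc m :: real) \<le> (1/4) ^ m" if "0 \<le> m" for m
    by (auto simp: field_simps)
qed

lemma bits_code_bounds: "0 \<le> bits_code b" "bits_code b \<le> 1/3"
proof -
  show "0 \<le> bits_code b" unfolding bits_code_def by (rule suminf_nonneg[OF summable_bits_code]) simp
  have g: "(\<lambda>m. (1/4) * (1/4::real) ^ m) sums ((1/4) * (1 / (1 - 1/4)))"
    by (intro sums_mult geometric_sums) simp
  have "bits_code b \<le> (\<Sum>m. (1/4) * (1/4::real) ^ m)" unfolding bits_code_def
    by (rule suminf_le[OF _ summable_bits_code sums_summable[OF g]]) (simp add: power_one_over field_simps)
  also have "\<dots> = 1/3" using sums_unique[OF g] by simp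
  finally show "bits_code b \<le> 1/3" .
qed

lemma bits_code_shift: "4 * bits_code b = of_bool (b 0) + bits_code (\<lambda>m. b (Suc m))"
proof -
  have "bits_code b = of_bool (b 0) / 4 + (\<Sum>m. of_bool (b (Suc m)) / 4 ^ Suc (Suc m))"
    unfolding bits_code_def using suminf_split_head[OF summable_bits_code[of b]] by simp
  also have "(\<Sum>m. of_bool (b (Suc m)) / 4 ^ Suc (Suc m)) = (\<Sum>m. of_bool (b (Suc m)) / 4 ^ Suc m) / (4::real)"
    by (subst suminf_divide[OF summable_bits_code, symmetric]) (simp add: field_simps)
  finally show ?thesis by (simp add: bits_code_def)
qed

text \<open>The earlier digits contribute a multiple of 4, which is even, and the later ones at most
  1/3. The parity of the integer part is therefore digit \<open>m\<close>.\<close>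

lemma bits_code_expansion:
  "\<exists>K::int. 4 ^ Suc m * bits_code b = of_int (4 * K + of_bool (b m)) + bits_code (\<lambda>i. b (i + Suc m))"
proof (induction m)
  case 0
  then show ?case using bits_code_shift[of b] by (intro exI[of _ 0]) simp
next
  case (Suc m)
  then obtain K :: int where K: "4 ^ Suc m * bits_code b = of_int (4 * K + of_bool (b m)) + bits_code (\<lambda>i. b (i + Suc m))" by blast
  have "4 ^ Suc (Suc m) * bits_code b = 4 * (4 ^ Suc m * bits_code b)" by simp
  also have "\<dots> = 4 * of_int (4 * K + of_bool (b m)) + 4 * bits_code (\<lambda>i. b (i + Suc m))" unfolding K by simp
  also have "4 * bits_code (\<lambda>i. b (i + Suc m)) = of_bool (b (Suc m)) + bits_code (\<lambda>i. b (i + Suc (Suc m)))"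
    using bits_code_shift[of "\<lambda>i. b (i + Suc m)"] by simp
  finally show ?case by (intro exI[of _ "4 * K + of_bool (b m)"]) (simp add: algebra_simps)
qed

lemma bits_digit_code: "bits_digit m (bits_code b) \<longleftrightarrow> b m"
  and frac_bits_code: "frac (4 ^ Suc m * bits_code b) \<le> 1/3"
proof -
  obtain K :: int where K: "4 ^ Suc m * bits_code b = of_int (4 * K + of_bool (b m)) + bits_code (\<lambda>i. b (i + Suc m))"
    using bits_code_expansion by blast
  have fl: "\<lfloor>4 ^ Suc m * bits_code b\<rfloor> = 4 * K + of_bool (b m)"
    unfolding K using bits_code_bounds[of "\<lambda>i. b (i + Suc m)"] by (intro floor_unique) linarith+
  then show "bits_digit m (bits_code b) \<longleftrightarrow> b m" unfolding bits_digit_def by simp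
  show "frac (4 ^ Suc m * bits_code b) \<le> 1/3"
    unfolding frac_def fl using bits_code_bounds[of "\<lambda>i. b (i + Suc m)"] by (simp add: K del: power_Suc)
qed

text \<open>Fractional parts that avoid the interval from 1/3 to 1 cannot approach an integer from
  below. The limit has the same property, and values within 1/3 of it have integer parts differing
  by less than 1.\<close>

lemma floor_eventually_const:
  fixes u :: real
  assumes u: "y \<longlonglongrightarrow> u" and frac: "\<And>k. frac (y k) \<le> 1/3"
  shows "eventually (\<lambda>k. \<lfloor>y k\<rfloor> = \<lfloor>u\<rfloor>) sequentially"
proof -
  have fu: "frac u \<le> 1/3"
  proof (rule ccontr)
    assume "\<not> frac u \<le> 1/3"
    then have pos: "min (frac u - 1/3) (1 - frac u) > 0" using frac_lt_1[of u] by simp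
    from LIMSEQ_D[OF u pos] obtain k where "\<bar>y k - u\<bar> < min (frac u - 1/3) (1 - frac u)" by (auto simp: real_norm_def)
    then have 1: "of_int \<lfloor>u\<rfloor> + 1/3 < y k" "y k < of_int \<lfloor>u\<rfloor> + 1" unfolding frac_def by linarith+
    then have "\<lfloor>y k\<rfloor> = \<lfloor>u\<rfloor>" by (intro floor_unique) linarith+
    then have "frac (y k) > 1/3" using 1 by (simp add: frac_def)
    then show False using frac[of k] by simp
  qed
  have "eventually (\<lambda>k. \<bar>y k - u\<bar> < 1/3) sequentially"
    using tendstoD[OF u, of "1/3"] by (simp add: dist_real_def)
  then show ?thesis
  proof eventually_elim
    case (elim k)
    have "frac (y k) \<le> 1/3" "0 \<le> frac (y k)" "0 \<le> frac u" using frac by auto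
    then have "of_int \<lfloor>y k\<rfloor> < of_int \<lfloor>u\<rfloor> + (1::real)" "of_int \<lfloor>u\<rfloor> < of_int \<lfloor>y k\<rfloor> + (1::real)"
      using elim fu unfolding frac_def by linarith+
    then show ?case by linarith
  qed
qed

definition binary_digit :: "nat \<Rightarrow> real \<Rightarrow> bool" where
  "binary_digit j x \<longleftrightarrow> odd \<lfloor>2 ^ Suc j * x\<rfloor>"

text \<open>The partial sums are \<open>\<lfloor>2 ^ n * x\<rfloor> / 2 ^ n\<close>.\<close>

lemma binary_digit_sums:
  assumes x: "0 \<le> x" "x < 1"
  shows "(\<lambda>j. of_bool (binary_digit j x) / 2 ^ Suc j) sums x"
proof -
  have fl: "\<lfloor>2 ^ Suc n * x\<rfloor> = 2 * \<lfloor>2 ^ n * x\<rfloor> + of_bool (binary_digit n x)" for n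
  proof -
    have "\<lfloor>2 ^ Suc n * x\<rfloor> div 2 = \<lfloor>2 ^ n * x\<rfloor>"
      using floor_divide_real_eq_div[of 2 "2 ^ Suc n * x"] by simp
    then show ?thesis unfolding binary_digit_def by (metis mod2_eq_if mult_div_mod_eq of_bool_eq(1,2))
  qed
  have "(\<Sum>j<n. of_bool (binary_digit j x) / 2 ^ Suc j :: real) = of_int \<lfloor>2 ^ n * x\<rfloor> / 2 ^ n" for n
  proof (induction n)
    case 0 then show ?case using x by (simp add: floor_eq_iff)
  next
    case (Suc n)
    then show ?case unfolding fl by (simp add: field_simps)
  qed
  moreover have "(\<lambda>n. of_int \<lfloor>2 ^ n * x\<rfloor> / 2 ^ n) \<longlonglongrightarrow> x"
  proof (rule tendsto_sandwich)
    have "(\<lambda>n. x - (1/2) ^ n) \<longlonglongrightarrow> x - 0" by (intro tendsto_diff tendsto_const LIMSEQ_realpow_zero) auto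
    then show "(\<lambda>n. x - (1/2) ^ n) \<longlonglongrightarrow> x" by simp
    show "\<forall>\<^sub>F n in sequentially. x - (1/2) ^ n \<le> of_int \<lfloor>2 ^ n * x\<rfloor> / 2 ^ n"
    proof (intro always_eventually allI)
      fix n :: nat
      have "2 ^ n * x - 1 \<le> of_int \<lfloor>2 ^ n * x\<rfloor>" by linarith
      then have "(2 ^ n * x - 1) / 2 ^ n \<le> of_int \<lfloor>2 ^ n * x\<rfloor> / 2 ^ n" by (rule divide_right_mono) simp
      then show "x - (1/2) ^ n \<le> of_int \<lfloor>2 ^ n * x\<rfloor> / 2 ^ n" by (simp add: diff_divide_distrib power_one_over)
    qed
    show "\<forall>\<^sub>F n in sequentially. of_int \<lfloor>2 ^ n * x\<rfloor> / 2 ^ n \<le> x"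
      by (intro always_eventually allI) (simp add: divide_le_eq mult.commute)
  qed simp
  ultimately show ?thesis unfolding sums_def by simp
qed

text \<open>The binary digits of all coordinates are interleaved by the pairing function. Binary
  digits are discontinuous in the coordinate; encoding is only used as a measurable map, and
  continuity is asked of decoding alone.\<close>

definition encode :: "(nat \<Rightarrow> real) \<Rightarrow> real" where
  "encode z = bits_code (\<lambda>m. binary_digit (snd (prod_decode m)) (z (fst (prod_decode m))))"

definition decode :: "real \<Rightarrow> nat \<Rightarrow> real" where
  "decode y i = (\<Sum>j. of_bool (bits_digit (prod_encode (i, j)) y) / 2 ^ Suc j)"

lemma decode_encode: "0 \<le> z i \<Longrightarrow> z i < 1 \<Longrightarrow> decode (encode z) i = z i"
  unfolding decode_def encode_def bits_digit_code using sums_unique[OF binary_digit_sums[of "z i"]] by simp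

lemma measurable_bits_code:
  assumes "\<And>m. Measurable.pred M (\<lambda>x. b x m)"
  shows "(\<lambda>x. bits_code (b x)) \<in> borel_measurable M"
  unfolding bits_code_def of_bool_def using assms by measurable

lemma measurable_encode:
  assumes [measurable]: "\<And>i. (\<lambda>x. z x i) \<in> borel_measurable M"
  shows "(\<lambda>x. encode (z x)) \<in> borel_measurable M"
  unfolding encode_def binary_digit_def by (rule measurable_bits_code) measurable

lemma measurable_decode [measurable]: "(\<lambda>y. decode y i) \<in> borel_measurable borel"
  unfolding decode_def bits_digit_def of_bool_def by measurable

text \<open>The property of codes that makes digits stable under limits. It is a Borel condition on
  the number, so it passes to any random variable with the law of a code.\<close>

definition admissible_code :: "real \<Rightarrow> bool" where
  "admissible_code y \<longleftrightarrow> (\<forall>m. frac (4 ^ Suc m * y) \<le> 1/3)"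

lemma admissible_encode: "admissible_code (encode z)"
  unfolding admissible_code_def encode_def using frac_bits_code by blast

lemma pred_admissible [measurable]: "Measurable.pred borel admissible_code"
  unfolding admissible_code_def frac_def by measurable

text \<open>Every digit is eventually constant, and the binary series is dominated by a geometric
  one. The limit \<open>u\<close> is not assumed to be the code of a sequence.\<close>

lemma decode_tendsto:
  assumes y: "y \<longlonglongrightarrow> u" and adm: "\<And>k. admissible_code (y k)"
  shows "(\<lambda>k. decode (y k) i) \<longlonglongrightarrow> decode u i"
proof -
  have ev: "eventually (\<lambda>k. bits_digit m (y k) = bits_digit m u) sequentially" for m
  proof -
    have "(\<lambda>k. 4 ^ Suc m * y k) \<longlonglongrightarrow> 4 ^ Suc m * u" by (intro tendsto_intros y)
    then have "eventually (\<lambda>k. \<lfloor>4 ^ Suc m * y k\<rfloor> = \<lfloor>4 ^ Suc m * u\<rfloor>) sequentially"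
      by (rule floor_eventually_const) (use adm in \<open>simp add: admissible_code_def del: power_Suc\<close>)
    then show ?thesis by eventually_elim (simp add: bits_digit_def)
  qed
  show ?thesis unfolding decode_def
  proof (rule conjunct2[OF conjunct2], rule tannerys_theorem[where M="\<lambda>j. (1/2) ^ j"])
    show "((\<lambda>k. of_bool (bits_digit (prod_encode (i, j)) (y k)) / 2 ^ Suc j) \<longlongrightarrow>
        of_bool (bits_digit (prod_encode (i, j)) u) / (2 ^ Suc j :: real)) sequentially" for j
      by (rule tendsto_eventually) (use ev[of "prod_encode (i, j)"] in \<open>auto elim!: eventually_mono\<close>)
    show "summable (\<lambda>j. (1/2::real) ^ j)" by (rule summable_geometric) simp
    show "\<forall>\<^sub>F (j, k) in at_top \<times>\<^sub>F sequentially. norm (of_bool (bits_digit (prod_encode (i, j)) (y k)) / 2 ^ Suc j :: real) \<le> (1/2) ^ j"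
      by (intro always_eventually) (auto simp: field_simps)
  qed simp
qed

section \<open>Almost surely convergent copies of a sequence of codes\<close>

lemma distr_scale_measure:
  assumes "f \<in> M \<rightarrow>\<^sub>M N"
  shows "distr (scale_measure r M) N f = scale_measure r (distr M N f)"
proof (rule measure_eqI)
  fix A assume "A \<in> sets (distr (scale_measure r M) N f)"
  then have A: "A \<in> sets N" by simp
  have f': "f \<in> scale_measure r M \<rightarrow>\<^sub>M N" using assms by (simp add: measurable_cong_sets[OF sets_scale_measure refl])
  show "emeasure (distr (scale_measure r M) N f) A = emeasure (scale_measure r (distr M N f)) A"
    using A assms f' by (simp add: emeasure_distr space_scale_measure)
qed simp

lemma scale_measure_normalize:
  assumes "c > 0"
  shows "scale_measure (ennreal c) (scale_measure (ennreal (1 / c)) M) = M"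
  using assms by (simp add: ennreal_mult[symmetric])

lemma prob_space_normalize:
  assumes "finite_measure M" "measure M (space M) > 0"
  shows "prob_space (scale_measure (ennreal (1 / measure M (space M))) M)"
proof (rule prob_spaceI)
  interpret finite_measure M by fact
  show "emeasure (scale_measure (ennreal (1 / measure M (space M))) M) (space (scale_measure (ennreal (1 / measure M (space M))) M)) = 1"
    using assms(2) by (simp add: space_scale_measure emeasure_eq_measure ennreal_mult[symmetric] ennreal_1[symmetric] del: ennreal_1)
qed

text \<open>Codes are real numbers in a fixed bounded interval, so their laws are tight whatever the
  coordinates do. The new variables share only the law of each code with the old ones, which is all
  that is carried over.\<close>

theorem random_sequence_selection:
  fixes Z :: "nat \<Rightarrow> 'g \<Rightarrow> nat \<Rightarrow> real"
  assumes P: "finite_measure P" and mass: "measure P (space P) > 0"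
    and Z: "\<And>k i. (\<lambda>p. Z k p i) \<in> borel_measurable P"
  obtains s :: "nat \<Rightarrow> nat" and \<Omega> :: "real measure" and W :: "nat \<Rightarrow> real \<Rightarrow> real" and W' :: "real \<Rightarrow> real"
  where "strict_mono s" "finite_measure \<Omega>" "measure \<Omega> (space \<Omega>) = measure P (space P)"
    "\<And>k. W k \<in> borel_measurable \<Omega>" "W' \<in> borel_measurable \<Omega>"
    "\<And>k. distr \<Omega> borel (W k) = distr P borel (\<lambda>p. encode (Z (s k) p))"
    "AE w in \<Omega>. \<forall>i. (\<lambda>k. decode (W k w) i) \<longlonglongrightarrow> decode (W' w) i"
proof -
  define c where "c = measure P (space P)"
  have c: "c > 0" using mass by (simp add: c_def)
  define Q where "Q = scale_measure (ennreal (1 / c)) P"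
  have Q: "prob_space Q" unfolding Q_def c_def by (rule prob_space_normalize[OF P mass])
  interpret Q: prob_space Q by (rule Q)
  have PQ: "scale_measure (ennreal c) Q = P" unfolding Q_def by (rule scale_measure_normalize[OF c])
  have enc [measurable]: "(\<lambda>p. encode (Z k p)) \<in> borel_measurable P" for k
    by (rule measurable_encode) (rule Z)
  then have encQ [measurable]: "(\<lambda>p. encode (Z k p)) \<in> borel_measurable Q" for k
    by (simp add: Q_def measurable_cong_sets[OF sets_scale_measure refl])
  define \<nu> where "\<nu> k = distr Q borel (\<lambda>p. encode (Z k p))" for k
  have rd: "real_distribution (\<nu> k)" for k
    unfolding \<nu>_def by (rule Q.real_distribution_distr) (rule encQ)
  have "tight \<nu>"
    unfolding tight_def
  proof (intro conjI allI impI rd)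
    fix e :: real assume e: "e > 0"
    have "measure (\<nu> k) {-1<..1} = 1" for k
    proof -
      have "measure (\<nu> k) {-1<..1} = measure Q ((\<lambda>p. encode (Z k p)) -` {-1<..1} \<inter> space Q)"
        unfolding \<nu>_def by (rule measure_distr) auto
      also have "(\<lambda>p. encode (Z k p)) -` {-1<..1} \<inter> space Q = space Q"
      proof -
        have "-1 < encode z" "encode z \<le> 1" for z
          unfolding encode_def using bits_code_bounds[of "\<lambda>m. binary_digit (snd (prod_decode m)) (z (fst (prod_decode m)))"] by linarith+
        then show ?thesis by auto
      qed
      finally show ?thesis by (simp add: Q.prob_space)
    qed
    then show "\<exists>a b. a < b \<and> (\<forall>n. 1 - e < measure (\<nu> n) {a<..b})"
      using e by (intro exI[of _ "-1"] exI[of _ 1]) simp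
  qed
  from tight_imp_convergent_subsubsequence[OF this strict_mono_id]
  obtain r M where r: "strict_mono (r :: nat \<Rightarrow> nat)" and M: "real_distribution M" and conv: "weak_conv_m (\<nu> \<circ> id \<circ> r) M"
    by blast
  have "\<And>n. real_distribution ((\<nu> \<circ> id \<circ> r) n)" using rd by simp
  from Skorohod[OF this M conv] obtain \<Omega>0 :: "real measure" and W W' where
    "prob_space \<Omega>0 \<and> (\<forall>n. W n \<in> borel_measurable \<Omega>0) \<and> (\<forall>n. distr \<Omega>0 borel (W n) = (\<nu> \<circ> id \<circ> r) n) \<and>
      W' \<in> measurable \<Omega>0 lborel \<and> distr \<Omega>0 borel W' = M \<and> (\<forall>x\<in>space \<Omega>0. (\<lambda>n. W n x) \<longlonglongrightarrow> W' x)"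
    by blast
  then have \<Omega>0: "prob_space \<Omega>0" and W: "\<And>n. W n \<in> borel_measurable \<Omega>0" "\<And>n. distr \<Omega>0 borel (W n) = \<nu> (r n)"
    and W': "W' \<in> measurable \<Omega>0 lborel" and lim: "\<And>x. x \<in> space \<Omega>0 \<Longrightarrow> (\<lambda>n. W n x) \<longlonglongrightarrow> W' x"
    by simp_all
  have W'm: "W' \<in> borel_measurable \<Omega>0" using W' by simp
  interpret \<Omega>0: prob_space \<Omega>0 by (rule \<Omega>0)
  \<comment> \<open>Helly and Skorohod were applied after normalizing to a probability; scaling by
    \<open>c\<close> restores the mass of \<open>P\<close>.\<close>
  define \<Omega> where "\<Omega> = scale_measure (ennreal c) \<Omega>0"
  have sets\<Omega>: "sets \<Omega> = sets \<Omega>0" by (simp add: \<Omega>_def)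
  have space\<Omega>: "space \<Omega> = space \<Omega>0" by (simp add: \<Omega>_def space_scale_measure)
  have em: "emeasure \<Omega> (space \<Omega>) = ennreal c"
    by (simp add: \<Omega>_def space_scale_measure \<Omega>0.emeasure_space_1)
  have Wm: "W n \<in> borel_measurable \<Omega>" for n using W(1) by (simp add: measurable_cong_sets[OF sets\<Omega> refl])
  have law: "distr \<Omega> borel (W n) = distr P borel (\<lambda>p. encode (Z (r n) p))" for n
  proof -
    have "distr \<Omega> borel (W n) = scale_measure (ennreal c) (\<nu> (r n))"
      unfolding \<Omega>_def using W by (simp add: distr_scale_measure)
    also have "\<dots> = distr (scale_measure (ennreal c) Q) borel (\<lambda>p. encode (Z (r n) p))"
      unfolding \<nu>_def by (rule distr_scale_measure[symmetric]) (rule encQ)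
    finally show ?thesis unfolding PQ .
  qed
  \<comment> \<open>\<open>W n\<close> need not take codes as values everywhere; equality of laws
    gives admissibility almost surely.\<close>
  have "AE w in \<Omega>. admissible_code (W n w)" for n
  proof -
    have "AE y in distr P borel (\<lambda>p. encode (Z (r n) p)). admissible_code y"
      by (subst AE_distr_iff) (auto simp: admissible_encode)
    then have "AE y in distr \<Omega> borel (W n). admissible_code y" unfolding law .
    then show ?thesis using Wm[of n] by (subst (asm) AE_distr_iff) auto
  qed
  then have adm: "AE w in \<Omega>. \<forall>n. admissible_code (W n w)" by (simp add: AE_all_countable)
  have AE: "AE w in \<Omega>. \<forall>i. (\<lambda>k. decode (W k w) i) \<longlonglongrightarrow> decode (W' w) i"
    using adm AE_space
  proof eventually_elim
    case (elim w)
    then show ?case using lim[of w] decode_tendsto unfolding space\<Omega> by blast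
  qed
  show thesis
  proof (rule that[OF r _ _ Wm _ law AE])
    show "finite_measure \<Omega>" by (rule finite_measureI) (simp add: em)
    show "measure \<Omega> (space \<Omega>) = measure P (space P)" using c by (simp add: measure_def em c_def)
    show "W' \<in> borel_measurable \<Omega>" using W'm by (simp add: measurable_cong_sets[OF sets\<Omega> refl])
  qed
qed

section \<open>Realizing a law on the atomless space\<close>

lemma ex_measurable_injection:
  "\<exists>f :: 'g::{second_countable_topology, t2_space} \<Rightarrow> real. f \<in> borel_measurable borel \<and> inj f"
proof -
  obtain B :: "'g set set" where B: "countable B" "topological_basis B"
    using ex_countable_basis by blast
  define b where "b n = from_nat_into B n" for n
  have ne: "B \<noteq> {}" using topological_basis_open[OF B(2)] topological_basisE[OF B(2) open_UNIV UNIV_I] by blast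
  have rb: "range b = B" unfolding b_def using ne B(1) by (rule range_from_nat_into)
  have openb: "open (b n)" for n using rb B(2) by (metis rangeI topological_basis_open)
  \<comment> \<open>The digits record membership in the sets of a countable basis; these sets
    separate points and can be read back from the code.\<close>
  define f where "f x = bits_code (\<lambda>n. x \<in> b n)" for x
  have "f \<in> borel_measurable borel" unfolding f_def
  proof (rule measurable_bits_code)
    fix n
    have [measurable]: "b n \<in> sets borel" using openb by simp
    show "Measurable.pred borel (\<lambda>x. x \<in> b n)" by measurable
  qed
  moreover have "inj f"
  proof (rule injI, rule ccontr)
    fix x y assume f: "f x = f y" and xy: "x \<noteq> y"
    from hausdorff[OF xy] obtain U V where UV: "open U" "x \<in> U" "y \<in> V" "U \<inter> V = {}" by blast
    from topological_basisE[OF B(2) UV(1,2)] obtain B' where "B' \<in> B" "x \<in> B'" "B' \<subseteq> U" by blast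
    then obtain n where n: "x \<in> b n" "b n \<subseteq> U" using rb by (metis imageE)
    have "bits_digit n (f x) \<longleftrightarrow> bits_digit n (f y)" using f by simp
    then have "y \<in> b n" using n unfolding f_def bits_digit_code by simp
    then show False using n UV by blast
  qed
  ultimately show ?thesis by blast
qed

text \<open>Without atoms the distribution function is continuous. The sublevel set is then a closed
  half-line, and the intermediate value theorem makes the value at its end point exactly
  \<open>u\<close>.\<close>

lemma cdf_uniform:
  assumes N: "real_distribution N" and cont: "\<And>y. measure N {y} = 0" and u: "0 < u" "u < 1"
  shows "measure N {y. cdf N y \<le> u} = u"
proof -
  interpret real_distribution N by (rule N)
  have isc: "isCont (cdf N) y" for y using cont by (simp add: isCont_cdf)
  have monoN: "cdf N x \<le> cdf N y" if "x \<le> y" for x y using that by (rule cdf_nondecreasing)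
  obtain a where a: "cdf N a < u"
    using eventually_happens'[OF _ order_tendstoD(2)[OF cdf_lim_at_bot u(1)]] by (auto simp: trivial_limit_at_bot_linorder)
  obtain b where b: "u < cdf N b"
    using eventually_happens'[OF _ order_tendstoD(1)[OF cdf_lim_at_top_prob u(2)]] by (auto simp: trivial_limit_at_top_linorder)
  have ab: "a \<le> b" using a b monoN[of b a] by linarith
  define S where "S = {y. cdf N y \<le> u}"
  have bdd: "bdd_above S"
    unfolding S_def bdd_above_def
  proof (intro exI[of _ b] ballI)
    fix y assume "y \<in> {y. cdf N y \<le> u}"
    then show "y \<le> b" using b monoN[of b y] by (simp add: linear) (meson less_le_trans not_le order_trans linear)
  qed
  have ne: "S \<noteq> {}" using a by (auto simp: S_def intro: less_imp_le)
  have "closed S"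
    unfolding S_def using isc
    by (intro closed_Collect_le) (auto simp: continuous_on_eq_continuous_at)
  then have S1: "Sup S \<in> S" using bdd ne by (intro closed_contains_Sup)
  obtain y where y: "cdf N y = u" using IVT[of "cdf N" a u b] a b ab isc by (auto simp: less_imp_le)
  have "y \<le> Sup S" using y bdd by (intro cSup_upper) (auto simp: S_def)
  then have "u \<le> cdf N (Sup S)" using monoN y by metis
  then have eq: "cdf N (Sup S) = u" using S1 by (simp add: S_def)
  have "S = {..Sup S}"
  proof (intro equalityI subsetI)
    fix y assume "y \<in> S" then show "y \<in> {..Sup S}" using bdd by (simp add: cSup_upper)
  next
    fix y assume "y \<in> {..Sup S}" then show "y \<in> S" using monoN[of y "Sup S"] eq by (simp add: S_def)
  qed
  then have "measure N S = cdf N (Sup S)" by (metis cdf_def)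
  then show ?thesis using eq by (simp add: S_def)
qed

text \<open>An injection into the line has no atoms in its law, so composing it with its own
  distribution function gives a uniform variable \<open>U\<close>. The quantile function of
  \<open>M\<close> applied to \<open>U\<close> then has law \<open>M\<close>.\<close>

lemma atomless_realization_prob:
  fixes P :: "'g::{second_countable_topology, t2_space} measure"
  assumes P: "prob_space P" and sets [measurable_cong]: "sets P = sets borel" and atomless: "\<And>x. emeasure P {x} = 0"
    and M: "real_distribution M"
  shows "\<exists>V \<in> borel_measurable P. distr P borel V = M"
proof -
  interpret P: prob_space P by (rule P)
  interpret M: cdf_distribution M unfolding cdf_distribution_def by (rule M)
  have sp: "space P = UNIV" using sets_eq_imp_space_eq[OF sets] by simp
  obtain f :: "'g \<Rightarrow> real" where f: "f \<in> borel_measurable borel" "inj f" using ex_measurable_injection by blast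
  have fP [measurable]: "f \<in> borel_measurable P" using f(1) by (simp add: measurable_cong_sets[OF sets refl])
  define N where "N = distr P borel f"
  have N: "real_distribution N" unfolding N_def by (rule P.real_distribution_distr) (rule fP)
  interpret N: real_distribution N by (rule N)
  have N0: "measure N {y} = 0" for y
  proof -
    have "measure N {y} = measure P (f -` {y} \<inter> space P)" unfolding N_def by (rule measure_distr) auto
    also have "\<dots> = 0"
    proof (cases "\<exists>x. f x = y")
      case True
      then obtain x where "f x = y" by blast
      then have "f -` {y} \<inter> space P = {x}" using f(2) by (auto simp: sp inj_def)
      then show ?thesis using atomless[of x] by (simp add: measure_def)
    next
      case False
      then have "f -` {y} \<inter> space P = {}" by auto
      then show ?thesis by simp
    qed
    finally show ?thesis .
  qed
  define U where "U x = cdf N (f x)" for x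
  have "mono (cdf N)" by (auto simp: mono_def intro: N.cdf_nondecreasing)
  then have [measurable]: "cdf N \<in> borel_measurable borel" by (rule borel_measurable_mono)
  have U [measurable]: "U \<in> borel_measurable P" unfolding U_def by measurable
  have Uu: "measure P {x \<in> space P. U x \<le> u} = u" if u: "0 < u" "u < 1" for u
  proof -
    have "measure P {x \<in> space P. U x \<le> u} = measure P (f -` {y. cdf N y \<le> u} \<inter> space P)"
      by (auto simp: U_def sp intro!: arg_cong[where f="measure P"])
    also have "\<dots> = measure N {y. cdf N y \<le> u}" unfolding N_def[symmetric]
      by (subst (2) N_def, subst measure_distr) auto
    also have "\<dots> = u" by (rule cdf_uniform[OF N N0 u])
    finally show ?thesis .
  qed
  have U0: "measure P {x \<in> space P. U x \<le> 0} = 0"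
  proof -
    have "measure P {x \<in> space P. U x \<le> 0} \<le> 0 + e" if e: "e > 0" for e
    proof -
      define u where "u = min e (1/2)"
      have "measure P {x \<in> space P. U x \<le> 0} \<le> measure P {x \<in> space P. U x \<le> u}"
        by (rule P.finite_measure_mono) (use e in \<open>auto simp: u_def\<close>)
      also have "\<dots> = u" by (rule Uu) (use e in \<open>auto simp: u_def\<close>)
      finally show ?thesis by (simp add: u_def)
    qed
    then have "measure P {x \<in> space P. U x \<le> 0} \<le> 0" by (rule field_le_epsilon)
    then show ?thesis by (simp add: measure_le_0_iff)
  qed
  have U1: "measure P {x \<in> space P. 1 \<le> U x} = 0"
  proof -
    have "measure P {x \<in> space P. 1 \<le> U x} \<le> 0 + e" if e: "e > 0" for e
    proof -
      define u where "u = max (1 - e) (1/2)"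
      have u: "0 < u" "u < 1" using e by (auto simp: u_def)
      have "measure P {x \<in> space P. 1 \<le> U x} \<le> measure P (space P - {x \<in> space P. U x \<le> u})"
        by (rule P.finite_measure_mono) (use u in auto)
      also have "\<dots> = 1 - u" by (subst P.prob_compl) (auto simp: Uu[OF u])
      finally show ?thesis by (auto simp: u_def)
    qed
    then have "measure P {x \<in> space P. 1 \<le> U x} \<le> 0" by (rule field_le_epsilon)
    then show ?thesis by (simp add: measure_le_0_iff)
  qed
  have AE01: "AE x in P. U x \<in> {0<..<1}"
  proof -
    have "AE x in P. \<not> U x \<le> 0" "AE x in P. \<not> 1 \<le> U x"
      using U0 U1 by (auto simp: P.prob_eq_0[symmetric] P.prob_Collect_eq_0)
    then show ?thesis by eventually_elim auto
  qed
  \<comment> \<open>The quantile function is used on the open unit interval only; \<open>U\<close>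
    leaves it on a null set, where the value 0 is immaterial.\<close>
  define V where "V x = (if U x \<in> {0<..<1} then M.I (U x) else 0)" for x
  have V [measurable]: "V \<in> borel_measurable P"
  proof -
    have "(\<lambda>u. if u \<in> {0<..<1} then M.I u else 0) \<in> borel_measurable borel"
    proof -
      have "(\<lambda>u. indicator {0<..<1} u *\<^sub>R M.I u) \<in> borel_measurable borel"
        using M.measurable_CI by (subst (asm) borel_measurable_restrict_space_iff) auto
      moreover have "(\<lambda>u. indicator {0<..<1} u *\<^sub>R M.I u) = (\<lambda>u. if u \<in> {0<..<1} then M.I u else 0)"
        by (auto simp: fun_eq_iff)
      ultimately show ?thesis by (simp only:)
    qed
    from measurable_compose[OF U this] show ?thesis by (simp add: V_def[abs_def])
  qed
  have "distr P borel V = M"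
  proof (rule cdf_unique)
    show "real_distribution (distr P borel V)" by (rule P.real_distribution_distr) (rule V)
    show "real_distribution M" by (rule M)
    show "cdf (distr P borel V) = cdf M"
    proof
      fix x
      have "cdf (distr P borel V) x = measure P {p \<in> space P. V p \<le> x}"
        unfolding cdf_def by (subst measure_distr) (auto intro!: arg_cong[where f="measure P"])
      also have "\<dots> = measure P {p \<in> space P. U p \<le> cdf M x}"
      proof (rule P.finite_measure_eq_AE)
        show "AE p in P. (p \<in> {p \<in> space P. V p \<le> x}) = (p \<in> {p \<in> space P. U p \<le> cdf M x})"
          using AE01 by eventually_elim (simp add: V_def M.pseudoinverse[symmetric])
      qed auto
      also have "\<dots> = cdf M x"
      proof -
        consider "cdf M x = 0" | "cdf M x = 1" | "0 < cdf M x" "cdf M x < 1"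
          using M.cdf_nonneg[of x] M.cdf_bounded_prob[of x] by linarith
        then show ?thesis
        proof cases
          case 1 then show ?thesis using U0 by simp
        next
          case 2
          have "{p \<in> space P. U p \<le> 1} = space P" by (auto simp: U_def N.cdf_bounded_prob)
          then show ?thesis using 2 by (simp add: P.prob_space)
        qed (rule Uu)
      qed
      finally show "cdf (distr P borel V) x = cdf M x" .
    qed
  qed
  then show ?thesis using V by blast
qed

theorem atomless_realization:
  fixes P :: "'g::{second_countable_topology, t2_space} measure"
  assumes P: "finite_measure P" "measure P (space P) > 0" and sets: "sets P = sets borel" and atomless: "\<And>x. emeasure P {x} = 0"
    and \<Omega>: "finite_measure \<Omega>" "measure \<Omega> (space \<Omega>) = measure P (space P)" and W: "W \<in> borel_measurable \<Omega>"
  obtains V :: "'g \<Rightarrow> real" where "V \<in> borel_measurable P" "distr P borel V = distr \<Omega> borel W"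
proof -
  define c where "c = measure P (space P)"
  have c: "c > 0" using P(2) by (simp add: c_def)
  define Q where "Q = scale_measure (ennreal (1 / c)) P"
  define \<Omega>' where "\<Omega>' = scale_measure (ennreal (1 / c)) \<Omega>"
  have Q: "prob_space Q" unfolding Q_def c_def by (rule prob_space_normalize[OF P])
  have \<Omega>': "prob_space \<Omega>'" unfolding \<Omega>'_def c_def \<Omega>(2)[symmetric]
    by (rule prob_space_normalize) (use \<Omega> P(2) in auto)
  have W': "W \<in> borel_measurable \<Omega>'" using W by (simp add: \<Omega>'_def measurable_cong_sets[OF sets_scale_measure refl])
  have "real_distribution (distr \<Omega>' borel W)" by (rule prob_space.real_distribution_distr[OF \<Omega>' W'])
  then have "\<exists>V \<in> borel_measurable Q. distr Q borel V = distr \<Omega>' borel W"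
    using sets atomless by (intro atomless_realization_prob Q) (auto simp: Q_def)
  then obtain V where V: "V \<in> borel_measurable Q" "distr Q borel V = distr \<Omega>' borel W" by blast
  have VP: "V \<in> borel_measurable P" using V(1) by (simp add: Q_def measurable_cong_sets[OF sets_scale_measure refl])
  have "distr P borel V = distr (scale_measure (ennreal c) Q) borel V"
    unfolding Q_def scale_measure_normalize[OF c] ..
  also have "\<dots> = scale_measure (ennreal c) (distr \<Omega>' borel W)"
    using V by (simp add: distr_scale_measure)
  also have "\<dots> = distr (scale_measure (ennreal c) \<Omega>') borel W"
    using W' by (simp add: distr_scale_measure)
  also have "\<dots> = distr \<Omega> borel W" unfolding \<Omega>'_def scale_measure_normalize[OF c] ..
  finally show thesis using that VP by blast
qed

section \<open>Coding Lipschitz paths by real numbers\<close>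

text \<open>An increasing bijection of the line onto (0,1), where coordinates have binary
  expansions. The end values 0 and 1 stand for infinity.\<close>

definition squash :: "real \<Rightarrow> real" where "squash x = (1 + x / (1 + \<bar>x\<bar>)) / 2"

definition unsquash :: "real \<Rightarrow> real" where "unsquash y = (2 * y - 1) / (1 - \<bar>2 * y - 1\<bar>)"

lemma squash_bounds: "0 < squash x" "squash x < 1"
proof -
  define w where "w = x / (1 + \<bar>x\<bar>)"
  have "\<bar>w\<bar> < 1" by (simp add: w_def abs_divide divide_less_eq)
  moreover have "squash x = (1 + w) / 2" by (simp add: squash_def w_def)
  ultimately show "0 < squash x" "squash x < 1" by auto
qed

lemma unsquash_squash [simp]: "unsquash (squash x) = x"
proof -
  define w where "w = x / (1 + \<bar>x\<bar>)"
  have "squash x = (1 + w) / 2" by (simp add: squash_def w_def)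
  then have 1: "2 * squash x - 1 = w" by simp
  have "1 - \<bar>w\<bar> = 1 / (1 + \<bar>x\<bar>)" unfolding w_def abs_divide by (simp add: field_simps)
  then show ?thesis unfolding unsquash_def 1 by (simp add: w_def)
qed

lemma unsquash_abs_le:
  assumes "0 < y" "y < 1" "\<bar>unsquash y\<bar> \<le> B"
  shows "\<bar>2 * y - 1\<bar> \<le> B / (1 + B)"
proof -
  let ?u = "\<bar>2 * y - 1\<bar>"
  have u: "0 < 1 - ?u" using assms by linarith
  have B: "0 \<le> B" using assms(3) abs_ge_zero order_trans by blast
  have "?u / (1 - ?u) \<le> B" using assms(3) u by (simp add: unsquash_def abs_divide)
  then have "?u \<le> B * (1 - ?u)" using u by (simp add: divide_le_eq)
  then have "?u * (1 + B) \<le> B" by (simp add: algebra_simps)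
  then show ?thesis using B by (simp add: le_divide_eq)
qed

text \<open>Since the squashed values converge as a whole sequence, a bound at infinitely many
  indices already keeps their limit off the end values, and there \<open>unsquash\<close> is
  continuous.\<close>

lemma unsquash_tendsto:
  assumes y: "y \<longlonglongrightarrow> u" and b: "\<And>k. 0 < y k" "\<And>k. y k < 1"
    and fr: "frequently (\<lambda>k. \<bar>unsquash (y k)\<bar> \<le> B) sequentially"
  shows "(\<lambda>k. unsquash (y k)) \<longlonglongrightarrow> unsquash u"
proof -
  have B: "0 \<le> B"
  proof -
    obtain k where "\<bar>unsquash (y k)\<bar> \<le> B" using frequently_ex[OF fr] by blast
    then show ?thesis by linarith
  qed
  have lim: "(\<lambda>k. \<bar>2 * y k - 1\<bar>) \<longlonglongrightarrow> \<bar>2 * u - 1\<bar>" by (intro tendsto_intros y)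
  have "\<bar>2 * u - 1\<bar> \<le> B / (1 + B)"
  proof (rule ccontr)
    assume "\<not> \<bar>2 * u - 1\<bar> \<le> B / (1 + B)"
    then have "eventually (\<lambda>k. B / (1 + B) < \<bar>2 * y k - 1\<bar>) sequentially"
      by (intro order_tendstoD(1)[OF lim]) simp
    then have "eventually (\<lambda>k. \<not> \<bar>unsquash (y k)\<bar> \<le> B) sequentially"
    proof eventually_elim
      case (elim k)
      show ?case
      proof
        assume "\<bar>unsquash (y k)\<bar> \<le> B"
        from unsquash_abs_le[OF b this] elim show False by simp
      qed
    qed
    then show False using fr by (simp add: frequently_def)
  qed
  also have "\<dots> < 1" using B by (simp add: divide_less_eq)
  finally have "1 - \<bar>2 * u - 1\<bar> \<noteq> 0" by simp
  then show ?thesis unfolding unsquash_def by (intro tendsto_intros y)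
qed

definition grid_rat :: "real \<Rightarrow> nat \<Rightarrow> rat" where
  "grid_rat t n = of_int \<lfloor>real (Suc n) * t\<rfloor> / of_nat (Suc n)"

lemma grid_rat_tendsto: "(\<lambda>n. real_of_rat (grid_rat t n)) \<longlonglongrightarrow> t"
  using floor_div_tendsto[of t] by (simp add: grid_rat_def of_rat_divide del: of_nat_Suc)

abbreviation path_index :: "('b::euclidean_space \<times> rat) set" where
  "path_index \<equiv> Basis \<times> UNIV"

text \<open>Index 0 carries the Lipschitz bound: it enters the cutoff of the discrete energy, so it
  must converge together with the path. The other indices carry the coordinates at rational
  times.\<close>

definition path_data :: "(real \<Rightarrow> 'b::euclidean_space) \<Rightarrow> real \<Rightarrow> nat \<Rightarrow> real" where
  "path_data x l i = (case i of 0 \<Rightarrow> squash l | Suc n \<Rightarrow>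
      (case from_nat_into path_index n of (b, q) \<Rightarrow> squash (x (real_of_rat q) \<bullet> b)))"

definition data_length :: "(nat \<Rightarrow> real) \<Rightarrow> real" where "data_length z = unsquash (z 0)"

definition data_point :: "(nat \<Rightarrow> real) \<Rightarrow> rat \<Rightarrow> 'b::euclidean_space" where
  "data_point z q = (\<Sum>b\<in>Basis. unsquash (z (Suc (to_nat_on path_index (b, q)))) *\<^sub>R b)"

text \<open>Countably many inequalities, hence a measurable condition, that single out the sequences
  from which a Lipschitz path can be rebuilt.\<close>

definition data_lipschitz :: "'b::euclidean_space itself \<Rightarrow> (nat \<Rightarrow> real) \<Rightarrow> bool" where
  "data_lipschitz (T :: 'b itself) z \<longleftrightarrow> 0 \<le> data_length z \<and>
     (\<forall>q q'. norm (data_point z q - data_point z q' :: 'b) \<le> data_length z * \<bar>real_of_rat q - real_of_rat q'\<bar>)"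

text \<open>Other sequences give the zero path, and the bound 0 in \<open>data_bound\<close>, so
  that every real number decodes to a Lipschitz path.\<close>

definition data_path :: "(nat \<Rightarrow> real) \<Rightarrow> real \<Rightarrow> 'b::euclidean_space" where
  "data_path z t = (if data_lipschitz TYPE('b) z then lim (\<lambda>n. data_point z (grid_rat t n)) else 0)"

definition data_bound :: "'b::euclidean_space itself \<Rightarrow> (nat \<Rightarrow> real) \<Rightarrow> real" where
  "data_bound T z = (if data_lipschitz T z then data_length z else 0)"

lemma countable_path_index: "countable (path_index :: ('b::euclidean_space \<times> rat) set)"
  by (intro countable_SIGMA countable_finite[OF finite_Basis]) auto

lemma path_data_bounds: "0 < path_data x l i" "path_data x l i < 1"
  by (auto simp: path_data_def squash_bounds split: nat.splits prod.splits)

lemma data_length_path_data: "data_length (path_data x l) = l"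
  by (simp add: data_length_def path_data_def)

lemma data_point_inner:
  assumes "b \<in> Basis"
  shows "data_point z q \<bullet> b = unsquash (z (Suc (to_nat_on (path_index :: ('b::euclidean_space \<times> rat) set) (b, q))))"
  unfolding data_point_def using assms by (simp add: inner_sum_left inner_Basis if_distrib cong: if_cong)

lemma data_point_path_data: "data_point (path_data x l) q = (x (real_of_rat q) :: 'b::euclidean_space)"
proof (rule euclidean_eqI)
  fix b :: 'b assume b: "b \<in> Basis"
  have "from_nat_into path_index (to_nat_on path_index (b, q)) = (b, q)"
    by (rule from_nat_into_to_nat_on[OF countable_path_index]) (use b in auto)
  then show "data_point (path_data x l) q \<bullet> b = x (real_of_rat q) \<bullet> b"
    unfolding data_point_inner[OF b] by (simp add: path_data_def)
qed

lemma data_path_eqI: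
  fixes x :: "real \<Rightarrow> 'b::euclidean_space"
  assumes l: "0 \<le> l" "data_length z = l" and x: "\<And>s t. norm (x s - x t) \<le> l * \<bar>s - t\<bar>"
    and pt: "\<And>q. data_point z q = x (real_of_rat q)"
  shows "data_lipschitz TYPE('b) z" "data_path z = x"
proof -
  show good: "data_lipschitz TYPE('b) z" using assms by (simp add: data_lipschitz_def)
  show "data_path z = x"
  proof
    fix t
    have "l-lipschitz_on UNIV x" using x l by (auto intro!: lipschitz_onI simp: dist_norm)
    then have "continuous_on UNIV x" by (rule lipschitz_on_continuous_on)
    then have "(\<lambda>n. x (real_of_rat (grid_rat t n))) \<longlonglongrightarrow> x t"
      by (rule continuous_on_tendsto_compose[OF _ grid_rat_tendsto]) auto
    then show "data_path z t = x t" using good by (simp add: data_path_def pt limI)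
  qed
qed

lemma data_path_path_data:
  fixes x :: "real \<Rightarrow> 'b::euclidean_space"
  assumes "0 \<le> l" "\<And>s t. norm (x s - x t) \<le> l * \<bar>s - t\<bar>"
  shows "data_path (path_data x l) = x" "data_bound TYPE('b) (path_data x l) = l"
    "data_lipschitz TYPE('b) (path_data x l)"
  using data_path_eqI[of l "path_data x l" x] assms
  by (auto simp: data_length_path_data data_point_path_data data_bound_def)

lemma data_path_tendsto:
  assumes "data_lipschitz TYPE('b::euclidean_space) z"
  shows "(\<lambda>n. data_point z (grid_rat t n)) \<longlonglongrightarrow> (data_path z t :: 'b)"
proof -
  have "Cauchy (\<lambda>n. data_point z (grid_rat t n) :: 'b)"
  proof (rule metric_CauchyI)
    fix e :: real assume e: "e > 0"
    define l where "l = data_length z + 1"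
    have l: "0 < l" using assms by (simp add: l_def data_lipschitz_def)
    have "Cauchy (\<lambda>n. real_of_rat (grid_rat t n))" using grid_rat_tendsto by (rule LIMSEQ_imp_Cauchy)
    then obtain M where M: "\<And>m n. m \<ge> M \<Longrightarrow> n \<ge> M \<Longrightarrow> dist (real_of_rat (grid_rat t m)) (real_of_rat (grid_rat t n)) < e / l"
      using e l by (meson metric_CauchyD divide_pos_pos)
    have "dist (data_point z (grid_rat t m)) (data_point z (grid_rat t n) :: 'b) < e" if "m \<ge> M" "n \<ge> M" for m n
    proof -
      have "dist (data_point z (grid_rat t m)) (data_point z (grid_rat t n) :: 'b) \<le> data_length z * \<bar>real_of_rat (grid_rat t m) - real_of_rat (grid_rat t n)\<bar>"
        using assms by (simp add: data_lipschitz_def dist_norm)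
      also have "\<dots> \<le> l * \<bar>real_of_rat (grid_rat t m) - real_of_rat (grid_rat t n)\<bar>"
        by (intro mult_right_mono) (auto simp: l_def)
      also have "\<dots> < e" using M[OF that] l by (simp add: dist_real_def pos_less_divide_eq mult.commute)
      finally show ?thesis .
    qed
    then show "\<exists>M. \<forall>m\<ge>M. \<forall>n\<ge>M. dist (data_point z (grid_rat t m)) (data_point z (grid_rat t n) :: 'b) < e" by blast
  qed
  then have "convergent (\<lambda>n. data_point z (grid_rat t n) :: 'b)" by (rule Cauchy_convergent)
  then show ?thesis using assms by (simp add: data_path_def convergent_LIMSEQ_iff)
qed

lemma data_bound_nonneg: "0 \<le> data_bound T z"
  by (simp add: data_bound_def data_lipschitz_def)

lemma data_path_lipschitz:
  "norm (data_path z s - data_path z t :: 'b::euclidean_space) \<le> data_bound TYPE('b) z * \<bar>s - t\<bar>"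
proof (cases "data_lipschitz TYPE('b) z")
  case True
  have "norm (data_path z s - data_path z t :: 'b) \<le> data_length z * \<bar>s - t\<bar>"
  proof (rule LIMSEQ_le)
    show "(\<lambda>n. norm (data_point z (grid_rat s n) - data_point z (grid_rat t n) :: 'b)) \<longlonglongrightarrow> norm (data_path z s - data_path z t :: 'b)"
      by (intro tendsto_intros data_path_tendsto True)
    show "(\<lambda>n. data_length z * \<bar>real_of_rat (grid_rat s n) - real_of_rat (grid_rat t n)\<bar>) \<longlonglongrightarrow> data_length z * \<bar>s - t\<bar>"
      by (intro tendsto_intros grid_rat_tendsto)
    show "\<exists>N. \<forall>n\<ge>N. norm (data_point z (grid_rat s n) - data_point z (grid_rat t n) :: 'b) \<le> data_length z * \<bar>real_of_rat (grid_rat s n) - real_of_rat (grid_rat t n)\<bar>"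
      using True by (auto simp: data_lipschitz_def)
  qed
  then show ?thesis using True by (simp add: data_bound_def)
qed (simp add: data_path_def data_bound_def)

lemma data_path_rat:
  assumes "data_lipschitz TYPE('b::euclidean_space) z"
  shows "data_path z (real_of_rat q) = (data_point z q :: 'b)"
proof -
  have "(\<lambda>n. data_point z (grid_rat (real_of_rat q) n) :: 'b) \<longlonglongrightarrow> data_point z q"
  proof (rule LIM_zero_cancel, rule tendsto_norm_zero_cancel)
    have lim: "(\<lambda>n. data_length z * \<bar>real_of_rat (grid_rat (real_of_rat q) n) - real_of_rat q\<bar>) \<longlonglongrightarrow> data_length z * \<bar>real_of_rat q - real_of_rat q\<bar>"
      by (intro tendsto_intros grid_rat_tendsto)
    show "(\<lambda>n. norm (data_point z (grid_rat (real_of_rat q) n) - data_point z q :: 'b)) \<longlonglongrightarrow> 0"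
      by (rule tendsto_sandwich[OF _ _ tendsto_const])
         (use lim assms in \<open>auto simp: data_lipschitz_def\<close>)
  qed
  then show ?thesis using LIMSEQ_unique data_path_tendsto[OF assms] by blast
qed

text \<open>The finite lower limit makes the lengths converge, hence bounded. Together with the
  bound \<open>R\<close> at time 0 this bounds the positions at each rational time, so these
  converge after unsquashing as well. The Lipschitz inequalities pass to the limit and carry
  convergence to all times.\<close>

lemma data_convergence:
  fixes z :: "nat \<Rightarrow> nat \<Rightarrow> real"
  assumes lim: "\<And>i. (\<lambda>k. z k i) \<longlonglongrightarrow> z' i" and b: "\<And>k i. 0 < z k i" "\<And>k i. z k i < 1"
    and good: "\<And>k. data_lipschitz TYPE('b::euclidean_space) (z k)"
    and R: "\<And>k. norm (data_path (z k) 0 :: 'b) \<le> R"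
    and fin: "liminf (\<lambda>k. ennreal (data_bound TYPE('b) (z k))) < \<infinity>"
  shows "(\<lambda>k. data_path (z k) t :: 'b) \<longlonglongrightarrow> data_path z' t"
    "(\<lambda>k. data_bound TYPE('b) (z k)) \<longlonglongrightarrow> data_bound TYPE('b) z'"
proof -
  have bl: "data_bound TYPE('b) (z k) = data_length (z k)" for k using good by (simp add: data_bound_def)
  have l0: "0 \<le> data_length (z k)" for k using good by (simp add: data_lipschitz_def)
  obtain B where B: "0 \<le> B" "liminf (\<lambda>k. ennreal (data_length (z k))) < ennreal B"
  proof -
    obtain c where "liminf (\<lambda>k. ennreal (data_length (z k))) = ennreal c" "0 \<le> c"
      using fin unfolding bl by (metis ennreal_cases infinity_ennreal_def less_irrefl)
    then show thesis using that[of "c + 1"] by (simp add: ennreal_less_iff)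
  qed
  have "frequently (\<lambda>k. \<bar>unsquash (z k 0)\<bar> \<le> B) sequentially"
  proof (rule ccontr)
    assume "\<not> frequently (\<lambda>k. \<bar>unsquash (z k 0)\<bar> \<le> B) sequentially"
    then have "eventually (\<lambda>k. ennreal B \<le> ennreal (data_length (z k))) sequentially"
      unfolding not_frequently
      by eventually_elim (use l0 in \<open>auto simp: data_length_def intro!: ennreal_leI\<close>)
    then have "ennreal B \<le> liminf (\<lambda>k. ennreal (data_length (z k)))" by (rule Liminf_bounded)
    then show False using B by simp
  qed
  from unsquash_tendsto[OF lim b this]
  have len: "(\<lambda>k. data_length (z k)) \<longlonglongrightarrow> data_length z'" unfolding data_length_def .
  then obtain C where C: "\<And>k. data_length (z k) \<le> C"
    using convergent_imp_Bseq[OF convergentI[OF len]] unfolding Bseq_def by (metis abs_le_D1 real_norm_def)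
  have pt: "(\<lambda>k. data_point (z k) q :: 'b) \<longlonglongrightarrow> data_point z' q" for q
    unfolding data_point_def
  proof (intro tendsto_sum tendsto_scaleR tendsto_const)
    fix e :: 'b assume e: "e \<in> Basis"
    show "(\<lambda>k. unsquash (z k (Suc (to_nat_on path_index (e, q))))) \<longlonglongrightarrow> unsquash (z' (Suc (to_nat_on path_index (e, q))))"
    proof (rule unsquash_tendsto[OF lim b])
      have "\<bar>unsquash (z k (Suc (to_nat_on path_index (e, q))))\<bar> \<le> R + C * \<bar>real_of_rat q\<bar>" for k
      proof -
        have "\<bar>data_point (z k) q \<bullet> e\<bar> \<le> norm (data_point (z k) q :: 'b)"
          using Basis_le_norm[OF e] by simp
        also have "\<dots> = norm (data_path (z k) (real_of_rat q) :: 'b)" by (simp add: data_path_rat[OF good])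
        also have "\<dots> \<le> norm (data_path (z k) 0 :: 'b) + norm (data_path (z k) (real_of_rat q) - data_path (z k) 0 :: 'b)"
          using norm_triangle_ineq[of "data_path (z k) 0 :: 'b" "data_path (z k) (real_of_rat q) - data_path (z k) 0"] by simp
        also have "\<dots> \<le> R + data_bound TYPE('b) (z k) * \<bar>real_of_rat q - 0\<bar>"
          by (intro add_mono R data_path_lipschitz)
        also have "\<dots> \<le> R + C * \<bar>real_of_rat q\<bar>" unfolding bl using C by (auto intro: mult_right_mono)
        finally show ?thesis unfolding data_point_inner[OF e] .
      qed
      then show "frequently (\<lambda>k. \<bar>unsquash (z k (Suc (to_nat_on path_index (e, q))))\<bar> \<le> R + C * \<bar>real_of_rat q\<bar>) sequentially"
        by (intro eventually_frequently) auto
    qed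
  qed
  have good': "data_lipschitz TYPE('b) z'"
    unfolding data_lipschitz_def
  proof (intro conjI allI)
    show "0 \<le> data_length z'" by (rule LIMSEQ_le_const[OF len]) (use l0 in auto)
    fix q q'
    show "norm (data_point z' q - data_point z' q' :: 'b) \<le> data_length z' * \<bar>real_of_rat q - real_of_rat q'\<bar>"
      by (rule LIMSEQ_le[OF tendsto_norm[OF tendsto_diff[OF pt pt]] tendsto_mult[OF len tendsto_const]])
         (use good in \<open>auto simp: data_lipschitz_def\<close>)
  qed
  then have bl': "data_bound TYPE('b) z' = data_length z'" by (simp add: data_bound_def)
  show "(\<lambda>k. data_bound TYPE('b) (z k)) \<longlonglongrightarrow> data_bound TYPE('b) z'" unfolding bl bl' by (rule len)
  show "(\<lambda>k. data_path (z k) t :: 'b) \<longlonglongrightarrow> data_path z' t"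
  proof (rule LIMSEQ_I)
    fix e :: real assume e: "e > 0"
    define l where "l = data_length z'"
    have l: "0 \<le> l" using good' by (simp add: l_def data_lipschitz_def)
    \<comment> \<open>The rational \<open>q\<close> is so near \<open>t\<close> that moving from
      \<open>t\<close> to \<open>q\<close> on the approximating paths and back on the limit path
      costs about \<open>2 * (l * h)\<close>, which is below \<open>e\<close>.\<close>
    have "t < t + e / (4 * l + 1)" using e l by (simp add: add_nonneg_pos)
    from of_rat_dense[OF this] obtain q where q: "t < real_of_rat q" "real_of_rat q < t + e / (4 * l + 1)" by blast
    define h where "h = \<bar>t - real_of_rat q\<bar>"
    have "h < e / (4 * l + 1)" using q by (simp add: h_def)
    then have "h * (4 * l + 1) < e" using l by (simp add: pos_less_divide_eq)
    moreover have "h * (4 * l + 1) = 4 * (l * h) + h" by (simp add: algebra_simps)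
    moreover have "0 \<le> h" "0 \<le> l * h" using l by (simp_all add: h_def)
    ultimately have h: "2 * (l * h) < e" by linarith
    have bound: "norm (data_path (z k) t - data_path z' t :: 'b) \<le> data_length (z k) * h + norm (data_point (z k) q - data_point z' q :: 'b) + l * h" for k
    proof -
      have "norm (data_path (z k) t - data_path (z k) (real_of_rat q) :: 'b) \<le> data_length (z k) * h"
        using data_path_lipschitz[where 'b='b, of "z k" t "real_of_rat q"] by (simp add: bl h_def)
      moreover have "norm (data_path z' (real_of_rat q) - data_path z' t :: 'b) \<le> l * h"
        using data_path_lipschitz[where 'b='b, of z' "real_of_rat q" t] by (simp add: bl' h_def l_def abs_minus_commute)
      moreover have "norm (data_path (z k) t - data_path z' t :: 'b) \<le> norm (data_path (z k) t - data_path (z k) (real_of_rat q) :: 'b) +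
          norm (data_point (z k) q - data_point z' q :: 'b) + norm (data_path z' (real_of_rat q) - data_path z' t :: 'b)"
      proof -
        have "data_path (z k) t - data_path z' t = (data_path (z k) t - data_path (z k) (real_of_rat q)) +
          (data_point (z k) q - data_point z' q) + (data_path z' (real_of_rat q) - data_path z' t :: 'b)"
          by (simp add: data_path_rat good good')
        then show ?thesis
          by (simp only:) (rule norm_triangle_le, rule add_right_mono, rule norm_triangle_ineq)
      qed
      ultimately show ?thesis by linarith
    qed
    have "(\<lambda>k. data_length (z k) * h + norm (data_point (z k) q - data_point z' q :: 'b) + l * h) \<longlonglongrightarrow>
        data_length z' * h + norm (data_point z' q - data_point z' q :: 'b) + l * h"
      by (intro tendsto_intros len pt)
    then have "eventually (\<lambda>k. data_length (z k) * h + norm (data_point (z k) q - data_point z' q :: 'b) + l * h < e) sequentially"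
      by (rule order_tendstoD(2)) (use h in \<open>simp add: l_def[symmetric] mult.commute[of h]\<close>)
    then show "\<exists>n0. \<forall>n\<ge>n0. norm (data_path (z n) t - data_path z' t :: 'b) < e"
      unfolding eventually_sequentially using bound by (meson le_less_trans)
  qed
qed

lemma measurable_data_length [measurable]:
  assumes [measurable]: "\<And>i. (\<lambda>x. z x i) \<in> borel_measurable M"
  shows "(\<lambda>x. data_length (z x)) \<in> borel_measurable M"
  unfolding data_length_def unsquash_def by measurable

lemma measurable_data_point [measurable]:
  assumes [measurable]: "\<And>i. (\<lambda>x. z x i) \<in> borel_measurable M"
  shows "(\<lambda>x. data_point (z x) q :: 'b::euclidean_space) \<in> borel_measurable M"
  unfolding data_point_def unsquash_def by measurable

lemma pred_data_lipschitz [measurable]: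
  assumes [measurable]: "\<And>i. (\<lambda>x. z x i) \<in> borel_measurable M"
  shows "Measurable.pred M (\<lambda>x. data_lipschitz TYPE('b::euclidean_space) (z x))"
  unfolding data_lipschitz_def by measurable

lemma measurable_data_path [measurable]:
  assumes [measurable]: "\<And>i. (\<lambda>x. z x i) \<in> borel_measurable M"
  shows "(\<lambda>x. data_path (z x) t :: 'b::euclidean_space) \<in> borel_measurable M"
proof -
  have [measurable]: "(\<lambda>x. lim (\<lambda>n. data_point (z x) (grid_rat t n)) :: 'b) \<in> borel_measurable M"
    by (intro borel_measurable_lim_metric) measurable
  show ?thesis unfolding data_path_def by measurable
qed

lemma measurable_data_bound [measurable]:
  assumes [measurable]: "\<And>i. (\<lambda>x. z x i) \<in> borel_measurable M"
  shows "(\<lambda>x. data_bound TYPE('b::euclidean_space) (z x)) \<in> borel_measurable M"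
  unfolding data_bound_def by measurable

lemma lipschitz_paths_data_path:
  assumes "finite_measure M" and [measurable]: "\<And>i. (\<lambda>x. z x i) \<in> borel_measurable M"
  shows "lipschitz_paths M (\<lambda>x. data_path (z x) :: real \<Rightarrow> 'b::euclidean_space) (\<lambda>x. data_bound TYPE('b) (z x))"
proof -
  interpret finite_measure M by fact
  show ?thesis
    by standard (auto intro: data_bound_nonneg data_path_lipschitz)
qed

text \<open>The energy depends on the law of the paths only: the tube masses, too, are masses of
  sets of paths under the image measure.\<close>

lemma discrete_energy_distr:
  assumes \<tau>: "transportation_cost \<tau>" and W: "W \<in> M \<rightarrow>\<^sub>M N" and M: "finite_measure M"
    and X: "lipschitz_paths (distr M N W) X L"
  shows "discrete_energy \<tau> (distr M N W) X L n d = discrete_energy \<tau> M (\<lambda>x. X (W x)) (\<lambda>x. L (W x)) n d"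
proof -
  interpret X: lipschitz_paths "distr M N W" X L by (rule X)
  note borel_measurable_r_tau[OF \<tau>, measurable]
  have tube: "measure (distr M N W) (tube (distr M N W) X d x) = measure M (tube M (\<lambda>x. X (W x)) d x)" for x
  proof -
    have "tube (distr M N W) X d x \<in> sets N" using X.sets_tube by simp
    then have "measure (distr M N W) (tube (distr M N W) X d x) = measure M (W -` tube (distr M N W) X d x \<inter> space M)"
      by (rule measure_distr[OF W])
    also have "W -` tube (distr M N W) X d x \<inter> space M = tube M (\<lambda>x. X (W x)) d x"
      using measurable_space[OF W] by (auto simp: tube_def)
    finally show ?thesis .
  qed
  define F where "F p = (if L p < d * real n then \<Sum>i<n. r_tau \<tau> (measure (distr M N W) (tube (distr M N W) X d (X p (real i / real n)))) *
        ennreal (norm (X p (real (Suc i) / real n) - X p (real i / real n))) else 0)" for p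
  have "F \<in> borel_measurable (distr M N W)" unfolding F_def by measurable
  then have "(\<integral>\<^sup>+p. F p \<partial>distr M N W) = (\<integral>\<^sup>+x. F (W x) \<partial>M)" by (intro nn_integral_distr W) simp
  then show ?thesis unfolding F_def discrete_energy_def tube .
qed

text \<open>Fatou's lemma for indicators of open sets bounds the limit law by \<open>N\<close> on
  open sets, and outer regularity on all Borel sets. Equal total masses, compared on a set and its
  complement, force equality.\<close>

lemma distr_eq_of_AE_limit:
  fixes f :: "nat \<Rightarrow> 'a \<Rightarrow> 'b::euclidean_space"
  assumes M: "finite_measure M" and f [measurable]: "\<And>k. f k \<in> borel_measurable M" and g [measurable]: "g \<in> borel_measurable M"
    and lim: "AE x in M. (\<lambda>k. f k x) \<longlonglongrightarrow> g x" and law: "\<And>k. distr M borel (f k) = N"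
  shows "distr M borel g = N"
proof -
  interpret M: finite_measure M by (rule M)
  have setsN: "sets N = sets borel" using law[of 0] by auto
  have totN: "emeasure N UNIV = emeasure M (space M)" using law[of 0] by (auto simp: emeasure_distr)
  have totg: "emeasure (distr M borel g) UNIV = emeasure M (space M)" by (simp add: emeasure_distr)
  have open_le: "emeasure (distr M borel g) U \<le> emeasure N U" if U: "open U" for U
  proof -
    have [measurable]: "U \<in> sets borel" using U by simp
    have "emeasure (distr M borel g) U = (\<integral>\<^sup>+x. indicator U (g x) \<partial>M)"
    proof -
      have "emeasure (distr M borel g) U = (\<integral>\<^sup>+y. indicator U y \<partial>distr M borel g)" using U by simp
      also have "\<dots> = (\<integral>\<^sup>+x. indicator U (g x) \<partial>M)" using U by (subst nn_integral_distr) auto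
      finally show ?thesis .
    qed
    also have "\<dots> \<le> (\<integral>\<^sup>+x. liminf (\<lambda>k. indicator U (f k x)) \<partial>M)"
    proof (rule nn_integral_mono_AE)
      show "AE x in M. indicator U (g x) \<le> liminf (\<lambda>k. indicator U (f k x) :: ennreal)"
        using lim
      proof eventually_elim
        case (elim x)
        show ?case
        proof (cases "g x \<in> U")
          case True
          then have "eventually (\<lambda>k. f k x \<in> U) sequentially" using topological_tendstoD[OF elim U] by blast
          then have "eventually (\<lambda>k. (1::ennreal) \<le> indicator U (f k x)) sequentially" by eventually_elim simp
          then show ?thesis using True by (simp add: Liminf_bounded)
        qed simp
      qed
    qed
    also have "\<dots> \<le> liminf (\<lambda>k. \<integral>\<^sup>+x. indicator U (f k x) \<partial>M)"
      by (rule nn_integral_liminf) measurable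
    also have "(\<lambda>k. \<integral>\<^sup>+x. indicator U (f k x) \<partial>M) = (\<lambda>k. emeasure N U)"
    proof
      fix k
      have "emeasure N U = (\<integral>\<^sup>+y. indicator U y \<partial>distr M borel (f k))" unfolding law using U setsN by simp
      also have "\<dots> = (\<integral>\<^sup>+x. indicator U (f k x) \<partial>M)" using U by (subst nn_integral_distr) auto
      finally show "(\<integral>\<^sup>+x. indicator U (f k x) \<partial>M) = emeasure N U" by simp
    qed
    finally show ?thesis by (simp add: Liminf_const)
  qed
  have fin: "emeasure N UNIV \<noteq> \<infinity>" "emeasure (distr M borel g) UNIV \<noteq> \<infinity>"
    unfolding totN totg by simp_all
  have le: "emeasure (distr M borel g) A \<le> emeasure N A" if A: "A \<in> sets borel" for A
  proof -
    have "emeasure (distr M borel g) A \<le> (INF U \<in> {U. A \<subseteq> U \<and> open U}. emeasure N U)"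
    proof (rule INF_greatest)
      fix U assume U: "U \<in> {U. A \<subseteq> U \<and> open U}"
      then have "emeasure (distr M borel g) A \<le> emeasure (distr M borel g) U" by (intro emeasure_mono) auto
      also have "\<dots> \<le> emeasure N U" using U open_le by blast
      finally show "emeasure (distr M borel g) A \<le> emeasure N U" .
    qed
    also have "\<dots> = emeasure N A"
      by (rule outer_regular[symmetric]) (use setsN fin A sets_eq_imp_space_eq[OF setsN] in auto)
    finally show ?thesis .
  qed
  show ?thesis
  proof (rule measure_eqI)
    fix A assume "A \<in> sets (distr M borel g)"
    then have A [measurable]: "A \<in> sets borel" by simp
    have "emeasure N A + emeasure N (- A) = emeasure N UNIV"
      using plus_emeasure[of A N "- A"] setsN by (simp add: Compl_partition)
    moreover have "emeasure (distr M borel g) A + emeasure (distr M borel g) (- A) = emeasure (distr M borel g) UNIV"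
      using plus_emeasure[of A "distr M borel g" "- A"] by (simp add: Compl_partition)
    ultimately have eq: "emeasure (distr M borel g) A + emeasure (distr M borel g) (- A) = emeasure N A + emeasure N (- A)"
      unfolding totN totg by simp
    have "emeasure N A \<le> emeasure (distr M borel g) A"
    proof (rule ccontr)
      assume "\<not> emeasure N A \<le> emeasure (distr M borel g) A"
      then have "emeasure (distr M borel g) A < emeasure N A" by simp
      moreover have "emeasure (distr M borel g) (- A) \<le> emeasure N (- A)" by (rule le) simp
      moreover have "emeasure N (- A) < \<infinity>"
        using emeasure_mono[of "- A" UNIV N] setsN fin(1) by (simp add: less_top[symmetric] top.extremum_unique) (metis top.extremum_unique)
      ultimately have "emeasure (distr M borel g) A + emeasure (distr M borel g) (- A) < emeasure N A + emeasure N (- A)"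
      proof -
        assume a: "emeasure (distr M borel g) A < emeasure N A" and b: "emeasure (distr M borel g) (- A) \<le> emeasure N (- A)"
          and c: "emeasure N (- A) < \<infinity>"
        have "emeasure (distr M borel g) A + emeasure (distr M borel g) (- A) \<le> emeasure N (- A) + emeasure (distr M borel g) A"
          using b by (subst add.commute) (rule add_right_mono)
        also have "\<dots> < emeasure N (- A) + emeasure N A" using a c by (simp add: ennreal_add_left_cancel_less)
        finally show ?thesis by (simp only: add.commute)
      qed
      then show False using eq by simp
    qed
    then show "emeasure (distr M borel g) A = emeasure N A" using le[OF A] by simp
  qed (simp add: setsN)
qed

section \<open>Existence of optimal patterns\<close>

text \<open>Collects the properties of the arc length parametrization on which compactness
  rests.\<close>

lemma reparametrization:
  assumes P: "finite_measure P" and mass: "0 < measure P (space P)"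
    and \<tau>: "transportation_cost \<tau>" "concave_on {0..} \<tau>"
    and chi: "irrigation_pattern P chi" and J: "J_tau \<tau> P chi < \<infinity>"
  shows "\<exists>X L. lipschitz_paths P X L \<and> (AE p in P. X p 0 = chi p 0 \<and> X p 1 = chi p 1) \<and>
    r_tau \<tau> (measure P (space P)) * (\<integral>\<^sup>+p. ennreal (L p) \<partial>P) \<le> J_tau \<tau> P chi \<and>
    (\<forall>N d. discrete_energy \<tau> P X L (Suc N) d \<le> J_tau \<tau> P chi)"
proof -
  interpret finite_measure P by (rule P)
  have "AE p in P. abs_cont_on_I (chi p)" using chi by (simp add: irrigation_pattern_def)
  then obtain B where B: "{p \<in> space P. \<not> abs_cont_on_I (chi p)} \<subseteq> B" "emeasure P B = 0" "B \<in> sets P"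
    by (rule AE_E)
  interpret irrigation P chi B
    by standard (use chi B in \<open>auto simp: irrigation_pattern_def null_sets_def\<close>)
  show ?thesis
  proof (intro exI conjI allI)
    show "lipschitz_paths P X (\<lambda>p. len p 1)" by (rule lipschitz_X)
    show "AE p in P. X p 0 = chi p 0 \<and> X p 1 = chi p 1"
      using AE_good[OF \<tau> mass J] by eventually_elim (simp add: X_endpoints)
    show "r_tau \<tau> (measure P (space P)) * (\<integral>\<^sup>+p. ennreal (len p 1) \<partial>P) \<le> J_tau \<tau> P chi"
      by (rule integral_len_le[OF \<tau> mass J])
    show "discrete_energy \<tau> P X (\<lambda>p. len p 1) (Suc N) d \<le> J_tau \<tau> P chi" for N d
      by (rule discrete_energy_le_J_tau[OF \<tau> mass J])
  qed
qed

lemma irrigation_pattern_measurable_at: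
  assumes "irrigation_pattern P chi" "t \<in> {0..1}"
  shows "(\<lambda>p. chi p t) \<in> borel_measurable P"
proof -
  have "t \<in> space I_measure" using assms(2) by (simp add: space_restrict_space)
  then have "(\<lambda>p. (p, t)) \<in> P \<rightarrow>\<^sub>M P \<Otimes>\<^sub>M I_measure" by simp
  moreover have "(\<lambda>(p, t). chi p t) \<in> borel_measurable (P \<Otimes>\<^sub>M I_measure)"
    using assms(1) by (simp add: irrigation_pattern_def)
  ultimately have "(\<lambda>p. (\<lambda>(p, t). chi p t) (p, t)) \<in> borel_measurable P" by (rule measurable_compose)
  then show ?thesis by simp
qed

lemma measurable_path_data:
  assumes "lipschitz_paths P X L"
  shows "(\<lambda>p. path_data (X p) (L p) i) \<in> borel_measurable P"
proof -
  interpret lipschitz_paths P X L by (rule assms)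
  show ?thesis
  proof (cases i)
    case 0
    then show ?thesis by (simp add: path_data_def squash_def)
  next
    case (Suc n)
    then show ?thesis by (simp add: path_data_def squash_def split: prod.split)
  qed
qed

text \<open>Convergence takes place on \<Omega>, while the patterns live on \<open>P\<close>. Codes
  connect the two: \<open>PX\<close> and \<open>PL\<close> read a path and its bound off a real
  number, so only laws of real variables have to be moved between the spaces.\<close>

theorem irrigation_pattern_compactness:
  fixes P :: "'g::polish_space measure" and chi :: "nat \<Rightarrow> 'g \<Rightarrow> real \<Rightarrow> 'b::euclidean_space"
  assumes P: "reference_measure P"
    and \<tau>: "transportation_cost \<tau>" "concave_on {0..} \<tau>"
    and \<mu>p: "finite_borel_bounded_support \<mu>p"
    and chi: "\<And>k. irrigation_pattern P (chi k)"
    and marg: "\<And>k. mu_plus P (chi k) = \<mu>p" "\<And>k. mu_minus P (chi k) = \<mu>m"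
    and J: "\<And>k. J_tau \<tau> P (chi k) \<le> C k" and C: "C \<longlonglongrightarrow> C0" "\<And>k. C k \<le> C1" "C1 < \<infinity>"
  obtains chi' where "irrigation_pattern P chi'" "mu_plus P chi' = \<mu>p" "mu_minus P chi' = \<mu>m" "J_tau \<tau> P chi' \<le> C0"
proof -
  have fin: "finite_measure P" and setsP: "sets P = sets borel" and atomless: "\<And>x. emeasure P {x} = 0"
    and spaceP: "space P = UNIV" and ne: "emeasure P UNIV \<noteq> 0"
    using P by (auto simp: reference_measure_def)
  interpret P: finite_measure P by (rule fin)
  define m where "m = measure P (space P)"
  have mass: "0 < measure P (space P)"
    using ne by (simp add: spaceP P.emeasure_eq_measure zero_less_measure_iff)
  then have m: "0 < m" by (simp add: m_def)
  have Jfin: "J_tau \<tau> P (chi k) < \<infinity>" for k using J[of k] C(2)[of k] C(3) by (meson le_less_trans order_trans)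
  define good where "good k X L \<longleftrightarrow> lipschitz_paths P X L \<and> (AE p in P. X p 0 = chi k p 0 \<and> X p 1 = chi k p 1) \<and>
    r_tau \<tau> m * (\<integral>\<^sup>+p. ennreal (L p) \<partial>P) \<le> J_tau \<tau> P (chi k) \<and>
    (\<forall>N d. discrete_energy \<tau> P X L (Suc N) d \<le> J_tau \<tau> P (chi k))" for k X L
  have "\<forall>k. \<exists>X L. good k X L"
    unfolding good_def m_def using reparametrization[OF fin mass \<tau> chi Jfin] by blast
  then obtain X L where XL: "\<And>k. good k (X k) (L k)" by metis
  have LP: "lipschitz_paths P (X k) (L k)" for k using XL by (simp add: good_def)
  define e where "e k p = encode (path_data (X k p) (L k p))" for k p
  have e_meas: "e k \<in> borel_measurable P" for k
    unfolding e_def by (rule measurable_encode) (rule measurable_path_data[OF LP])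
  define PX where "PX y = (data_path (decode y) :: real \<Rightarrow> 'b)" for y
  define PL where "PL y = data_bound TYPE('b) (decode y)" for y
  have dec: "decode (e k p) = path_data (X k p) (L k p)" for k p
    unfolding e_def by (rule ext, rule decode_encode) (auto simp: path_data_bounds less_imp_le)
  have XeL: "PX (e k p) = X k p" "PL (e k p) = L k p" "data_lipschitz TYPE('b) (decode (e k p))" for k p
    unfolding PX_def PL_def dec
    using data_path_path_data[of "L k p" "X k p"] lipschitz_paths.L_nonneg[OF LP] lipschitz_paths.lipschitz[OF LP] by auto
  have LPM: "lipschitz_paths M (\<lambda>x. PX (f x)) (\<lambda>x. PL (f x))" if "finite_measure M" "f \<in> borel_measurable M" for M :: "'g measure" and f
    unfolding PX_def PL_def
    by (rule lipschitz_paths_data_path[OF that(1)]) (rule measurable_compose[OF that(2) measurable_decode])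
  have LPR: "lipschitz_paths M (\<lambda>x. PX (f x)) (\<lambda>x. PL (f x))" if "finite_measure M" "f \<in> borel_measurable M" for M :: "real measure" and f
    unfolding PX_def PL_def
    by (rule lipschitz_paths_data_path[OF that(1)]) (rule measurable_compose[OF that(2) measurable_decode])
  have LPD: "lipschitz_paths M PX PL" if "finite_measure M" "sets M = sets borel" for M :: "real measure"
    using LPR[of M "\<lambda>x. x"] that by (simp add: measurable_cong_sets[OF that(2) refl])
  have PX_meas [measurable]: "(\<lambda>y. PX y t) \<in> borel_measurable borel" for t
    unfolding PX_def by (rule measurable_data_path) measurable
  have PL_meas [measurable]: "PL \<in> borel_measurable borel"
    unfolding PL_def by (rule measurable_data_bound) measurable
  obtain s :: "nat \<Rightarrow> nat" and \<Omega> :: "real measure" and W W' where s: "strict_mono s" and \<Omega>: "finite_measure \<Omega>" "measure \<Omega> (space \<Omega>) = measure P (space P)"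
    and W: "\<And>k. W k \<in> borel_measurable \<Omega>" "W' \<in> borel_measurable \<Omega>"
    and law0: "\<And>k. distr \<Omega> borel (W k) = distr P borel (\<lambda>p. encode (path_data (X (s k) p) (L (s k) p)))"
    and conv: "AE w in \<Omega>. \<forall>i. (\<lambda>k. decode (W k w) i) \<longlonglongrightarrow> decode (W' w) i"
    by (rule random_sequence_selection[where Z="\<lambda>k p. path_data (X k p) (L k p)", OF fin mass measurable_path_data[OF LP]])
       (rule that; assumption)
  have law: "distr \<Omega> borel (W k) = distr P borel (e (s k))" for k using law0 by (simp add: e_def[abs_def])
  interpret \<Omega>: finite_measure \<Omega> by (rule \<Omega>(1))
  note W(1)[measurable] W(2)[measurable] e_meas[measurable]
  \<comment> \<open>Almost sure Borel properties of the original codes hold for their copies,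
    because the laws agree.\<close>
  have transfer: "AE w in \<Omega>. \<Phi> (W k w)" if "Measurable.pred borel \<Phi>" "AE p in P. \<Phi> (e (s k) p)" for \<Phi> k
  proof -
    have [measurable]: "Measurable.pred borel \<Phi>" by (rule that(1))
    have "AE y in distr P borel (e (s k)). \<Phi> y" using that(2) by (subst AE_distr_iff) auto
    then have "AE y in distr \<Omega> borel (W k). \<Phi> y" unfolding law .
    then show ?thesis by (subst (asm) AE_distr_iff) auto
  qed
  \<comment> \<open>The support of the initial measure confines the starting points; it supplies the
    bound required by \<open>data_convergence\<close>.\<close>
  obtain R where R: "emeasure \<mu>p (- cball 0 R) = 0" using \<mu>p by (auto simp: finite_borel_bounded_support_def)
  have start: "AE p in P. norm (X k p 0) \<le> R" for k
  proof -
    have [measurable]: "(\<lambda>p. chi k p 0) \<in> borel_measurable P" by (rule irrigation_pattern_measurable_at[OF chi]) simp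
    have "AE y in distr P borel (\<lambda>p. chi k p 0). y \<notin> - cball 0 R"
      using marg(1)[of k] R by (intro AE_not_in) (auto simp: null_sets_def mu_plus_def)
    then have "AE p in P. norm (chi k p 0) \<le> R" by (subst (asm) AE_distr_iff) auto
    moreover have "AE p in P. X k p 0 = chi k p 0" using XL[of k] by (auto simp: good_def elim: AE_mp)
    ultimately show ?thesis by eventually_elim simp
  qed
  have AE_W: "AE w in \<Omega>. \<forall>k. (\<forall>i. 0 < decode (W k w) i \<and> decode (W k w) i < 1) \<and>
      data_lipschitz TYPE('b) (decode (W k w)) \<and> norm (PX (W k w) 0) \<le> R"
    unfolding AE_all_countable
  proof
    fix k
    have 1: "Measurable.pred borel (\<lambda>y. data_lipschitz TYPE('b) (decode y))" by (rule pred_data_lipschitz) measurable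
    show "AE w in \<Omega>. (\<forall>i. 0 < decode (W k w) i \<and> decode (W k w) i < 1) \<and>
      data_lipschitz TYPE('b) (decode (W k w)) \<and> norm (PX (W k w) 0) \<le> R"
    proof (rule transfer)
      show "Measurable.pred borel (\<lambda>y. (\<forall>i. 0 < decode y i \<and> decode y i < 1) \<and> data_lipschitz TYPE('b) (decode y) \<and> norm (PX y 0) \<le> R)"
        using 1 by measurable
      show "AE p in P. (\<forall>i. 0 < decode (e (s k) p) i \<and> decode (e (s k) p) i < 1) \<and>
          data_lipschitz TYPE('b) (decode (e (s k) p)) \<and> norm (PX (e (s k) p) 0) \<le> R"
        using start[of "s k"] by eventually_elim (auto simp: XeL dec path_data_bounds XeL(3)[unfolded dec])
    qed
  qed
  \<comment> \<open>The cost bounds mean lengths uniformly in \<open>k\<close>. Fatou's lemma turns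
    this into a finite lower limit for almost every sample.\<close>
  have AE_L: "AE w in \<Omega>. liminf (\<lambda>k. ennreal (PL (W k w))) < \<infinity>"
  proof -
    define c where "c = \<tau> m / m"
    have c: "c > 0" using m \<tau>(1) by (simp add: c_def transportation_cost_def)
    have r: "r_tau \<tau> m = ennreal c" using m by (simp add: r_tau_def c_def)
    have intL: "(\<integral>\<^sup>+p. ennreal (L k p) \<partial>P) \<le> ennreal (1 / c) * C1" for k
    proof -
      have "ennreal c * (\<integral>\<^sup>+p. ennreal (L k p) \<partial>P) \<le> C1"
        using XL[of k] J[of k] C(2)[of k] unfolding good_def r by (meson order_trans)
      then have "ennreal (1 / c) * (ennreal c * (\<integral>\<^sup>+p. ennreal (L k p) \<partial>P)) \<le> ennreal (1 / c) * C1"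
        by (rule mult_left_mono) simp
      moreover have "ennreal (1 / c) * ennreal c = 1" using c by (simp add: ennreal_mult[symmetric])
      ultimately show ?thesis by (simp add: mult.assoc[symmetric])
    qed
    have intW: "(\<integral>\<^sup>+w. ennreal (PL (W k w)) \<partial>\<Omega>) \<le> ennreal (1 / c) * C1" for k
    proof -
      have "(\<integral>\<^sup>+w. ennreal (PL (W k w)) \<partial>\<Omega>) = (\<integral>\<^sup>+y. ennreal (PL y) \<partial>distr \<Omega> borel (W k))"
        by (subst nn_integral_distr) auto
      also have "\<dots> = (\<integral>\<^sup>+p. ennreal (PL (e (s k) p)) \<partial>P)"
        unfolding law by (subst nn_integral_distr) auto
      also have "\<dots> \<le> ennreal (1 / c) * C1" unfolding XeL by (rule intL)
      finally show ?thesis .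
    qed
    have "(\<integral>\<^sup>+w. liminf (\<lambda>k. ennreal (PL (W k w))) \<partial>\<Omega>) \<le> liminf (\<lambda>k. \<integral>\<^sup>+w. ennreal (PL (W k w)) \<partial>\<Omega>)"
      by (rule nn_integral_liminf) measurable
    also have "\<dots> \<le> limsup (\<lambda>k. \<integral>\<^sup>+w. ennreal (PL (W k w)) \<partial>\<Omega>)" by (rule Liminf_le_Limsup) simp
    also have "\<dots> \<le> ennreal (1 / c) * C1" by (rule Limsup_bounded) (simp add: intW)
    also have "\<dots> < \<infinity>" using C(3) by (simp add: ennreal_mult_less_top)
    finally have "(\<integral>\<^sup>+w. liminf (\<lambda>k. ennreal (PL (W k w))) \<partial>\<Omega>) \<noteq> \<infinity>" by simp
    then have "AE w in \<Omega>. liminf (\<lambda>k. ennreal (PL (W k w))) \<noteq> \<infinity>" by (intro nn_integral_PInf_AE) measurable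
    then show ?thesis by eventually_elim (simp add: less_top)
  qed
  have AE_conv: "AE w in \<Omega>. (\<forall>t. (\<lambda>k. PX (W k w) t) \<longlonglongrightarrow> PX (W' w) t) \<and> (\<lambda>k. PL (W k w)) \<longlonglongrightarrow> PL (W' w)"
    using conv AE_W AE_L
  proof eventually_elim
    case (elim w)
    note dc = data_convergence[where 'b='b and z="\<lambda>k. decode (W k w)" and z'="decode (W' w)" and R=R]
    show ?case unfolding PX_def PL_def
      by (intro conjI allI dc) (use elim in \<open>auto simp: PX_def PL_def\<close>)
  qed
  \<comment> \<open>A variable on \<open>P\<close> with the law of the limit code; decoding it gives
    the candidate pattern.\<close>
  obtain V where V: "V \<in> borel_measurable P" "distr P borel V = distr \<Omega> borel W'"
    by (rule atomless_realization[OF fin mass setsP atomless \<Omega> W(2)])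
  note V(1)[measurable]
  define chi' where "chi' p = PX (V p)" for p
  have finD: "finite_measure (distr M borel f)" if "finite_measure M" "f \<in> borel_measurable M" for M :: "'g measure" and f :: "'g \<Rightarrow> real"
    using that by (intro finite_measure.finite_measure_distr)
  have finR: "finite_measure (distr M borel f)" if "finite_measure M" "f \<in> borel_measurable M" for M :: "real measure" and f :: "real \<Rightarrow> real"
    using that by (intro finite_measure.finite_measure_distr)
  have LPV: "lipschitz_paths P chi' (\<lambda>p. PL (V p))"
    unfolding chi'_def using LPM[OF fin V(1)] by simp
  have energyW: "discrete_energy \<tau> \<Omega> (\<lambda>w. PX (W k w)) (\<lambda>w. PL (W k w)) N d = discrete_energy \<tau> P (X (s k)) (L (s k)) N d" for k N d
  proof -
    have "discrete_energy \<tau> \<Omega> (\<lambda>w. PX (W k w)) (\<lambda>w. PL (W k w)) N d = discrete_energy \<tau> (distr \<Omega> borel (W k)) PX PL N d"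
      by (rule discrete_energy_distr[OF \<tau>(1) W(1) \<Omega>(1), symmetric]) (rule LPD[OF finR[OF \<Omega>(1) W(1)]], simp)
    also have "\<dots> = discrete_energy \<tau> (distr P borel (e (s k))) PX PL N d" unfolding law ..
    also have "\<dots> = discrete_energy \<tau> P (\<lambda>p. PX (e (s k) p)) (\<lambda>p. PL (e (s k) p)) N d"
      by (rule discrete_energy_distr[OF \<tau>(1) e_meas fin]) (rule LPD[OF finD[OF fin e_meas]], simp)
    finally show ?thesis by (simp add: XeL)
  qed
  have energyV: "discrete_energy \<tau> P chi' (\<lambda>p. PL (V p)) N d = discrete_energy \<tau> \<Omega> (\<lambda>w. PX (W' w)) (\<lambda>w. PL (W' w)) N d" for N d
  proof -
    have "discrete_energy \<tau> P chi' (\<lambda>p. PL (V p)) N d = discrete_energy \<tau> (distr P borel V) PX PL N d"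
      unfolding chi'_def by (rule discrete_energy_distr[OF \<tau>(1) V(1) fin, symmetric]) (rule LPD[OF finD[OF fin V(1)]], simp)
    also have "\<dots> = discrete_energy \<tau> (distr \<Omega> borel W') PX PL N d" unfolding V(2) ..
    also have "\<dots> = discrete_energy \<tau> \<Omega> (\<lambda>w. PX (W' w)) (\<lambda>w. PL (W' w)) N d"
      by (rule discrete_energy_distr[OF \<tau>(1) W(2) \<Omega>(1)]) (rule LPD[OF finR[OF \<Omega>(1) W(2)]], simp)
    finally show ?thesis .
  qed
  \<comment> \<open>The energies of the original paths equal those of their copies on \<Omega>,
    semicontinuity is applied there, and the energy of the limit equals that of the candidate on
    \<open>P\<close>.\<close>
  have energy: "discrete_energy \<tau> P chi' (\<lambda>p. PL (V p)) (Suc N) d \<le> C0" for N d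
  proof -
    have "paths_converge \<Omega> (\<lambda>k w. PX (W k w)) (\<lambda>k w. PL (W k w)) (\<lambda>w. PX (W' w)) (\<lambda>w. PL (W' w))"
      unfolding paths_converge_def using AE_conv by eventually_elim blast
    then have "discrete_energy \<tau> \<Omega> (\<lambda>w. PX (W' w)) (\<lambda>w. PL (W' w)) (Suc N) d \<le>
        liminf (\<lambda>k. discrete_energy \<tau> \<Omega> (\<lambda>w. PX (W k w)) (\<lambda>w. PL (W k w)) (Suc N) d)"
      by (intro discrete_energy_lower_semicontinuous[OF \<tau>] LPR[OF \<Omega>(1)] W)
    also have "\<dots> \<le> liminf (\<lambda>k. C (s k))"
    proof (intro Liminf_mono always_eventually allI)
      fix k show "discrete_energy \<tau> \<Omega> (\<lambda>w. PX (W k w)) (\<lambda>w. PL (W k w)) (Suc N) d \<le> C (s k)"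
        unfolding energyW using XL[of "s k"] J[of "s k"] unfolding good_def by (meson order_trans)
    qed
    also have "\<dots> = C0"
      by (rule lim_imp_Liminf) (use LIMSEQ_subseq_LIMSEQ[OF C(1) s] in \<open>auto simp: o_def\<close>)
    finally show ?thesis unfolding energyV .
  qed
  \<comment> \<open>Used at times 0 and 1, where reparametrization has kept the positions and the
    laws are prescribed.\<close>
  have limit_law: "distr P borel (\<lambda>p. chi' p t) = \<mu>"
    if t: "\<And>k. AE p in P. X k p t = chi k p t" "t \<in> {0..1}" and \<mu>: "\<And>k. distr P borel (\<lambda>p. chi k p t) = \<mu>" for t \<mu>
  proof -
    have "distr P borel (\<lambda>p. chi' p t) = distr (distr P borel V) borel (\<lambda>y. PX y t)"
      by (subst distr_distr) (auto simp: chi'_def o_def)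
    also have "\<dots> = distr \<Omega> borel (\<lambda>w. PX (W' w) t)" unfolding V(2) by (subst distr_distr) (auto simp: o_def)
    also have "\<dots> = \<mu>"
    proof (rule distr_eq_of_AE_limit[OF \<Omega>(1)])
      show "AE w in \<Omega>. (\<lambda>k. PX (W k w) t) \<longlonglongrightarrow> PX (W' w) t" using AE_conv by eventually_elim blast
      fix k
      have "distr \<Omega> borel (\<lambda>w. PX (W k w) t) = distr (distr \<Omega> borel (W k)) borel (\<lambda>y. PX y t)"
        by (subst distr_distr) (auto simp: o_def)
      also have "\<dots> = distr P borel (\<lambda>p. X (s k) p t)" unfolding law by (subst distr_distr) (auto simp: o_def XeL)
      also have "\<dots> = distr P borel (\<lambda>p. chi (s k) p t)"
        by (rule distr_cong_AE[OF refl refl t(1)])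
           (auto intro: lipschitz_paths.measurable_X[OF LP] irrigation_pattern_measurable_at[OF chi t(2)])
      also have "\<dots> = \<mu>" by (rule \<mu>)
      finally show "distr \<Omega> borel (\<lambda>w. PX (W k w) t) = \<mu>" .
    qed measurable
    finally show ?thesis .
  qed
  show thesis
  proof (rule that[of chi'])
    show "irrigation_pattern P chi'"
      unfolding irrigation_pattern_def
      using lipschitz_paths.measurable_X_I[OF LPV] lipschitz_paths.abs_cont_X[OF LPV] by (simp add: case_prod_beta)
    show "mu_plus P chi' = \<mu>p"
      unfolding mu_plus_def
    proof (rule limit_law)
      show "AE p in P. X k p 0 = chi k p 0" for k using XL[of k] by (auto simp: good_def elim: AE_mp)
    qed (use marg in \<open>auto simp: mu_plus_def\<close>)
    show "mu_minus P chi' = \<mu>m"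
      unfolding mu_minus_def
    proof (rule limit_law)
      show "AE p in P. X k p 1 = chi k p 1" for k using XL[of k] by (auto simp: good_def elim: AE_mp)
    qed (use marg in \<open>auto simp: mu_minus_def\<close>)
    show "J_tau \<tau> P chi' \<le> C0"
      by (rule lipschitz_paths.J_tau_le_discrete_energy[OF LPV \<tau> energy])
  qed
qed

theorem mainTheorem10:
  fixes P :: "'g::polish_space measure"
    and \<tau> :: "real \<Rightarrow> real"
    and \<mu>p \<mu>m :: "(real ^ 'n) measure"
  assumes "reference_measure P"
    and "transportation_cost \<tau>"
    and "concave_on {0..} \<tau>"
    and "finite_borel_bounded_support \<mu>p"
    and "finite_borel_bounded_support \<mu>m"
  shows "(\<exists>chi. irrigation_pattern P chi \<and>
            (\<forall>chi'. irrigation_pattern P chi' \<longrightarrow> J_tau_mu \<tau> P \<mu>p \<mu>m chi \<le> J_tau_mu \<tau> P \<mu>p \<mu>m chi'))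
       \<or> (\<forall>chi. irrigation_pattern P chi \<longrightarrow> J_tau_mu \<tau> P \<mu>p \<mu>m chi = \<infinity>)"
proof -
  define F where "F = (J_tau_mu \<tau> P \<mu>p \<mu>m :: ('g \<Rightarrow> real \<Rightarrow> real ^ 'n) \<Rightarrow> ennreal)"
  define I where "I = (INF chi\<in>Collect (irrigation_pattern P). F chi)"
  show ?thesis
  proof (cases "I = \<infinity>")
    case True
    have "F chi = \<infinity>" if "irrigation_pattern P chi" for chi
    proof -
      have "I \<le> F chi" unfolding I_def using that by (intro INF_lower) simp
      then show ?thesis using True by (simp add: top_unique)
    qed
    then show ?thesis unfolding F_def by blast
  next
    case False
    \<comment> \<open>A finite infimum lies strictly below each \<open>C k\<close>, which yields a
      minimizing sequence.\<close>
    define C where "C k = I + ennreal (1 / real (Suc k))" for k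
    have "\<exists>chi. irrigation_pattern P chi \<and> F chi < C k" for k
    proof -
      have "I < C k" using False unfolding C_def
        by (simp add: ennreal_add_left_cancel_less[of I 0, simplified] less_top[symmetric] del: of_nat_Suc)
      then show ?thesis unfolding I_def INF_less_iff by auto
    qed
    then obtain chi where chi: "\<And>k. irrigation_pattern P (chi k)" "\<And>k. F (chi k) < C k" by metis
    \<comment> \<open>A finite value of the functional forces the prescribed initial and final
      measures.\<close>
    have marg: "mu_plus P (chi k) = \<mu>p \<and> mu_minus P (chi k) = \<mu>m" for k
    proof (rule ccontr)
      assume "\<not> ?thesis"
      then have "F (chi k) = \<infinity>" by (auto simp: F_def J_tau_mu_def)
      then show False using chi(2)[of k] by simp
    qed
    then have J: "J_tau \<tau> P (chi k) \<le> C k" for k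
      using chi(2)[of k] by (simp add: F_def J_tau_mu_def less_imp_le)
    have "C \<longlonglongrightarrow> I + ennreal 0"
      unfolding C_def by (intro tendsto_add tendsto_const tendsto_ennrealI tendsto_one_over_Suc)
    then have lim: "C \<longlonglongrightarrow> I" by simp
    have C1: "C k \<le> I + 1" for k
    proof -
      have "ennreal (1 / real (Suc k)) \<le> ennreal 1" by (rule ennreal_leI) simp
      then show ?thesis unfolding C_def by (simp add: add_left_mono del: of_nat_Suc)
    qed
    have "I + 1 < \<infinity>" using False by (simp add: less_top[symmetric])
    then obtain chi' where "irrigation_pattern P chi'" "mu_plus P chi' = \<mu>p" "mu_minus P chi' = \<mu>m" "J_tau \<tau> P chi' \<le> I"
      using irrigation_pattern_compactness[OF assms(1-4) chi(1) conjunct1[OF marg] conjunct2[OF marg] J lim C1] by blast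
    then have "irrigation_pattern P chi'" "F chi' \<le> I" by (auto simp: F_def J_tau_mu_def)
    moreover have "I \<le> F c" if "irrigation_pattern P c" for c
      unfolding I_def using that by (intro INF_lower) simp
    ultimately show ?thesis unfolding F_def by (meson order_trans)
  qed
qed

end
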